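(* Let $W$ be a tournamenton. Then $C(W,4)=c(4)=4/3$ if and only if $W$ is weakly isomorphic to the carousel tournamenton $W_C$, and $C(W,8)=c(8)=332/315$ if and only if $W$ is weakly isomorphic to $W_C$.
   Context: A tournamenton is a measurable $W:[0,1]^2\to[0,1]$ with $W(x,y)+W(y,x)=1$ for all $x,y$. $C(W,\ell)=2^{\ell}\int_{[0,1]^\ell}W(x_1,x_2)W(x_2,x_3)\cdots W(x_\ell,x_1)\,dx_1\cdots dx_\ell$. For $n\ge\ell$, $C(n,\ell)$ is the maximum number of directed cycles of length $\ell$ in an $n$-vertex tournament, $R(n,\ell)=\frac{(\ell-1)!}{2^\ell}\binom n\ell$, and $c(\ell)=\lim_{n\to\infty}C(n,\ell)/R(n,\ell)$. An $n$-vertex $W$-random tournament is obtained by sampling $x_1,\dots,x_n$ independently and uniformly from $[0,1]$ and orienting the edge between vertices $i$ and $j$ from $i$ to $j$ with probability $W(x_i,x_j)$ (independently). The density $d(T,W)$ of a tournament $T$ in $W$ is the probability that the $|T|$-vertex $W$-random tournament is isomorphic to $T$. Tournamentons $W,W'$ are weakly isomorphic if $d(T,W)=d(T,W')$ for every tournament $T$. The carousel tournamenton $W_C$ is defined by $W_C(x,x)=1/2$, $W_C(x,y)=1$ if $y\in(x-1,x-1/2)\cup(x,x+1/2]$, and $W_C(x,y)=0$ otherwise. *)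

theory Defs
  imports "HOL-Probability.Probability" "Graph_Theory.Graph_Theory"
begin

section \<open>Tournaments and their cycles\<close>

locale tournament = pair_digraph T for T :: "'a pair_pre_digraph" +
  assumes tournament_arcs:
    "u \<in> pverts T \<Longrightarrow> v \<in> pverts T \<Longrightarrow> u \<noteq> v \<Longrightarrow> (u, v) \<in> parcs T \<longleftrightarrow> (v, u) \<notin> parcs T"

text \<open>
  The library represents a cycle by its list of arcs, starting from some base vertex, so every
  cycle occurs once per base vertex. Cycles are counted as subgraphs here, so they are
  identified with their sets of arcs.
\<close>

definition num_cycles :: "'a pair_pre_digraph \<Rightarrow> nat \<Rightarrow> nat" where
  "num_cycles T l = card {set p | p. pre_digraph.cycle (with_proj T) p \<and> length p = l}"

definition max_cycles :: "nat \<Rightarrow> nat \<Rightarrow> nat" where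
  "max_cycles n l =
     Max ((\<lambda>T. num_cycles T l) ` {T :: nat pair_pre_digraph. tournament T \<and> pverts T = {..<n}})"

definition random_cycles :: "nat \<Rightarrow> nat \<Rightarrow> real" where
  "random_cycles n l = fact (l - 1) / 2 ^ l * real (n choose l)"

definition cycle_limit :: "nat \<Rightarrow> real" where
  "cycle_limit l = lim (\<lambda>n. real (max_cycles n l) / random_cycles n l)"


section \<open>Tournamentons\<close>

text \<open>Only the values on the unit square matter. Measurability is Lebesgue measurability.\<close>

definition tournamenton :: "(real \<Rightarrow> real \<Rightarrow> real) \<Rightarrow> bool" where
  "tournamenton W \<longleftrightarrow>
     (\<lambda>(x, y). W x y) \<in> borel_measurable (lebesgue_on ({0..1} \<times> {0..1})) \<and>
     (\<forall>x\<in>{0..1}. \<forall>y\<in>{0..1}. W x y \<in> {0..1} \<and> W x y + W y x = 1)"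

text \<open>
  Lebesgue measure on the cube of side 1 and dimension n, which is also the law of n independent
  uniform points. The completion is needed since W is only assumed Lebesgue measurable.
\<close>

definition unit_cube :: "nat \<Rightarrow> (nat \<Rightarrow> real) measure" where
  "unit_cube n = completion (\<Pi>\<^sub>M i\<in>{..<n}. restrict_space lborel {0..1})"

definition cycle_density :: "(real \<Rightarrow> real \<Rightarrow> real) \<Rightarrow> nat \<Rightarrow> real" where
  "cycle_density W l = 2 ^ l * (\<integral>x. (\<Prod>i<l. W (x i) (x (Suc i mod l))) \<partial>unit_cube l)"

text \<open>
  The random tournament for given points x: the coin b (i, j) for i < j decides whether the
  edge between i and j is oriented from i to j.
\<close>

definition random_orientation ::
  "(real \<Rightarrow> real \<Rightarrow> real) \<Rightarrow> nat \<Rightarrow> (nat \<Rightarrow> real) \<Rightarrow> nat pair_pre_digraph pmf" where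
  "random_orientation W n x =
     map_pmf
       (\<lambda>b. \<lparr> pverts = {..<n},
             parcs = {(i, j) | i j. i < j \<and> j < n \<and> b (i, j)} \<union>
                     {(j, i) | i j. i < j \<and> j < n \<and> \<not> b (i, j)} \<rparr>)
       (Pi_pmf {(i, j). i < j \<and> j < n} False (\<lambda>(i, j). bernoulli_pmf (W (x i) (x j))))"

definition random_tournament ::
  "(real \<Rightarrow> real \<Rightarrow> real) \<Rightarrow> nat \<Rightarrow> nat pair_pre_digraph measure" where
  "random_tournament W n = unit_cube n \<bind> (\<lambda>x. measure_pmf (random_orientation W n x))"

definition tournament_density :: "'a pair_pre_digraph \<Rightarrow> (real \<Rightarrow> real \<Rightarrow> real) \<Rightarrow> real" where
  "tournament_density T W =
     measure (random_tournament W (card (pverts T)))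
       {S. digraph_iso (with_proj S) (with_proj T)}"

text \<open>Every finite tournament is isomorphic to one whose vertices are natural numbers.\<close>

definition weakly_isomorphic ::
  "(real \<Rightarrow> real \<Rightarrow> real) \<Rightarrow> (real \<Rightarrow> real \<Rightarrow> real) \<Rightarrow> bool" where
  "weakly_isomorphic W W' \<longleftrightarrow>
     (\<forall>T :: nat pair_pre_digraph. tournament T \<longrightarrow> tournament_density T W = tournament_density T W')"

text \<open>
  At the two corners (0, 1) and (1, 0) this function is 0, so W x y + W y x = 1 fails there.
  This is a null set and does not affect any density.
\<close>

definition carousel :: "real \<Rightarrow> real \<Rightarrow> real" where
  "carousel x y =
     (if x = y then 1/2
      else if y \<in> {x - 1 <..< x - 1/2} \<union> {x <.. x + 1/2} then 1
      else 0)"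

end

theory Submission imports Defs begin

text \<open>
  Write \<open>W = (1 + S) / 2\<close> with S skew and \<open>\<bar>S\<bar> \<le> 1\<close>. Expanding the trace of the l-th power of
  \<open>2 W = 1 + S\<close>, for l = 4 and l = 8, gives 1 plus the trace of \<open>S ^ l\<close> plus a correction that is negative
  unless S is regular, that is, \<open>S 1 = 0\<close>. The trace of \<open>S ^ 4\<close> is a third of the mean of the sum of the
  three signed 4-cycles on four random points, and that sum is at most 1. The trace of \<open>S ^ 8\<close> is the mean of the
  squared norm of \<open>S ^ 3 (S x)\<close>. Switching by the signs of \<open>S x\<close> (after making S random
  where it is not a sign) reduces its bound to that of the squared norm of \<open>S ^ 3 1\<close>, which follows from an inequality
  between the numbers of 3-, 5- and 7-cycles in a tournament on seven vertices.

  In both cases equality means that S is regular and that almost surely no vertex dominates or is dominated by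
  a cyclic triangle. For such S the probability of a labelled tournament does not change when one vertex is
  switched: with u as the last vertex, the pattern of u is decided by its arcs to two other vertices, and by regularity
  the two opposite patterns have the same probability. As all locally transitive tournaments
  arise from each other by switching and relabelling, they all have the same probability, so S determines
  a single weak isomorphism class, which contains the carousel. Conversely the cycle densities are sums of
  labelled densities. Finally c(l) is found by evaluating the bounds on finite tournaments, blown up to
  kernels, and by sampling from the carousel.
\<close>

section \<open>Closed walks and tournaments on six vertices\<close>

text \<open>The constants come from the linear order. For the kernel \<open>sgn (y - x)\<close> on
  the unit interval the squared norms of \<open>S 1\<close> and \<open>S ^ 3 1\<close> are 1/3 and
  17/315. In the carousel, switching by the signs of any \<open>S x\<close> produces a linear order,
  so the same numbers are its traces of \<open>S ^ 4\<close> and \<open>S ^ 8\<close>. No spectral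
  theory enters. Fixing the base point x of a closed walk turns the trace of \<open>S ^ 8\<close>
  into a bound on \<open>S ^ 3 f\<close> over all f with values in [-1, 1], and switching makes f =
  1 the general case. The squared norm of \<open>S ^ 3 1\<close> is a combination of 3-, 5- and
  7-cycle densities, so seven vertices are enough for an 8-cycle problem. For a tournament with c3,
  c5 and c7 such cycles the inequality reads \<open>5 * c5 <= 8 * c3 + 10 * c7\<close>, with
  equality for the transitive one. Equality at f = 1 means that there are no cyclic triangles, which
  is also equality for \<open>S ^ 4\<close>; hence both lengths have the same extremal kernels.
  Their uniqueness requires no description of the kernels: densities that are constant on a finite
  set of tournaments, zero elsewhere and of sum 1 are determined.\<close>

definition dlists :: "nat \<Rightarrow> 'a set \<Rightarrow> 'a list set" where
  "dlists k R = {xs. distinct xs \<and> length xs = k \<and> set xs \<subseteq> R}"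

definition closed_walk :: "('a \<Rightarrow> 'a \<Rightarrow> 'b::comm_monoid_mult) \<Rightarrow> 'a list \<Rightarrow> 'b" where
  "closed_walk w xs = (\<Prod>i<length xs. w (xs ! i) (xs ! (Suc i mod length xs)))"

fun open_walk :: "('a \<Rightarrow> 'a \<Rightarrow> 'b::comm_monoid_mult) \<Rightarrow> 'a list \<Rightarrow> 'b" where
  "open_walk w (x # y # zs) = w x y * open_walk w (y # zs)"
| "open_walk w _ = 1"

lemma Suc_mod_less: "i < n \<Longrightarrow> Suc i mod n < n"
  by (rule mod_less_divisor) linarith

lemma finite_dlists [simp]: "finite R \<Longrightarrow> finite (dlists k R)"
  unfolding dlists_def by (rule finite_subset[OF _ finite_lists_length_eq[of R k]]) auto

lemma dlists_0 [simp]: "dlists 0 R = {[]}"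
  by (auto simp: dlists_def)

lemma sum_dlists_Suc:
  fixes f :: "'a list \<Rightarrow> 'b::comm_monoid_add"
  assumes "finite R"
  shows "(\<Sum>xs\<in>dlists (Suc k) R. f xs) = (\<Sum>b\<in>R. \<Sum>xs\<in>dlists k (R - {b}). f (b # xs))"
proof -
  have "(\<Sum>b\<in>R. \<Sum>xs\<in>dlists k (R - {b}). f (b # xs))
      = (\<Sum>(b, xs)\<in>(SIGMA b:R. dlists k (R - {b})). f (b # xs))"
    using assms by (subst sum.Sigma) auto
  also have "\<dots> = (\<Sum>xs\<in>dlists (Suc k) R. f xs)"
    by (rule sum.reindex_bij_witness[where i = "\<lambda>xs. (hd xs, tl xs)" and j = "\<lambda>(b, xs). b # xs"])
      (auto simp: dlists_def length_Suc_conv)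
  finally show ?thesis ..
qed

lemma open_walk_snoc:
  "xs \<noteq> [] \<Longrightarrow> open_walk w (xs @ [z]) = open_walk w xs * w (last xs) z"
  by (induction w xs rule: open_walk.induct) (auto simp: mult.assoc)

lemma open_walk_eq_prod:
  "open_walk w xs = (\<Prod>i<length xs - 1. w (xs ! i) (xs ! Suc i))"
proof (induction w xs rule: open_walk.induct)
  case (1 w x y zs)
  have "(\<Prod>i<Suc (length zs). w ((x # y # zs) ! i) ((x # y # zs) ! Suc i))
    = w x y * (\<Prod>i<length zs. w ((y # zs) ! i) ((y # zs) ! Suc i))"
    by (subst prod.lessThan_Suc_shift) simp
  then show ?case using 1 by simp
qed auto

lemma closed_walk_Cons: "closed_walk w (a # ys) = open_walk w (a # ys @ [a])"
proof -
  have "(\<Prod>i<length (a # ys). w ((a # ys) ! i) ((a # ys) ! (Suc i mod length (a # ys))))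
    = (\<Prod>i<length (a # ys). w ((a # ys @ [a]) ! i) ((a # ys @ [a]) ! Suc i))"
  proof (rule prod.cong[OF refl])
    fix i assume "i \<in> {..<length (a # ys)}"
    then have i: "i < Suc (length ys)" by simp
    have "(a # ys) ! i = (a # ys @ [a]) ! i"
      using i by (cases i) (auto simp: nth_append)
    moreover have "(a # ys) ! (Suc i mod length (a # ys)) = (a # ys @ [a]) ! Suc i"
      using i by (cases "i = length ys") (auto simp: nth_append)
    ultimately show "w ((a # ys) ! i) ((a # ys) ! (Suc i mod length (a # ys)))
        = w ((a # ys @ [a]) ! i) ((a # ys @ [a]) ! Suc i)" by simp
  qed
  then show ?thesis by (simp add: closed_walk_def open_walk_eq_prod)
qed

lemma closed_walk_Cons_last:
  "closed_walk w (a # ys) = open_walk w (a # ys) * w (last (a # ys)) a"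
  unfolding closed_walk_Cons using open_walk_snoc[of "a # ys" w a] by simp

text \<open>One entry for each path of k steps from a, with multiplicity. The last vertex is all
  that has to be kept, because closing a path, directly or through a seventh vertex, depends on it
  alone.\<close>

fun ends :: "('a \<Rightarrow> 'a \<Rightarrow> bool) \<Rightarrow> nat \<Rightarrow> 'a list \<Rightarrow> 'a \<Rightarrow> 'a list" where
  "ends A 0 R a = [a]"
| "ends A (Suc k) R a = concat (map (\<lambda>b. if A a b then ends A k (remove1 b R) b else []) R)"

abbreviation ind :: "('a \<Rightarrow> 'a \<Rightarrow> bool) \<Rightarrow> 'a \<Rightarrow> 'a \<Rightarrow> real" where
  "ind A \<equiv> (\<lambda>i j. of_bool (A i j))"

text \<open>The free function g becomes the closing arc, which may lead back to a or to a vertex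
  outside R.\<close>

lemma sum_open_walk_ends:
  fixes g :: "'a \<Rightarrow> real"
  assumes "distinct R"
  shows "(\<Sum>xs\<in>dlists k (set R). open_walk (ind A) (a # xs) * g (last (a # xs)))
      = (\<Sum>b\<leftarrow>ends A k R a. g b)"
  using assms
proof (induction k arbitrary: R a)
  case (Suc k)
  have "(\<Sum>xs\<in>dlists (Suc k) (set R). open_walk (ind A) (a # xs) * g (last (a # xs)))
     = (\<Sum>b\<in>set R. of_bool (A a b) * (\<Sum>xs\<in>dlists k (set (remove1 b R)). open_walk (ind A) (b # xs) * g (last (b # xs))))"
    using Suc.prems by (simp add: sum_dlists_Suc sum_distrib_left mult.assoc)
  also have "\<dots> = (\<Sum>b\<in>set R. of_bool (A a b) * (\<Sum>c\<leftarrow>ends A k (remove1 b R) b. g c))"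
    using Suc.prems by (intro sum.cong refl arg_cong2[of _ _ _ _ "(*)"] Suc.IH) auto
  also have "\<dots> = (\<Sum>b\<leftarrow>R. of_bool (A a b) * (\<Sum>c\<leftarrow>ends A k (remove1 b R) b. g c))"
    using Suc.prems by (simp add: sum_list_distinct_conv_sum_set)
  also have "\<dots> = (\<Sum>c\<leftarrow>ends A (Suc k) R a. g c)"
  proof -
    have "(\<Sum>c\<leftarrow>concat yss. g c) = (\<Sum>ys\<leftarrow>yss. \<Sum>c\<leftarrow>ys. g c)" for yss :: "'a list list"
      by (induction yss) auto
    then show ?thesis by (auto simp: comp_def intro!: arg_cong[of _ _ sum_list])
  qed
  finally show ?case .
qed simp

text \<open>A tournament on the vertices below n is coded by the list of its columns above the diagonal.\<close>

definition col_adj :: "bool list list \<Rightarrow> nat \<Rightarrow> nat \<Rightarrow> bool" where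
  "col_adj T i j = (if i < j then T ! j ! i else if j < i then \<not> T ! i ! j else False)"

definition columns :: "nat \<Rightarrow> (nat \<Rightarrow> nat \<Rightarrow> bool) \<Rightarrow> bool list list" where
  "columns n A = map (\<lambda>j. map (\<lambda>i. A i j) [0..<j]) [0..<n]"

definition outdegs :: "nat \<Rightarrow> bool list list \<Rightarrow> int list" where
  "outdegs n T = map (\<lambda>i. \<Sum>j\<leftarrow>[0..<n]. if col_adj T i j then 1 else 0) [0..<n]"

text \<open>Any order of the vertices would do; this one merges most isomorphic tournaments.\<close>

definition order_keys :: "nat \<Rightarrow> bool list list \<Rightarrow> int list \<Rightarrow> int list" where
  "order_keys n T d = map (\<lambda>i. \<Sum>j\<leftarrow>[0..<n]. if col_adj T i j then (d ! j + 1) * (d ! j + 1) else 0) [0..<n]"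

definition normal_order :: "nat \<Rightarrow> bool list list \<Rightarrow> nat list" where
  "normal_order n T = foldr (insort_key ((!) (order_keys n T (outdegs n T)))) [0..<n] []"

definition reorder :: "nat \<Rightarrow> bool list list \<Rightarrow> nat list \<Rightarrow> bool list list" where
  "reorder n T q = columns n (\<lambda>i j. col_adj T (q ! i) (q ! j))"

definition normalise :: "nat \<Rightarrow> bool list list \<Rightarrow> bool list list" where
  "normalise n T = reorder n T (normal_order n T)"

fun extensions :: "nat \<Rightarrow> bool list list \<Rightarrow> bool list list \<Rightarrow> bool list list list" where
  "extensions n T [] = []"
| "extensions n T (p # ps) = normalise n (T @ [p]) # extensions n T ps"

fun all_extensions :: "nat \<Rightarrow> bool list list list \<Rightarrow> bool list list \<Rightarrow> bool list list list" where
  "all_extensions n [] ps = []"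
| "all_extensions n (T # Ts) ps = extensions n T ps @ all_extensions n Ts ps"

text \<open>Isomorphic duplicates are harmless: \<open>remdups\<close> merges only extensions whose
  codes coincide, and what counts is that every tournament has a code in the list. Normalising after
  each new vertex keeps the list short.\<close>

fun normal_forms :: "nat \<Rightarrow> bool list list list" where
  "normal_forms 0 = [[]]"
| "normal_forms (Suc n) = remdups (all_extensions (Suc n) (normal_forms n) (List.n_lists n [True, False]))"

lemma set_extensions: "set (extensions n T ps) = (\<lambda>p. normalise n (T @ [p])) ` set ps"
  by (induction ps) auto

lemma set_all_extensions:
  "set (all_extensions n Ts ps) = (\<Union>T\<in>set Ts. (\<lambda>p. normalise n (T @ [p])) ` set ps)"
  by (induction Ts) (auto simp: set_extensions)

definition tourn :: "nat \<Rightarrow> (nat \<Rightarrow> nat \<Rightarrow> bool) \<Rightarrow> bool" where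
  "tourn n A \<longleftrightarrow> (\<forall>i<n. \<forall>j<n. i \<noteq> j \<longrightarrow> A i j = (\<not> A j i))"

lemma tourn_mono: "tourn n A \<Longrightarrow> m \<le> n \<Longrightarrow> tourn m A"
  unfolding tourn_def by (meson less_le_trans)

lemma tournD: "tourn n A \<Longrightarrow> i < n \<Longrightarrow> j < n \<Longrightarrow> i \<noteq> j \<Longrightarrow> A i j = (\<not> A j i)"
  unfolding tourn_def by blast

lemma length_columns [simp]: "length (columns n A) = n"
  by (simp add: columns_def)

lemma col_adj_columns:
  "tourn n A \<Longrightarrow> i < n \<Longrightarrow> j < n \<Longrightarrow> i \<noteq> j \<Longrightarrow> col_adj (columns n A) i j = A i j"
  using tournD[of n A i j] by (simp add: col_adj_def columns_def)

lemma normal_order_props: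
  "length (normal_order n T) = n" "set (normal_order n T) = {..<n}" "distinct (normal_order n T)"
  by (auto simp: normal_order_def simp flip: sort_key_def)

lemma bij_normal_order: "bij_betw (\<lambda>i. normal_order n T ! i) {..<n} {..<n}"
  using bij_betw_nth[OF normal_order_props(3)] by (simp add: normal_order_props)

lemma length_normal_forms: "T \<in> set (normal_forms n) \<Longrightarrow> length T = n"
  by (cases n) (auto simp: normalise_def reorder_def set_all_extensions)

text \<open>Vertex n is added to the normal form of the first n vertices, and the result is normalised again.\<close>

lemma ex_normal_form:
  "tourn n A \<Longrightarrow> \<exists>T\<in>set (normal_forms n). \<exists>\<sigma>. bij_betw \<sigma> {..<n} {..<n} \<and>
     (\<forall>i<n. \<forall>j<n. i \<noteq> j \<longrightarrow> col_adj T i j = A (\<sigma> i) (\<sigma> j))"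
proof (induction n)
  case 0
  have "bij_betw id {..<0::nat} {..<0}" by (simp add: bij_betw_def)
  then show ?case by (intro bexI[of _ "[]"] exI[of _ id]) (auto simp: bij_betw_def)
next
  case (Suc n)
  have "tourn n A" using Suc.prems by (rule tourn_mono) simp
  from Suc.IH[OF this] obtain T \<sigma> where T: "T \<in> set (normal_forms n)" and \<sigma>: "bij_betw \<sigma> {..<n} {..<n}"
    and A: "\<And>i j. i < n \<Longrightarrow> j < n \<Longrightarrow> i \<noteq> j \<Longrightarrow> col_adj T i j = A (\<sigma> i) (\<sigma> j)"
    by blast
  define p where "p = map (\<lambda>i. A (\<sigma> i) n) [0..<n]"
  define T' where "T' = T @ [p]"
  define \<tau> where "\<tau> = (\<lambda>i. if i = n then n else \<sigma> i)"
  define q where "q = normal_order (Suc n) T'"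
  have \<sigma>n: "\<sigma> i < n" if "i < n" for i
    using bij_betwE[OF \<sigma>] that by blast
  have \<tau>: "bij_betw \<tau> {..<Suc n} {..<Suc n}"
  proof -
    have "bij_betw \<tau> {..<n} {..<n}"
      using \<sigma> by (subst bij_betw_cong[where g = \<sigma>]) (auto simp: \<tau>_def)
    then show ?thesis
      using bij_betw_combine[of \<tau> "{..<n}" "{..<n}" "{n}" "{n}"]
      by (simp add: lessThan_Suc \<tau>_def bij_betw_def)
  qed
  have lenT: "length T = n" using T by (rule length_normal_forms)
  have T': "col_adj T' i j = A (\<tau> i) (\<tau> j)" if ij: "i < Suc n" "j < Suc n" "i \<noteq> j" for i j
  proof -
    have *: "A (\<sigma> i) n = (\<not> A n (\<sigma> i))" if "i < n" for i
      using tournD[OF Suc.prems, of "\<sigma> i" n] \<sigma>n[OF that] by simp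
    show ?thesis
    proof (cases "i = n \<or> j = n")
      case True
      then consider "i = n" "j < n" | "j = n" "i < n" using ij True by force
      then show ?thesis
      proof cases
        case 1
        then show ?thesis using lenT *[of j] by (simp add: col_adj_def T'_def \<tau>_def p_def nth_append)
      next
        case 2
        then show ?thesis using lenT by (simp add: col_adj_def T'_def \<tau>_def p_def nth_append)
      qed
    next
      case False
      then have "col_adj T' i j = col_adj T i j"
        using ij lenT by (auto simp: col_adj_def T'_def nth_append)
      then show ?thesis using False ij A by (simp add: \<tau>_def)
    qed
  qed
  have inj: "inj_on (\<lambda>i. q ! i) {..<Suc n}" and q: "\<And>i. i < Suc n \<Longrightarrow> q ! i < Suc n"
    using bij_normal_order[of "Suc n" T'] unfolding q_def[symmetric]
    by (auto simp: bij_betw_def)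
  have t': "tourn (Suc n) (\<lambda>i j. col_adj T' (q ! i) (q ! j))"
  proof -
    have "col_adj T' (q ! i) (q ! j) = (\<not> col_adj T' (q ! j) (q ! i))"
      if "i < Suc n" "j < Suc n" "i \<noteq> j" for i j
    proof -
      have "q ! i \<noteq> q ! j" using inj that by (auto dest: inj_onD)
      then show ?thesis by (simp add: col_adj_def)
    qed
    then show ?thesis unfolding tourn_def by blast
  qed
  have nf: "normalise (Suc n) T' \<in> set (normal_forms (Suc n))"
  proof -
    have "p \<in> set (List.n_lists n [True, False])" by (auto simp: p_def set_n_lists)
    then show ?thesis using T by (auto simp: T'_def set_all_extensions)
  qed
  have bij: "bij_betw (\<lambda>i. \<tau> (q ! i)) {..<Suc n} {..<Suc n}"
    using bij_betw_trans[OF bij_normal_order[of "Suc n" T'] \<tau>] by (simp add: q_def comp_def)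
  have "col_adj (normalise (Suc n) T') i j = A (\<tau> (q ! i)) (\<tau> (q ! j))"
    if ij: "i < Suc n" "j < Suc n" "i \<noteq> j" for i j
  proof -
    have "q ! i \<noteq> q ! j" using inj ij by (auto dest: inj_onD)
    then show ?thesis
      using col_adj_columns[OF t' ij] T'[of "q ! i" "q ! j"] q ij
      by (simp add: normalise_def reorder_def q_def)
  qed
  then show ?case
    using bij by (intro bexI[OF _ nf] exI[of _ "\<lambda>i. \<tau> (q ! i)"]) blast
qed

section \<open>Evaluation of the cycle inequality on tournament codes\<close>

definition end_row :: "(nat \<Rightarrow> nat \<Rightarrow> bool) \<Rightarrow> nat \<Rightarrow> int list" where
  "end_row A i = (let R = remove1 i [0..<6]; e1 = ends A 1 R i; e3 = ends A 3 R i; e5 = ends A 5 R i in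
     map (\<lambda>j. 8 * int (count_list e1 j) - 5 * int (count_list e3 j) + 10 * int (count_list e5 j)) [0..<6])"

text \<open>A 3-cycle is met from 3 starting vertices and a 5-cycle from 5, so they weigh 24 and
  -15. These are also the weights of cycles through a seventh vertex: 3 times the coefficients 8 and
  -5 in \<open>end_row\<close>, where each cycle is met once.\<close>

definition inner_count :: "(nat \<Rightarrow> nat \<Rightarrow> bool) \<Rightarrow> int" where
  "inner_count A = (\<Sum>i\<leftarrow>[0..<6]. let R = remove1 i [0..<6] in
     8 * int (length (filter (\<lambda>j. A j i) (ends A 2 R i)))
   - 3 * int (length (filter (\<lambda>j. A j i) (ends A 4 R i))))"

fun dot :: "bool list \<Rightarrow> int list \<Rightarrow> int" where
  "dot (p # ps) (h # hs) = (if p then dot ps hs else h + dot ps hs)"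
| "dot _ _ = 0"

text \<open>A seventh vertex splits the others into out-neighbours (True) and in-neighbours. Its
  contribution adds up the weights of the paths that lead from the former to the latter.\<close>

definition cut :: "bool list \<Rightarrow> int list list \<Rightarrow> int" where
  "cut ps H = sum_list (map2 (\<lambda>p h. if p then dot ps h else 0) ps H)"

definition extensions_ok :: "bool list list \<Rightarrow> bool" where
  "extensions_ok T = (let A = col_adj T; c = inner_count A; H = map (end_row A) [0..<6] in
     list_all (\<lambda>p. 0 \<le> c + 3 * cut p H) (List.n_lists 6 [True, False]))"

text \<open>The finite check behind the inequality: each code is combined with the 64 neighbourhoods
  of a seventh vertex. The path counts are computed once per code and serve all 64.\<close>

lemma all_extensions_ok: "list_all extensions_ok (normal_forms 6)"
  by code_simp

section \<open>A cycle inequality for tournaments on seven vertices\<close>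

text \<open>Only arcs between different vertices are compared, since \<open>col_adj\<close> and the
  coded relation may differ on the diagonal.\<close>

lemma ends_cong:
  assumes "\<And>x y. x \<in> insert a (set R) \<Longrightarrow> y \<in> set R \<Longrightarrow> x \<noteq> y \<Longrightarrow> A x y = B x y"
    and "distinct R" "a \<notin> set R"
  shows "ends A k R a = ends B k R a"
  using assms
proof (induction k arbitrary: R a)
  case (Suc k)
  have "(if A a b then ends A k (remove1 b R) b else []) = (if B a b then ends B k (remove1 b R) b else [])"
    if b: "b \<in> set R" for b
  proof -
    have "A a b = B a b" using Suc.prems(1)[of a b] Suc.prems(3) b by auto
    moreover have "ends A k (remove1 b R) b = ends B k (remove1 b R) b"
      using Suc.prems b by (intro Suc.IH) (auto simp: set_remove1_eq)
    ultimately show ?thesis by simp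
  qed
  then show ?case by (auto intro!: arg_cong[of _ _ concat])
qed simp

lemma set_ends: "set (ends A k R a) \<subseteq> insert a (set R)"
proof (induction k arbitrary: R a)
  case (Suc k)
  have "set (ends A k (remove1 b R) b) \<subseteq> insert a (set R)" if "b \<in> set R" for b
    using Suc[of "remove1 b R" b] that set_remove1_subset[of b R] by blast
  then show ?case by (auto split: if_splits)
qed simp

lemma sum_list_count_upto:
  fixes g :: "nat \<Rightarrow> real"
  assumes "set xs \<subseteq> {..<n}"
  shows "(\<Sum>b\<leftarrow>xs. g b) = (\<Sum>j<n. real (count_list xs j) * g j)"
  using assms
proof (induction xs)
  case (Cons x xs)
  have "(\<Sum>j<n. real (count_list (x # xs) j) * g j)
      = (\<Sum>j<n. (if j = x then g j else 0) + real (count_list xs j) * g j)"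
    by (intro sum.cong) (auto simp: algebra_simps)
  then show ?case using Cons by (simp add: sum.distrib)
qed simp

lemma dot_eq:
  "length ps = length hs \<Longrightarrow> dot ps hs = (\<Sum>j<length ps. if ps ! j then 0 else hs ! j)"
  by (induction ps hs rule: dot.induct)
    (auto simp del: sum.lessThan_Suc simp add: sum.lessThan_Suc_shift intro!: sum.cong)

lemma cut_eq:
  "length ps = length H \<Longrightarrow> cut ps H = (\<Sum>i<length ps. if ps ! i then dot ps (H ! i) else 0)"
  unfolding cut_def by (subst sum_list_sum_nth) (auto simp: atLeast0LessThan intro!: sum.cong)

text \<open>If the arguments are random, the expectation is a positive multiple of \<open>56 a - 63 b + 45 c\<close> with the densities
  a, b and c of the 3-, 5- and 7-cycles. The vertex 6 is singled out, so that the value for a tournament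
  is a constant plus the value of a cut of its restriction to the other vertices.\<close>

definition local_form :: "(nat \<Rightarrow> nat \<Rightarrow> real) \<Rightarrow> real" where
  "local_form w = 8 * (\<Sum>xs\<in>dlists 3 {..<6}. closed_walk w xs) - 3 * (\<Sum>xs\<in>dlists 5 {..<6}. closed_walk w xs)
     + 3 * (8 * (\<Sum>xs\<in>dlists 2 {..<6}. closed_walk w (6 # xs))
          - 5 * (\<Sum>xs\<in>dlists 4 {..<6}. closed_walk w (6 # xs))
          + 10 * (\<Sum>xs\<in>dlists 6 {..<6}. closed_walk w (6 # xs)))"

lemma sum_dlists_map:
  assumes "bij_betw \<sigma> R R"
  shows "(\<Sum>xs\<in>dlists k R. f (map \<sigma> xs)) = (\<Sum>xs\<in>dlists k R. f xs)"
proof -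
  let ?\<tau> = "the_inv_into R \<sigma>"
  have inj: "inj_on \<sigma> R" and im: "\<sigma> ` R = R" using assms by (auto simp: bij_betw_def)
  have inj': "inj_on ?\<tau> R" and im': "?\<tau> ` R = R"
    using bij_betw_the_inv_into[OF assms] by (auto simp: bij_betw_def)
  have inv1: "map ?\<tau> (map \<sigma> xs) = xs" if "set xs \<subseteq> R" for xs
    using that inj by (auto simp: the_inv_into_f_f subset_iff intro!: map_idI)
  have inv2: "map \<sigma> (map ?\<tau> xs) = xs" if "set xs \<subseteq> R" for xs
    using that inj im by (auto simp: f_the_inv_into_f subset_iff intro!: map_idI)
  show ?thesis
  proof (rule sum.reindex_bij_witness[where i = "map ?\<tau>" and j = "map \<sigma>"])
    fix xs assume "xs \<in> dlists k R"
    then show "map \<sigma> xs \<in> dlists k R" "map ?\<tau> (map \<sigma> xs) = xs"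
      using inj im inv1[of xs] by (auto simp: dlists_def distinct_map dest: inj_on_subset)
  next
    fix xs assume "xs \<in> dlists k R"
    then show "map ?\<tau> xs \<in> dlists k R" "map \<sigma> (map ?\<tau> xs) = xs"
      using inj' im' inv2[of xs] by (auto simp: dlists_def distinct_map dest: inj_on_subset)
  qed simp
qed

lemma closed_walk_map: "closed_walk w (map \<sigma> xs) = closed_walk (\<lambda>i j. w (\<sigma> i) (\<sigma> j)) xs"
  unfolding closed_walk_def
proof (intro prod.cong)
  fix i assume "i \<in> {..<length xs}"
  then have "i < length xs" "Suc i mod length xs < length xs" by (auto intro: Suc_mod_less)
  then show "w (map \<sigma> xs ! i) (map \<sigma> xs ! (Suc i mod length (map \<sigma> xs))) = w (\<sigma> (xs ! i)) (\<sigma> (xs ! (Suc i mod length xs)))"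
    by simp
qed simp

lemma local_form_relabel:
  assumes "bij_betw \<sigma> {..<6} {..<6}" "\<sigma> 6 = 6"
  shows "local_form (\<lambda>i j. w (\<sigma> i) (\<sigma> j)) = local_form w"
proof -
  have 1: "(\<Sum>xs\<in>dlists k {..<6}. closed_walk (\<lambda>i j. w (\<sigma> i) (\<sigma> j)) xs) = (\<Sum>xs\<in>dlists k {..<6}. closed_walk w xs)" for k
    using sum_dlists_map[OF assms(1), of "closed_walk w" k] by (simp add: closed_walk_map)
  have 2: "(\<Sum>xs\<in>dlists k {..<6}. closed_walk (\<lambda>i j. w (\<sigma> i) (\<sigma> j)) (6 # xs)) = (\<Sum>xs\<in>dlists k {..<6}. closed_walk w (6 # xs))" for k
    using sum_dlists_map[OF assms(1), of "\<lambda>xs. closed_walk w (6 # xs)" k] assms(2)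
    by (simp flip: closed_walk_map)
  show ?thesis unfolding local_form_def 1 2 ..
qed

lemma sum_closed_walk_inner:
  fixes A :: "nat \<Rightarrow> nat \<Rightarrow> bool"
  shows "(\<Sum>xs\<in>dlists (Suc k) {..<n}. closed_walk (ind A) xs)
    = (\<Sum>i<n. real (length (filter (\<lambda>j. A j i) (ends A k (remove1 i [0..<n]) i))))"
proof -
  have "(\<Sum>xs\<in>dlists (Suc k) {..<n}. closed_walk (ind A) xs)
    = (\<Sum>i<n. \<Sum>xs\<in>dlists k (set (remove1 i [0..<n])). open_walk (ind A) (i # xs) * ind A (last (i # xs)) i)"
    by (simp add: sum_dlists_Suc closed_walk_Cons_last atLeast0LessThan)
  also have "\<dots> = (\<Sum>i<n. \<Sum>b\<leftarrow>ends A k (remove1 i [0..<n]) i. ind A b i)"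
    by (subst sum_open_walk_ends) auto
  also have "\<dots> = (\<Sum>i<n. real (length (filter (\<lambda>j. A j i) (ends A k (remove1 i [0..<n]) i))))"
  proof (rule sum.cong[OF refl])
    fix i
    show "(\<Sum>b\<leftarrow>xs. ind A b i) = real (length (filter (\<lambda>j. A j i) xs))" for xs
      by (induction xs) auto
  qed
  finally show ?thesis .
qed

lemma sum_closed_walk_outer:
  fixes A :: "nat \<Rightarrow> nat \<Rightarrow> bool"
  shows "(\<Sum>xs\<in>dlists (Suc k) {..<n}. closed_walk (ind A) (n # xs))
    = (\<Sum>i<n. if A n i then \<Sum>j<n. if A j n then real (count_list (ends A k (remove1 i [0..<n]) i) j) else 0 else 0)"
proof -
  have "(\<Sum>xs\<in>dlists (Suc k) {..<n}. closed_walk (ind A) (n # xs))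
    = (\<Sum>i<n. ind A n i * (\<Sum>xs\<in>dlists k (set (remove1 i [0..<n])). open_walk (ind A) (i # xs) * ind A (last (i # xs)) n))"
    unfolding sum_dlists_Suc[OF finite_lessThan] sum_distrib_left closed_walk_Cons_last
    by (simp add: atLeast0LessThan mult.assoc del: sum_mult_of_bool_eq sum_of_bool_mult_eq)
  also have "\<dots> = (\<Sum>i<n. ind A n i * (\<Sum>b\<leftarrow>ends A k (remove1 i [0..<n]) i. ind A b n))"
    by (subst sum_open_walk_ends) auto
  also have "\<dots> = (\<Sum>i<n. ind A n i * (\<Sum>j<n. real (count_list (ends A k (remove1 i [0..<n]) i) j) * ind A j n))"
  proof (rule sum.cong[OF refl])
    fix i assume "i \<in> {..<n}"
    then have "set (ends A k (remove1 i [0..<n]) i) \<subseteq> {..<n}"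
      using set_ends[of A k "remove1 i [0..<n]" i] set_remove1_subset[of i "[0..<n]"] by force
    then show "ind A n i * (\<Sum>b\<leftarrow>ends A k (remove1 i [0..<n]) i. ind A b n)
      = ind A n i * (\<Sum>j<n. real (count_list (ends A k (remove1 i [0..<n]) i) j) * ind A j n)"
      by (subst sum_list_count_upto[of _ n]) auto
  qed
  also have "\<dots> = (\<Sum>i<n. if A n i then \<Sum>j<n. if A j n then real (count_list (ends A k (remove1 i [0..<n]) i) j) else 0 else 0)"
  proof (intro sum.cong refl)
    have *: "c * ind A j n = (if A j n then c else 0)" for c :: real and j by simp
    show "ind A n i * (\<Sum>j<n. real (count_list (ends A k (remove1 i [0..<n]) i) j) * ind A j n)
      = (if A n i then \<Sum>j<n. if A j n then real (count_list (ends A k (remove1 i [0..<n]) i) j) else 0 else 0)" for i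
      unfolding * by simp
  qed
  finally show ?thesis .
qed

text \<open>Counting each cycle by its starting points, the form is
  \<open>24 * c3 - 15 * c5 + 30 * c7\<close> for the numbers of 3-, 5- and 7-cycles on all seven
  vertices. It is symmetric in the vertices although its formula singles out 6.\<close>

lemma local_form_tournament:
  assumes A: "tourn 7 A"
  shows "0 \<le> local_form (ind A)"
proof -
  have "tourn 6 A" using A by (rule tourn_mono) simp
  from ex_normal_form[OF this] obtain T \<sigma>0 where T: "T \<in> set (normal_forms 6)"
    and \<sigma>0: "bij_betw \<sigma>0 {..<6} {..<6}"
    and TA: "\<And>i j. i < 6 \<Longrightarrow> j < 6 \<Longrightarrow> i \<noteq> j \<Longrightarrow> col_adj T i j = A (\<sigma>0 i) (\<sigma>0 j)" by blast
  \<comment> \<open>The form treats 6 separately, so the relabelling of the other six vertices is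
    extended by fixing 6.\<close>
  define \<sigma> where "\<sigma> = (\<lambda>i. if i < 6 then \<sigma>0 i else i)"
  have \<sigma>: "bij_betw \<sigma> {..<6} {..<6}" "\<sigma> 6 = 6"
    using \<sigma>0 bij_betw_cong[of "{..<6}" \<sigma> \<sigma>0 "{..<6}"] by (auto simp: \<sigma>_def)
  define B where "B = (\<lambda>i j. A (\<sigma> i) (\<sigma> j))"
  have B: "col_adj T i j = B i j" if "i < 6" "j < 6" "i \<noteq> j" for i j
    using TA that by (simp add: B_def \<sigma>_def)
  have B6: "B j 6 = (\<not> B 6 j)" if "j < 6" for j
  proof -
    have "\<sigma> j < 6" using \<sigma>(1) that by (auto dest: bij_betwE)
    then show ?thesis using tournD[OF A, of "\<sigma> j" 6] unfolding B_def \<sigma>(2) by simp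
  qed
  have ends: "ends B k (remove1 i [0..<6]) i = ends (col_adj T) k (remove1 i [0..<6]) i" if "i < 6" for i k
    using that by (intro ends_cong) (auto simp: B)
  \<comment> \<open>The out-neighbours of 6; by \<open>B6\<close> the complement consists of the
    in-neighbours, so p is one of the splits covered by \<open>extensions_ok\<close>.\<close>
  define p where "p = map (B 6) [0..<6]"
  have p: "length p = 6" "\<And>j. j < 6 \<Longrightarrow> p ! j = B 6 j" by (auto simp: p_def)
  define C where "C = col_adj T"
  have ok: "0 \<le> inner_count C + 3 * cut p (map (end_row C) [0..<6])"
  proof -
    have "extensions_ok T" using T all_extensions_ok by (auto simp: list_all_iff)
    moreover have "p \<in> set (List.n_lists 6 [True, False])" using p(1) by (auto simp: set_n_lists)
    ultimately show ?thesis by (auto simp: extensions_ok_def Let_def list_all_iff C_def)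
  qed
  have inner: "real_of_int (inner_count C)
     = 8 * (\<Sum>xs\<in>dlists 3 {..<6}. closed_walk (ind B) xs) - 3 * (\<Sum>xs\<in>dlists 5 {..<6}. closed_walk (ind B) xs)"
  proof -
    \<comment> \<open>For k > 0 the paths end in vertices other than i, so the two relations are
      again compared off the diagonal only.\<close>
    have f: "filter (\<lambda>j. B j i) (ends C k (remove1 i [0..<6]) i) = filter (\<lambda>j. C j i) (ends C k (remove1 i [0..<6]) i)"
      if ik: "i < 6" "0 < k" for i k
    proof (rule filter_cong[OF refl])
      fix j assume j: "j \<in> set (ends C k (remove1 i [0..<6]) i)"
      obtain k' where k: "k = Suc k'" using ik by (cases k) auto
      have "j \<in> set (remove1 i [0..<6])"
        using j set_ends[of C k'] unfolding k by (fastforce split: if_splits simp: set_remove1_eq)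
      then show "B j i = C j i" using B[of j i] ik by (auto simp: C_def)
    qed
    have "real_of_int (inner_count C) = (\<Sum>i<6. 8 * real (length (filter (\<lambda>j. C j i) (ends C 2 (remove1 i [0..<6]) i)))
        - 3 * real (length (filter (\<lambda>j. C j i) (ends C 4 (remove1 i [0..<6]) i))))"
      unfolding inner_count_def Let_def sum_list_distinct_conv_sum_set[OF distinct_upt] set_upt atLeast0LessThan
      by simp
    also have "\<dots> = (\<Sum>i<6. 8 * real (length (filter (\<lambda>j. B j i) (ends B 2 (remove1 i [0..<6]) i)))
        - 3 * real (length (filter (\<lambda>j. B j i) (ends B 4 (remove1 i [0..<6]) i))))"
      by (intro sum.cong) (auto simp: ends f simp flip: C_def)
    also have "\<dots> = 8 * (\<Sum>xs\<in>dlists (Suc 2) {..<6}. closed_walk (ind B) xs)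
        - 3 * (\<Sum>xs\<in>dlists (Suc 4) {..<6}. closed_walk (ind B) xs)"
      unfolding sum_closed_walk_inner sum_subtractf sum_distrib_left ..
    finally show ?thesis by (simp add: numeral_eq_Suc)
  qed
  have outer: "real_of_int (cut p (map (end_row C) [0..<6])) =
       8 * (\<Sum>xs\<in>dlists (Suc 1) {..<6}. closed_walk (ind B) (6 # xs))
     - 5 * (\<Sum>xs\<in>dlists (Suc 3) {..<6}. closed_walk (ind B) (6 # xs))
     + 10 * (\<Sum>xs\<in>dlists (Suc 5) {..<6}. closed_walk (ind B) (6 # xs))"
  proof -
    have "real_of_int (cut p (map (end_row C) [0..<6]))
      = (\<Sum>i<6. if B 6 i then \<Sum>j<6. if B j 6 then real_of_int (end_row C i ! j) else 0 else 0)"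
    proof -
      have "cut p (map (end_row C) [0..<6]) = (\<Sum>i<6. if B 6 i then \<Sum>j<6. if B j 6 then end_row C i ! j else 0 else 0)"
      proof -
        have "dot p (end_row C i) = (\<Sum>j<6. if B j 6 then end_row C i ! j else 0)" for i
          using p by (subst dot_eq) (auto simp: end_row_def Let_def B6 intro!: sum.cong)
        then show ?thesis using p by (subst cut_eq) (auto intro!: sum.cong)
      qed
      then show ?thesis by (auto intro!: sum.cong)
    qed
    also have "\<dots> = (\<Sum>i<6. if B 6 i then \<Sum>j<6. if B j 6 then
          8 * real (count_list (ends B 1 (remove1 i [0..<6]) i) j)
        - 5 * real (count_list (ends B 3 (remove1 i [0..<6]) i) j)
        + 10 * real (count_list (ends B 5 (remove1 i [0..<6]) i) j) else 0 else 0)"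
    proof -
      have "real_of_int (end_row C i ! j) = 8 * real (count_list (ends B 1 (remove1 i [0..<6]) i) j)
        - 5 * real (count_list (ends B 3 (remove1 i [0..<6]) i) j)
        + 10 * real (count_list (ends B 5 (remove1 i [0..<6]) i) j)" if "i < 6" "j < 6" for i j
        unfolding end_row_def Let_def C_def ends[OF that(1), symmetric] using that(2) by (simp del: ends.simps)
      then show ?thesis by (intro sum.cong if_cong refl) auto
    qed
    also have "\<dots> = (\<Sum>i<6.
          8 * (if B 6 i then \<Sum>j<6. if B j 6 then real (count_list (ends B 1 (remove1 i [0..<6]) i) j) else 0 else 0)
        - 5 * (if B 6 i then \<Sum>j<6. if B j 6 then real (count_list (ends B 3 (remove1 i [0..<6]) i) j) else 0 else 0)
        + 10 * (if B 6 i then \<Sum>j<6. if B j 6 then real (count_list (ends B 5 (remove1 i [0..<6]) i) j) else 0 else 0))"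
    proof -
      have "(\<Sum>j<6. if P j then 8 * f j - 5 * g j + 10 * h j else 0) =
        8 * (\<Sum>j<6. if P j then f j else 0) - 5 * (\<Sum>j<6. if P j then g j else 0) + 10 * (\<Sum>j<6. if P j then h j else 0)"
        for P :: "nat \<Rightarrow> bool" and f g h :: "nat \<Rightarrow> real"
        unfolding sum_distrib_left sum_subtractf[symmetric] sum.distrib[symmetric] by (intro sum.cong) auto
      then show ?thesis by (intro sum.cong) auto
    qed
    also have "\<dots> = 8 * (\<Sum>xs\<in>dlists (Suc 1) {..<6}. closed_walk (ind B) (6 # xs))
     - 5 * (\<Sum>xs\<in>dlists (Suc 3) {..<6}. closed_walk (ind B) (6 # xs))
     + 10 * (\<Sum>xs\<in>dlists (Suc 5) {..<6}. closed_walk (ind B) (6 # xs))"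
      unfolding sum_closed_walk_outer sum_subtractf sum.distrib sum_distrib_left ..
    finally show ?thesis .
  qed
  have "0 \<le> real_of_int (inner_count C + 3 * cut p (map (end_row C) [0..<6]))" using ok by simp
  also have "\<dots> = local_form (ind B)"
    unfolding local_form_def using inner outer by (simp add: numeral_eq_Suc)
  also have "\<dots> = local_form (ind A)"
    using local_form_relabel[OF \<sigma>, of "ind A"] by (simp add: B_def)
  finally show ?thesis .
qed

text \<open>A function that is affine in each coordinate attains its minimum over a cube at a vertex.\<close>

definition multi_affine :: "(('e \<Rightarrow> real) \<Rightarrow> real) \<Rightarrow> bool" where
  "multi_affine f \<longleftrightarrow> (\<forall>g e t. f (g(e := t)) = (1 - t) * f (g(e := 0)) + t * f (g(e := 1)))"

lemma multi_affineD: "multi_affine f \<Longrightarrow> f (g(e := t)) = (1 - t) * f (g(e := 0)) + t * f (g(e := 1))"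
  unfolding multi_affine_def by blast

text \<open>Induction on a set F of coordinates that may still lie strictly between 0 and 1. One of
  them is moved to its two end points, and the value is a convex combination of the results.\<close>

lemma multi_affine_nonneg:
  assumes f: "multi_affine f" and fin: "finite E"
    and vert: "\<And>g. (\<And>e. e \<in> E \<Longrightarrow> g e \<in> {0, 1}) \<Longrightarrow> 0 \<le> f g"
    and g: "\<And>e. e \<in> E \<Longrightarrow> g e \<in> {0..1}"
  shows "0 \<le> f g"
proof -
  have "0 \<le> f g" if "finite F" "F \<subseteq> E" "\<And>e. e \<in> F \<Longrightarrow> g e \<in> {0..1}" "\<And>e. e \<in> E - F \<Longrightarrow> g e \<in> {0, 1}" for F g
    using that
  proof (induction F arbitrary: g rule: finite_induct)
    case empty
    then show ?case by (intro vert) auto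
  next
    case (insert e F)
    have gE: "g x \<in> {0, 1}" if "x \<in> E" "x \<noteq> e" "x \<notin> F" for x using insert.prems(3)[of x] that by auto
    have gF: "g x \<in> {0..1}" if "x \<in> F" for x using insert.prems(2) that by blast
    have "0 \<le> f (g(e := c))" if c: "c \<in> {0, 1}" for c
    proof (rule insert.IH)
      show "F \<subseteq> E" using insert.prems by auto
      show "(g(e := c)) x \<in> {0..1}" if "x \<in> F" for x using gF[OF that] c by auto
      show "(g(e := c)) x \<in> {0, 1}" if "x \<in> E - F" for x using gE[of x] that c by (cases "x = e") auto
    qed
    then have "0 \<le> f (g(e := 0))" "0 \<le> f (g(e := 1))" by auto
    moreover have "f g = (1 - g e) * f (g(e := 0)) + g e * f (g(e := 1))"
      using multi_affineD[OF f, of g e "g e"] by simp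
    moreover have "g e \<in> {0..1}" using insert.prems by auto
    ultimately show ?case by auto
  qed
  from this[of E g] fin g show ?thesis by auto
qed

lemma multi_affine_sum:
  assumes "\<And>x. x \<in> X \<Longrightarrow> multi_affine (f x)"
  shows "multi_affine (\<lambda>g. \<Sum>x\<in>X. f x g)"
  unfolding multi_affine_def
proof (intro allI)
  fix g e t
  have "(\<Sum>x\<in>X. f x (g(e := t))) = (\<Sum>x\<in>X. (1 - t) * f x (g(e := 0)) + t * f x (g(e := 1)))"
    by (intro sum.cong refl multi_affineD assms)
  also have "\<dots> = (1 - t) * (\<Sum>x\<in>X. f x (g(e := 0))) + t * (\<Sum>x\<in>X. f x (g(e := 1)))"
    unfolding sum.distrib sum_distrib_left ..
  finally show "(\<Sum>x\<in>X. f x (g(e := t))) = (1 - t) * (\<Sum>x\<in>X. f x (g(e := 0))) + t * (\<Sum>x\<in>X. f x (g(e := 1)))" .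
qed

lemma multi_affine_cmult:
  assumes "multi_affine f" shows "multi_affine (\<lambda>g. c * f g)"
  unfolding multi_affine_def
proof (intro allI)
  show "c * f (g(e := t)) = (1 - t) * (c * f (g(e := 0))) + t * (c * f (g(e := 1)))" for g e t
    by (subst multi_affineD[OF assms]) (simp add: algebra_simps)
qed

lemma multi_affine_add:
  assumes "multi_affine f" "multi_affine h" shows "multi_affine (\<lambda>g. f g + h g)"
  unfolding multi_affine_def
proof (intro allI)
  show "f (g(e := t)) + h (g(e := t)) = (1 - t) * (f (g(e := 0)) + h (g(e := 0))) + t * (f (g(e := 1)) + h (g(e := 1)))" for g e t
    by (subst multi_affineD[OF assms(1)], subst multi_affineD[OF assms(2)]) (simp add: algebra_simps)
qed

lemma multi_affine_diff: "multi_affine f \<Longrightarrow> multi_affine h \<Longrightarrow> multi_affine (\<lambda>g. f g - h g)"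
  using multi_affine_add[of f "\<lambda>g. - 1 * h g"] multi_affine_cmult[of h "-1"] by simp

lemma multi_affine_prod:
  assumes "finite I" "inj_on key I"
  shows "multi_affine (\<lambda>g. \<Prod>i\<in>I. a i + b i * g (key i))"
  unfolding multi_affine_def
proof (intro allI)
  fix g e t
  show "(\<Prod>i\<in>I. a i + b i * (g(e := t)) (key i))
    = (1 - t) * (\<Prod>i\<in>I. a i + b i * (g(e := 0)) (key i)) + t * (\<Prod>i\<in>I. a i + b i * (g(e := 1)) (key i))"
  proof (cases "e \<in> key ` I")
    case True
    then obtain k where k: "k \<in> I" "e = key k" by auto
    have "(\<Prod>i\<in>I. a i + b i * (g(e := s)) (key i)) = (a k + b k * s) * (\<Prod>i\<in>I - {k}. a i + b i * g (key i))" for s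
    proof -
      have "(\<Prod>i\<in>I - {k}. a i + b i * (g(e := s)) (key i)) = (\<Prod>i\<in>I - {k}. a i + b i * g (key i))"
        using assms k by (intro prod.cong) (auto simp: inj_on_def)
      then show ?thesis using k assms by (simp add: prod.remove[of I k])
    qed
    then show ?thesis by (simp add: algebra_simps)
  next
    case False
    then have "(\<Prod>i\<in>I. a i + b i * (g(e := s)) (key i)) = (\<Prod>i\<in>I. a i + b i * g (key i))" for s
      by (intro prod.cong) auto
    then show ?thesis by (simp add: algebra_simps)
  qed
qed

text \<open>The constraint that opposite arcs have weights of sum 1 is built in: one free coordinate
  per unordered pair, so the domain is a cube.\<close>

definition oriented :: "(nat \<times> nat \<Rightarrow> real) \<Rightarrow> nat \<Rightarrow> nat \<Rightarrow> real" where
  "oriented g i j = (if i < j then g (i, j) else 1 - g (j, i))"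

lemma nth_neq_nth_Suc_mod:
  assumes "distinct xs" "i < length xs" "2 \<le> length xs"
  shows "xs ! i \<noteq> xs ! (Suc i mod length xs)"
proof
  assume "xs ! i = xs ! (Suc i mod length xs)"
  then have "i = Suc i mod length xs"
    using assms by (simp add: nth_eq_iff_index_eq Suc_mod_less)
  then show False using assms by (cases "Suc i = length xs") auto
qed

text \<open>A cycle on at least three vertices uses each unordered pair at most once, so every
  coordinate occurs in at most one factor. On two vertices the product would be quadratic in its
  single coordinate.\<close>

lemma multi_affine_closed_walk:
  assumes "distinct xs" "3 \<le> length xs"
  shows "multi_affine (\<lambda>g. closed_walk (oriented g) xs)"
proof -
  define n where "n = length xs"
  define key where "key i = (let x = xs ! i; y = xs ! (Suc i mod n) in (min x y, max x y))" for i
  define b where "b i = (if xs ! i < xs ! (Suc i mod n) then 1 else - 1 :: real)" for i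
  define a where "a i = (if xs ! i < xs ! (Suc i mod n) then 0 else 1 :: real)" for i
  have n: "3 \<le> n" using assms by (simp add: n_def)
  have "inj_on key {..<n}"
  proof (rule inj_onI)
    fix i j assume ij: "i \<in> {..<n}" "j \<in> {..<n}" "key i = key j"
    have s: "Suc i mod n < n" "Suc j mod n < n" using n by auto
    have "{xs ! i, xs ! (Suc i mod n)} = {xs ! j, xs ! (Suc j mod n)}"
      using ij(3) unfolding key_def Let_def by (auto simp: min_def max_def split: if_splits)
    \<comment> \<open>Two steps with the same unordered pair either coincide or run through it in
      opposite directions. In the second case the cycle would close after two steps.\<close>
    then have "i = j \<or> (i = Suc j mod n \<and> Suc i mod n = j)"
      using assms(1) ij s by (auto simp: doubleton_eq_iff nth_eq_iff_index_eq n_def)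
    then show "i = j"
      using ij n by (auto simp: mod_Suc split: if_splits)
  qed
  then have "multi_affine (\<lambda>g. \<Prod>i<n. a i + b i * g (key i))"
    by (intro multi_affine_prod) auto
  moreover have "closed_walk (oriented g) xs = (\<Prod>i<n. a i + b i * g (key i))" for g
    unfolding closed_walk_def n_def[symmetric]
  proof (rule prod.cong[OF refl])
    fix i assume "i \<in> {..<n}"
    then have "xs ! i \<noteq> xs ! (Suc i mod n)"
      using nth_neq_nth_Suc_mod[OF assms(1), of i] n by (simp add: n_def)
    then show "oriented g (xs ! i) (xs ! (Suc i mod n)) = a i + b i * g (key i)"
      by (auto simp: oriented_def a_def b_def key_def Let_def min_def max_def)
  qed
  ultimately show ?thesis by simp
qed

lemma closed_walk_cong:
  assumes "\<And>x y. x \<in> set xs \<Longrightarrow> y \<in> set xs \<Longrightarrow> x \<noteq> y \<Longrightarrow> w x y = w' x y" "distinct xs" "2 \<le> length xs"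
  shows "closed_walk w xs = closed_walk w' xs"
  unfolding closed_walk_def
proof (rule prod.cong[OF refl])
  fix i assume i: "i \<in> {..<length xs}"
  then have "xs ! i \<noteq> xs ! (Suc i mod length xs)"
    using assms by (intro nth_neq_nth_Suc_mod) auto
  then show "w (xs ! i) (xs ! (Suc i mod length xs)) = w' (xs ! i) (xs ! (Suc i mod length xs))"
    using i Suc_mod_less[of i "length xs"] by (intro assms(1)) auto
qed

lemma local_form_cong:
  assumes "\<And>x y. x < 7 \<Longrightarrow> y < 7 \<Longrightarrow> x \<noteq> y \<Longrightarrow> w x y = w' x y"
  shows "local_form w = local_form w'"
proof -
  have 1: "closed_walk w xs = closed_walk w' xs" if "xs \<in> dlists k {..<6}" "2 \<le> k" for xs k
  proof (rule closed_walk_cong)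
    have xs: "set xs \<subseteq> {..<6}" "distinct xs" "length xs = k" using that by (auto simp: dlists_def)
    then show "distinct xs" "2 \<le> length xs" using that by auto
    fix x y assume xy: "x \<in> set xs" "y \<in> set xs" "x \<noteq> y"
    then have "x < 7" "y < 7" using xs by fastforce+
    then show "w x y = w' x y" using assms xy by blast
  qed
  have 2: "closed_walk w (6 # xs) = closed_walk w' (6 # xs)" if "xs \<in> dlists k {..<6}" "2 \<le> k" for xs k
  proof (rule closed_walk_cong)
    have "set xs \<subseteq> {..<6}" "distinct xs" "length xs = k" using that by (auto simp: dlists_def)
    then show "distinct (6 # xs)" "2 \<le> length (6 # xs)" using that by auto
    fix x y assume xy: "x \<in> set (6 # xs)" "y \<in> set (6 # xs)" "x \<noteq> y"
    then have "x < 7" "y < 7" using \<open>set xs \<subseteq> {..<6}\<close> by fastforce+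
    then show "w x y = w' x y" using assms xy by blast
  qed
  show ?thesis unfolding local_form_def
    by (intro arg_cong2[of _ _ _ _ "(+)"] arg_cong2[of _ _ _ _ "(-)"] arg_cong2[of _ _ _ _ "(*)"] refl sum.cong 1 2) auto
qed

text \<open>The form is affine in the weight of each pair, so its minimum over weighted tournaments
  is attained at an ordinary tournament.\<close>

theorem local_form_nonneg:
  assumes "\<And>i j. i < 7 \<Longrightarrow> j < 7 \<Longrightarrow> w i j \<in> {0..1}"
    and "\<And>i j. i < 7 \<Longrightarrow> j < 7 \<Longrightarrow> i \<noteq> j \<Longrightarrow> w i j + w j i = 1"
  shows "0 \<le> local_form w"
proof -
  define g where "g = (\<lambda>(i, j). w i j)"
  have 1: "multi_affine (\<lambda>g. \<Sum>xs\<in>dlists k {..<6}. closed_walk (oriented g) xs)" if "3 \<le> k" for k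
    using that by (intro multi_affine_sum multi_affine_closed_walk) (auto simp: dlists_def)
  have 2: "multi_affine (\<lambda>g. \<Sum>xs\<in>dlists k {..<6}. closed_walk (oriented g) (6 # xs))" if "2 \<le> k" for k
    using that by (intro multi_affine_sum multi_affine_closed_walk) (auto simp: dlists_def)
  have "multi_affine (\<lambda>g. local_form (oriented g))"
    unfolding local_form_def
    by (intro multi_affine_add multi_affine_diff multi_affine_cmult 1 2) auto
  then have "0 \<le> local_form (oriented g)"
  proof (rule multi_affine_nonneg[where E = "{..<7} \<times> {..<7}"])
    fix g :: "nat \<times> nat \<Rightarrow> real" assume g: "\<And>e. e \<in> {..<7} \<times> {..<7} \<Longrightarrow> g e \<in> {0, 1}"
    define A where "A i j \<longleftrightarrow> oriented g i j = 1" for i j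
    have "oriented g i j \<in> {0, 1}" if "i < 7" "j < 7" for i j
      using that g[of "(i, j)"] g[of "(j, i)"] by (auto simp: oriented_def)
    then have "local_form (oriented g) = local_form (ind A)"
      by (intro local_form_cong) (auto simp: A_def)
    moreover have "tourn 7 A" unfolding tourn_def
    proof (intro allI impI)
      fix i j :: nat assume ij: "i < 7" "j < 7" "i \<noteq> j"
      then show "A i j = (\<not> A j i)"
        using g[of "(i, j)"] g[of "(j, i)"] by (auto simp: A_def oriented_def)
    qed
    ultimately show "0 \<le> local_form (oriented g)" using local_form_tournament by simp
  qed (use assms in \<open>auto simp: g_def\<close>)
  also have "local_form (oriented g) = local_form w"
  proof (rule local_form_cong)
    fix x y :: nat assume "x < 7" "y < 7" "x \<noteq> y"
    then show "oriented g x y = w x y"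
      using assms(2)[of x y] by (auto simp: oriented_def g_def)
  qed
  finally show ?thesis .
qed

section \<open>Kernels and cycle integrals\<close>

definition kernel_op :: "'a measure \<Rightarrow> ('a \<Rightarrow> 'a \<Rightarrow> real) \<Rightarrow> ('a \<Rightarrow> real) \<Rightarrow> 'a \<Rightarrow> real" where
  "kernel_op M K f x = (\<integral>y. K x y * f y \<partial>M)"

text \<open>The bound is imposed at every point, even outside the space, so that iterated integrals
  stay in the class without almost-everywhere side conditions.\<close>

definition bdd_fun :: "'a measure \<Rightarrow> ('a \<Rightarrow> real) \<Rightarrow> bool" where
  "bdd_fun M f \<longleftrightarrow> f \<in> borel_measurable M \<and> (\<exists>B. \<forall>x. \<bar>f x\<bar> \<le> B)"

definition bdd_kernel :: "'a measure \<Rightarrow> ('a \<Rightarrow> 'a \<Rightarrow> real) \<Rightarrow> bool" where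
  "bdd_kernel M K \<longleftrightarrow> bdd_fun (M \<Otimes>\<^sub>M M) (\<lambda>(x, y). K x y)"

definition cycle_integral :: "'a measure \<Rightarrow> ('a \<Rightarrow> 'a \<Rightarrow> real) \<Rightarrow> nat \<Rightarrow> real" where
  "cycle_integral M K l = (\<integral>x. closed_walk (\<lambda>i j. K (x i) (x j)) [0..<l] \<partial>(\<Pi>\<^sub>M i\<in>{..<l}. M))"

section \<open>Closure properties of bounded functions and kernels\<close>

lemma bdd_fun_const [intro]: "bdd_fun M (\<lambda>_. c)"
  by (auto simp: bdd_fun_def)

lemma bdd_fun_add [intro]:
  assumes "bdd_fun M f" "bdd_fun M g" shows "bdd_fun M (\<lambda>x. f x + g x)"
proof -
  obtain A B where "\<And>x. \<bar>f x\<bar> \<le> A" "\<And>x. \<bar>g x\<bar> \<le> B" using assms by (auto simp: bdd_fun_def)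
  then have "\<bar>f x + g x\<bar> \<le> A + B" for x by (meson abs_triangle_ineq add_mono order_trans)
  then show ?thesis using assms by (auto simp: bdd_fun_def)
qed

lemma bdd_fun_mult [intro]:
  assumes "bdd_fun M f" "bdd_fun M g" shows "bdd_fun M (\<lambda>x. f x * g x)"
proof -
  obtain A B where AB: "\<And>x. \<bar>f x\<bar> \<le> A" "\<And>x. \<bar>g x\<bar> \<le> B" using assms by (auto simp: bdd_fun_def)
  have "\<bar>f x * g x\<bar> \<le> A * B" for x
    unfolding abs_mult by (intro mult_mono AB order_trans[OF abs_ge_zero AB(1)[of x]]) auto
  then show ?thesis using assms by (auto simp: bdd_fun_def)
qed

lemma bdd_fun_cmult [intro]: "bdd_fun M f \<Longrightarrow> bdd_fun M (\<lambda>x. c * f x)"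
  by (rule bdd_fun_mult[OF bdd_fun_const])

lemma bdd_fun_uminus [intro]: "bdd_fun M f \<Longrightarrow> bdd_fun M (\<lambda>x. - f x)"
  using bdd_fun_cmult[of M f "-1"] by simp

lemma bdd_fun_diff [intro]: "bdd_fun M f \<Longrightarrow> bdd_fun M g \<Longrightarrow> bdd_fun M (\<lambda>x. f x - g x)"
  using bdd_fun_add[of M f "\<lambda>x. - g x"] by auto

lemma bdd_fun_power [intro]: "bdd_fun M f \<Longrightarrow> bdd_fun M (\<lambda>x. f x ^ n)"
  by (induction n) auto

lemma bdd_fun_sum [intro]: "(\<And>i. i \<in> I \<Longrightarrow> bdd_fun M (f i)) \<Longrightarrow> bdd_fun M (\<lambda>x. \<Sum>i\<in>I. f i x)"
  by (induction I rule: infinite_finite_induct) auto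

lemma bdd_fun_prod [intro]: "(\<And>i. i \<in> I \<Longrightarrow> bdd_fun M (f i)) \<Longrightarrow> bdd_fun M (\<lambda>x. \<Prod>i\<in>I. f i x)"
  by (induction I rule: infinite_finite_induct) auto

lemma bdd_fun_comp:
  "bdd_fun N f \<Longrightarrow> g \<in> M \<rightarrow>\<^sub>M N \<Longrightarrow> bdd_fun M (\<lambda>x. f (g x))"
  by (auto simp: bdd_fun_def)

lemma bdd_fun_measurable: "bdd_fun M f \<Longrightarrow> f \<in> borel_measurable M"
  by (simp add: bdd_fun_def)

lemma bdd_kernel_comp:
  assumes "bdd_kernel N K" "f \<in> M \<rightarrow>\<^sub>M N" "g \<in> M \<rightarrow>\<^sub>M N"
  shows "bdd_fun M (\<lambda>x. K (f x) (g x))"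
  using bdd_fun_comp[OF assms(1)[unfolded bdd_kernel_def], of "\<lambda>x. (f x, g x)" M] assms(2,3) by simp

lemma bdd_kernel_diag: "bdd_kernel M K \<Longrightarrow> bdd_fun M (\<lambda>x. K x x)"
  by (rule bdd_kernel_comp[of M K "\<lambda>x. x" M "\<lambda>x. x"]) auto

lemma bdd_kernel_swap: "bdd_kernel M K \<Longrightarrow> bdd_kernel M (\<lambda>x y. K y x)"
  unfolding bdd_kernel_def[of _ "\<lambda>x y. K y x"] case_prod_beta
  by (rule bdd_kernel_comp[of M K snd "M \<Otimes>\<^sub>M M" fst]) auto

lemma bdd_kernel_left: "bdd_fun M f \<Longrightarrow> bdd_kernel M (\<lambda>x y. f x)"
  unfolding bdd_kernel_def case_prod_beta by (rule bdd_fun_comp[of M f fst]) auto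

lemma bdd_kernel_right: "bdd_fun M f \<Longrightarrow> bdd_kernel M (\<lambda>x y. f y)"
  unfolding bdd_kernel_def case_prod_beta by (rule bdd_fun_comp[of M f snd]) auto

lemma bdd_kernel_add: "bdd_kernel M K \<Longrightarrow> bdd_kernel M L \<Longrightarrow> bdd_kernel M (\<lambda>x y. K x y + L x y)"
  unfolding bdd_kernel_def case_prod_beta by (rule bdd_fun_add)

lemma bdd_kernel_mult: "bdd_kernel M K \<Longrightarrow> bdd_kernel M L \<Longrightarrow> bdd_kernel M (\<lambda>x y. K x y * L x y)"
  unfolding bdd_kernel_def case_prod_beta by (rule bdd_fun_mult)

lemma bdd_kernel_const: "bdd_kernel M (\<lambda>x y. c)"
  unfolding bdd_kernel_def case_prod_beta by (rule bdd_fun_const)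

lemma bdd_kernel_section: "bdd_kernel M K \<Longrightarrow> x \<in> space M \<Longrightarrow> bdd_fun M (K x)"
  by (rule bdd_kernel_comp[of M K "\<lambda>_. x" M "\<lambda>y. y"]) auto

context prob_space begin

lemma bdd_fun_integrable: "bdd_fun M f \<Longrightarrow> integrable M f"
proof -
  assume f: "bdd_fun M f"
  then obtain B where "\<And>x. \<bar>f x\<bar> \<le> B" by (auto simp: bdd_fun_def)
  then show ?thesis using bdd_fun_measurable[OF f] by (intro integrable_const_bound[of _ B]) auto
qed

lemma pair_prob: "pair_prob_space M M" ..

lemma bdd_fun_integral:
  assumes "bdd_kernel M K"
  shows "bdd_fun M (\<lambda>x. \<integral>y. K x y \<partial>M)"
proof -
  obtain B where B: "\<And>x y. \<bar>K x y\<bar> \<le> B" using assms by (auto simp: bdd_kernel_def bdd_fun_def)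
  have B0: "0 \<le> B" using order_trans[OF abs_ge_zero B] .
  have m: "(\<lambda>(x, y). K x y) \<in> borel_measurable (M \<Otimes>\<^sub>M M)"
    using assms by (simp add: bdd_kernel_def bdd_fun_def)
  have "\<bar>\<integral>y. K x y \<partial>M\<bar> \<le> B" for x
  \<comment> \<open>Outside the space the section at x may fail to be integrable; its integral is
    then 0 by convention, which obeys the bound.\<close>
  proof (cases "integrable M (K x)")
    case True
    have "\<bar>\<integral>x'. K x x' \<partial>M\<bar> \<le> (\<integral>x'. \<bar>K x x'\<bar> \<partial>M)" by (rule integral_abs_bound)
    also have "\<dots> \<le> (\<integral>x. B \<partial>M)" using B True by (intro integral_mono) auto
    finally show ?thesis by (simp add: prob_space)
  next
    case False then show ?thesis using B0 by (simp add: not_integrable_integral_eq)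
  qed
  then show ?thesis
    using borel_measurable_lebesgue_integral[OF m] by (auto simp: bdd_fun_def)
qed

lemma Fubini:
  assumes "bdd_kernel M K"
  shows "(\<integral>x. (\<integral>y. K x y \<partial>M) \<partial>M) = (\<integral>y. (\<integral>x. K x y \<partial>M) \<partial>M)"
proof -
  interpret P: pair_prob_space M M ..
  show ?thesis
    using assms by (intro P.Fubini_integral[symmetric] P.bdd_fun_integrable) (simp add: bdd_kernel_def)
qed

lemma bdd_fun_op: "bdd_kernel M K \<Longrightarrow> bdd_fun M f \<Longrightarrow> bdd_fun M (kernel_op M K f)"
  unfolding kernel_op_def by (intro bdd_fun_integral bdd_kernel_mult bdd_kernel_right)

lemma bdd_fun_op_pow: "bdd_kernel M K \<Longrightarrow> bdd_fun M f \<Longrightarrow> bdd_fun M ((kernel_op M K ^^ n) f)"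
  by (induction n) (auto intro: bdd_fun_op)

lemma bdd_kernel_op:
  assumes K: "bdd_kernel M K" and G: "bdd_kernel M G"
  shows "bdd_kernel M (\<lambda>x. kernel_op M K (G x))"
proof -
  interpret P: pair_prob_space M M ..
  obtain A where A: "\<And>x y. \<bar>K x y\<bar> \<le> A" using K by (auto simp: bdd_kernel_def bdd_fun_def)
  obtain B where B: "\<And>x y. \<bar>G x y\<bar> \<le> B" using G by (auto simp: bdd_kernel_def bdd_fun_def)
  have AB: "\<bar>K u y * G x y\<bar> \<le> A * B" for x y u
    unfolding abs_mult by (intro mult_mono A B order_trans[OF abs_ge_zero A]) auto
  have B0: "0 \<le> A * B" using order_trans[OF abs_ge_zero AB] .
  have "\<bar>\<integral>y. K u y * G x y \<partial>M\<bar> \<le> A * B" for x u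
  proof (cases "integrable M (\<lambda>y. K u y * G x y)")
    case True
    have "\<bar>\<integral>y. K u y * G x y \<partial>M\<bar> \<le> (\<integral>y. \<bar>K u y * G x y\<bar> \<partial>M)" by (rule integral_abs_bound)
    also have "\<dots> \<le> (\<integral>x. A * B \<partial>M)" using AB True by (intro integral_mono) auto
    finally show ?thesis by (simp add: prob_space)
  next
    case False then show ?thesis using B0 by (simp add: not_integrable_integral_eq)
  qed
  moreover have "(\<lambda>p. \<integral>y. K (snd p) y * G (fst p) y \<partial>M) \<in> borel_measurable (M \<Otimes>\<^sub>M M)"
  proof (rule borel_measurable_lebesgue_integral)
    have "bdd_fun ((M \<Otimes>\<^sub>M M) \<Otimes>\<^sub>M M) (\<lambda>p. K (snd (fst p)) (snd p) * G (fst (fst p)) (snd p))"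
      by (intro bdd_fun_mult bdd_kernel_comp[OF K] bdd_kernel_comp[OF G]) auto
    then show "(\<lambda>(p, y). K (snd p) y * G (fst p) y) \<in> borel_measurable ((M \<Otimes>\<^sub>M M) \<Otimes>\<^sub>M M)"
      unfolding case_prod_beta by (rule bdd_fun_measurable)
  qed
  ultimately show ?thesis
    unfolding bdd_kernel_def bdd_fun_def kernel_op_def case_prod_beta by auto
qed

lemma bdd_kernel_op_pow:
  assumes "bdd_kernel M K" "bdd_kernel M G"
  shows "bdd_kernel M (\<lambda>x. (kernel_op M K ^^ n) (G x))"
  by (induction n) (use assms in \<open>auto intro: bdd_kernel_op\<close>)

section \<open>Integrals along walks and closed walks\<close>

lemma prob_space_power: "prob_space (\<Pi>\<^sub>M i\<in>I. M)"
  by (rule prob_space_PiM) (rule prob_space_axioms)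

text \<open>Integrating out the last vertex turns the closing weight G into
  \<open>kernel_op M K (G x)\<close>. The induction therefore runs over arbitrary G and not only
  over the kernel itself.\<close>

lemma walk_integral:
  assumes K: "bdd_kernel M K" and G: "bdd_kernel M G"
  shows "(\<integral>x. (\<Prod>i<n. K (x i) (x (Suc i))) * G (x 0) (x n) \<partial>(\<Pi>\<^sub>M i\<in>{..<Suc n}. M))
       = (\<integral>x. (kernel_op M K ^^ n) (G x) x \<partial>M)"
  using G
proof (induction n arbitrary: G)
  case 0
  interpret P: product_sigma_finite "\<lambda>_::nat. M" ..
  have "(\<integral>x. G (x 0) (x 0) \<partial>(\<Pi>\<^sub>M i\<in>{0::nat}. M)) = (\<integral>x. G x x \<partial>M)"
    using bdd_fun_measurable[OF bdd_kernel_diag[OF 0]]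
    by (intro P.product_integral_singleton[of "\<lambda>x. G x x" 0]) auto
  then show ?case by (simp add: lessThan_Suc)
next
  case (Suc n)
  interpret P: product_sigma_finite "\<lambda>_::nat. M" ..
  interpret Q: prob_space "\<Pi>\<^sub>M i\<in>{..<Suc (Suc n)}. M" by (rule prob_space_power)
  let ?f = "\<lambda>x. (\<Prod>i<Suc n. K (x i) (x (Suc i))) * G (x 0) (x (Suc n))"
  have ins: "{..<Suc (Suc n)} = insert (Suc n) {..<Suc n}" by auto
  have "bdd_fun (\<Pi>\<^sub>M i\<in>{..<Suc (Suc n)}. M) ?f"
    by (intro bdd_fun_mult bdd_fun_prod bdd_kernel_comp[OF K] bdd_kernel_comp[OF Suc.prems]) auto
  then have int: "integrable (\<Pi>\<^sub>M i\<in>insert (Suc n) {..<Suc n}. M) ?f"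
    unfolding ins[symmetric] by (rule Q.bdd_fun_integrable)
  have "(\<integral>x. ?f x \<partial>(\<Pi>\<^sub>M i\<in>{..<Suc (Suc n)}. M))
     = (\<integral>x. (\<integral>y. ?f (x(Suc n := y)) \<partial>M) \<partial>(\<Pi>\<^sub>M i\<in>{..<Suc n}. M))"
    unfolding ins by (rule P.product_integral_insert[OF _ _ int]) auto
  also have "\<dots> = (\<integral>x. (\<Prod>i<n. K (x i) (x (Suc i))) * kernel_op M K (G (x 0)) (x n) \<partial>(\<Pi>\<^sub>M i\<in>{..<Suc n}. M))"
  proof (rule Bochner_Integration.integral_cong[OF refl])
    fix x :: "nat \<Rightarrow> 'a"
    have "?f (x(Suc n := y)) = (\<Prod>i<n. K (x i) (x (Suc i))) * (K (x n) y * G (x 0) y)" for y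
    proof -
      have "(\<Prod>i<n. K ((x(Suc n := y)) i) ((x(Suc n := y)) (Suc i))) = (\<Prod>i<n. K (x i) (x (Suc i)))"
        by (intro prod.cong) auto
      then show ?thesis by (simp add: mult.assoc)
    qed
    then show "(\<integral>y. ?f (x(Suc n := y)) \<partial>M) = (\<Prod>i<n. K (x i) (x (Suc i))) * kernel_op M K (G (x 0)) (x n)"
      by (simp only: kernel_op_def integral_mult_right_zero)
  qed
  also have "\<dots> = (\<integral>x. (kernel_op M K ^^ n) (kernel_op M K (G x)) x \<partial>M)"
    using Suc.IH[OF bdd_kernel_op[OF K Suc.prems]] by simp
  finally show ?case by (simp add: funpow_Suc_right del: funpow.simps)
qed

text \<open>The trace of a power, written as an integral over the diagonal; G in
  \<open>walk_integral\<close> is the closing arc. Every iterate is an actual function, so its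
  diagonal makes sense.\<close>

lemma cycle_integral_eq:
  assumes K: "bdd_kernel M K"
  shows "cycle_integral M K (Suc n) = (\<integral>x. (kernel_op M K ^^ n) (\<lambda>u. K u x) x \<partial>M)"
proof -
  have "closed_walk (\<lambda>i j. K (x i) (x j)) [0..<Suc n]
      = (\<Prod>i<n. K (x i) (x (Suc i))) * K (x n) (x 0)" for x :: "nat \<Rightarrow> 'a"
  proof -
    have "closed_walk (\<lambda>i j. K (x i) (x j)) [0..<Suc n] = (\<Prod>i<Suc n. K (x i) (x (Suc i mod Suc n)))"
      unfolding closed_walk_def by (intro prod.cong) (auto simp del: upt_Suc)
    also have "\<dots> = (\<Prod>i<n. K (x i) (x (Suc i))) * K (x n) (x 0)"
      by (auto intro!: prod.cong)
    finally show ?thesis .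
  qed
  then show ?thesis
    unfolding cycle_integral_def
    using walk_integral[OF K bdd_kernel_swap[OF K], of n] by simp
qed

text \<open>Coordinates picked by an injection are again independent with the same law.\<close>

lemma integral_PiM_reindex:
  assumes "inj_on f J" "f ` J \<subseteq> I" and "g \<in> borel_measurable (\<Pi>\<^sub>M i\<in>J. M)"
  shows "(\<integral>x. g (\<lambda>j\<in>J. x (f j)) \<partial>(\<Pi>\<^sub>M i\<in>I. M)) = (\<integral>x. (g x::real) \<partial>(\<Pi>\<^sub>M i\<in>J. M))"
proof -
  have "distr (\<Pi>\<^sub>M i\<in>I. M) (\<Pi>\<^sub>M i\<in>J. M) (\<lambda>\<omega>. \<lambda>n\<in>J. \<omega> (f n)) = (\<Pi>\<^sub>M i\<in>J. M)"
    using distr_PiM_reindex[of I "\<lambda>_. M" f J] assms prob_space_axioms by auto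
  then have "(\<integral>x. g x \<partial>(\<Pi>\<^sub>M i\<in>J. M)) = (\<integral>x. g x \<partial>distr (\<Pi>\<^sub>M i\<in>I. M) (\<Pi>\<^sub>M i\<in>J. M) (\<lambda>\<omega>. \<lambda>n\<in>J. \<omega> (f n)))"
    by simp
  also have "\<dots> = (\<integral>x. g (\<lambda>j\<in>J. x (f j)) \<partial>(\<Pi>\<^sub>M i\<in>I. M))"
    using assms by (intro integral_distr measurable_restrict measurable_component_singleton) auto
  finally show ?thesis ..
qed

lemma bdd_fun_closed_walk:
  assumes "bdd_kernel M K" "set xs \<subseteq> I"
  shows "bdd_fun (\<Pi>\<^sub>M i\<in>I. M) (\<lambda>x. closed_walk (\<lambda>i j. K (x i) (x j)) xs)"
  unfolding closed_walk_def
proof (intro bdd_fun_prod bdd_kernel_comp[OF assms(1)])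
  fix i assume "i \<in> {..<length xs}"
  then have "i < length xs" "Suc i mod length xs < length xs" by (auto intro: Suc_mod_less)
  then have "xs ! i \<in> I" "xs ! (Suc i mod length xs) \<in> I"
    using assms(2) nth_mem by blast+
  then show "(\<lambda>x. x (xs ! i)) \<in> (\<Pi>\<^sub>M i\<in>I. M) \<rightarrow>\<^sub>M M" "(\<lambda>x. x (xs ! (Suc i mod length xs))) \<in> (\<Pi>\<^sub>M i\<in>I. M) \<rightarrow>\<^sub>M M"
    by auto
qed

lemma integral_closed_walk:
  assumes K: "bdd_kernel M K" and xs: "distinct xs" "set xs \<subseteq> I"
  shows "(\<integral>x. closed_walk (\<lambda>i j. K (x i) (x j)) xs \<partial>(\<Pi>\<^sub>M i\<in>I. M)) = cycle_integral M K (length xs)"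
proof -
  let ?l = "length xs" and ?g = "\<lambda>x. closed_walk (\<lambda>i j. K (x i) (x j)) [0..<length xs]"
  have "closed_walk (\<lambda>i j. K (x i) (x j)) xs = ?g (\<lambda>j\<in>{..<?l}. x (xs ! j))" for x :: "'b \<Rightarrow> 'a"
    unfolding closed_walk_def
  proof (intro prod.cong)
    fix i assume "i \<in> {..<length [0..<?l]}"
    then have "i < ?l" "Suc i mod ?l < ?l" by (auto intro: Suc_mod_less)
    then show "K (x (xs ! i)) (x (xs ! (Suc i mod ?l)))
      = K ((\<lambda>j\<in>{..<?l}. x (xs ! j)) ([0..<?l] ! i)) ((\<lambda>j\<in>{..<?l}. x (xs ! j)) ([0..<?l] ! (Suc i mod length [0..<?l])))"
      by simp
  qed simp
  then have "(\<integral>x. closed_walk (\<lambda>i j. K (x i) (x j)) xs \<partial>(\<Pi>\<^sub>M i\<in>I. M))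
      = (\<integral>x. ?g (\<lambda>j\<in>{..<?l}. x (xs ! j)) \<partial>(\<Pi>\<^sub>M i\<in>I. M))"
    by simp
  also have "\<dots> = (\<integral>x. ?g x \<partial>(\<Pi>\<^sub>M i\<in>{..<?l}. M))"
    using xs bdd_fun_closed_walk[OF K, of "[0..<?l]" "{..<?l}"]
    by (intro integral_PiM_reindex) (auto simp: inj_on_def nth_eq_iff_index_eq atLeast0LessThan intro!: bdd_fun_measurable)
  finally show ?thesis by (simp add: cycle_integral_def)
qed

lemma cycle_integral_cmult:
  "cycle_integral M (\<lambda>x y. c * K x y) l = c ^ l * cycle_integral M K l"
  unfolding cycle_integral_def closed_walk_def by (simp add: prod.distrib)

end

section \<open>Skew kernels and the traces of powers of 1 + S\<close>

definition skew :: "('a \<Rightarrow> 'a \<Rightarrow> real) \<Rightarrow> bool" where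
  "skew S \<longleftrightarrow> (\<forall>x y. S x y = - S y x)"

lemma skewD: "skew S \<Longrightarrow> S x y = - S y x"
  unfolding skew_def by blast

context prob_space begin

lemma kernel_op_cong:
  "(\<And>y. y \<in> space M \<Longrightarrow> f y = g y) \<Longrightarrow> kernel_op M K f = kernel_op M K g"
  unfolding kernel_op_def by (intro ext Bochner_Integration.integral_cong) auto

lemma kernel_op_pow_cong:
  assumes "\<And>y. y \<in> space M \<Longrightarrow> f y = g y" "x \<in> space M"
  shows "(kernel_op M K ^^ n) f x = (kernel_op M K ^^ n) g x"
proof (cases n)
  case (Suc k)
  then show ?thesis using kernel_op_cong[OF assms(1)] by (simp add: funpow_Suc_right del: funpow.simps)
qed (use assms in auto)

lemma kernel_op_linear:
  assumes "bdd_kernel M K" "bdd_fun M f" "bdd_fun M g" "x \<in> space M"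
  shows "kernel_op M K (\<lambda>y. c * f y + g y) x = c * kernel_op M K f x + kernel_op M K g x"
proof -
  have "bdd_fun M (\<lambda>y. K x y * f y)" "bdd_fun M (\<lambda>y. K x y * g y)"
    using assms by (auto intro: bdd_kernel_section)
  from this[THEN bdd_fun_integrable] show ?thesis
    by (simp add: kernel_op_def distrib_left mult.left_commute)
qed

lemma kernel_op_pow_linear:
  assumes "bdd_kernel M K" "bdd_fun M f" "bdd_fun M g" "x \<in> space M"
  shows "(kernel_op M K ^^ n) (\<lambda>y. c * f y + g y) x = c * (kernel_op M K ^^ n) f x + (kernel_op M K ^^ n) g x"
  using assms(4)
proof (induction n arbitrary: x)
  case (Suc n)
  have "kernel_op M K ((kernel_op M K ^^ n) (\<lambda>y. c * f y + g y))
      = kernel_op M K (\<lambda>y. c * (kernel_op M K ^^ n) f y + (kernel_op M K ^^ n) g y)"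
    using Suc.IH by (rule kernel_op_cong)
  then show ?case
    using kernel_op_linear[OF assms(1) bdd_fun_op_pow[OF assms(1,2)] bdd_fun_op_pow[OF assms(1,3)] Suc.prems] by simp
qed simp

end

locale skew_kernel = prob_space M for M :: "'a measure" +
  fixes S :: "'a \<Rightarrow> 'a \<Rightarrow> real"
  assumes skew: "skew S" and bdd: "bdd_kernel M S"
begin

abbreviation "sop \<equiv> kernel_op M S"

lemma bdd_col: "x \<in> space M \<Longrightarrow> bdd_fun M (\<lambda>u. S u x)"
  by (rule bdd_kernel_section[OF bdd_kernel_swap[OF bdd]])

lemma adjoint:
  assumes f: "bdd_fun M f" and g: "bdd_fun M g"
  shows "(\<integral>x. f x * sop g x \<partial>M) = - (\<integral>x. sop f x * g x \<partial>M)"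
proof -
  have "(\<integral>x. f x * sop g x \<partial>M) = (\<integral>x. (\<integral>y. f x * (S x y * g y) \<partial>M) \<partial>M)"
    by (simp add: kernel_op_def)
  also have "\<dots> = (\<integral>y. (\<integral>x. f x * (S x y * g y) \<partial>M) \<partial>M)"
    by (intro Fubini bdd_kernel_mult bdd_kernel_left bdd_kernel_right f g bdd)
  also have "\<dots> = (\<integral>y. - (sop f y * g y) \<partial>M)"
  proof (intro Bochner_Integration.integral_cong refl)
    fix y
    have "(\<integral>x. f x * (S x y * g y) \<partial>M) = (\<integral>x. - g y * (S y x * f x) \<partial>M)"
      by (intro Bochner_Integration.integral_cong refl) (simp add: skewD[OF skew, of _ y])
    then show "(\<integral>x. f x * (S x y * g y) \<partial>M) = - (sop f y * g y)"
      by (simp add: kernel_op_def mult.commute)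
  qed
  finally show ?thesis by simp
qed

lemma bdd_pow: "bdd_fun M f \<Longrightarrow> bdd_fun M ((sop ^^ n) f)"
  by (rule bdd_fun_op_pow[OF bdd])

lemma adjoint_pow:
  assumes "bdd_fun M f" "bdd_fun M g"
  shows "(\<integral>x. f x * (sop ^^ n) g x \<partial>M) = (-1) ^ n * (\<integral>x. (sop ^^ n) f x * g x \<partial>M)"
  using assms(1)
proof (induction n arbitrary: f)
  case (Suc n)
  have "(\<integral>x. f x * (sop ^^ Suc n) g x \<partial>M) = - (\<integral>x. sop f x * (sop ^^ n) g x \<partial>M)"
    using adjoint[OF Suc.prems bdd_pow[OF assms(2)]] by simp
  then show ?case
    using Suc.IH[OF bdd_fun_op[OF bdd Suc.prems]] by (simp add: funpow_swap1)
qed simp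

definition vec :: "nat \<Rightarrow> 'a \<Rightarrow> real" where "vec n = (sop ^^ n) (\<lambda>_. 1)"

definition moment :: "nat \<Rightarrow> real" where "moment n = (\<integral>x. vec n x \<partial>M)"

lemma bdd_vec: "bdd_fun M (vec n)"
  unfolding vec_def by (intro bdd_pow bdd_fun_const)

lemma vec_0 [simp]: "vec 0 = (\<lambda>_. 1)" by (simp add: vec_def)

lemma vec_Suc: "vec (Suc n) = sop (vec n)" by (simp add: vec_def)

lemma integral_vec_vec: "(\<integral>x. vec i x * vec j x \<partial>M) = (-1) ^ i * moment (i + j)"
  using adjoint_pow[OF bdd_vec[of j] bdd_fun_const[of M 1], of i]
  by (simp add: moment_def vec_def funpow_add mult.commute)

lemma moment_odd: "odd n \<Longrightarrow> moment n = 0"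
  using adjoint_pow[OF bdd_fun_const[of M 1] bdd_fun_const[of M 1], of n]
  by (simp add: moment_def vec_def)

lemma moment_0 [simp]: "moment 0 = 1"
  by (simp add: moment_def prob_space)

lemma norm_vec: "(\<integral>x. (vec i x)\<^sup>2 \<partial>M) = (-1) ^ i * moment (2 * i)"
  using integral_vec_vec[of i i] by (simp add: power2_eq_square mult_2)

definition plus_one :: "'a \<Rightarrow> 'a \<Rightarrow> real" where "plus_one x y = 1 + S x y"

abbreviation "pop \<equiv> kernel_op M plus_one"

lemma bdd_plus_one: "bdd_kernel M plus_one"
  unfolding plus_one_def by (intro bdd_kernel_add bdd_kernel_const bdd)

lemma pop_eq:
  assumes "bdd_fun M f" "x \<in> space M"
  shows "pop f x = (\<integral>y. f y \<partial>M) + sop f x"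
proof -
  have "bdd_fun M (\<lambda>y. S x y * f y)" using assms bdd by (auto intro: bdd_kernel_section)
  then show ?thesis
    using bdd_fun_integrable[OF assms(1)] bdd_fun_integrable
    by (simp add: kernel_op_def plus_one_def distrib_right)
qed

definition pvec :: "nat \<Rightarrow> 'a \<Rightarrow> real" where "pvec n = (pop ^^ n) (\<lambda>_. 1)"

definition mixed :: "nat \<Rightarrow> nat \<Rightarrow> real" where "mixed n i = (\<integral>x. vec i x * pvec n x \<partial>M)"

lemma bdd_pvec: "bdd_fun M (pvec n)"
  unfolding pvec_def by (intro bdd_fun_op_pow bdd_plus_one bdd_fun_const)

lemma mixed_0: "mixed 0 i = moment i"
  by (simp add: mixed_def pvec_def moment_def)

text \<open>\<open>pop\<close> is \<open>sop\<close> plus the rank-one operator that maps a function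
  to its mean. The mean gives the product, and moving S to the other side of the inner product gives
  the sign and the shift of i. Everything thus reduces to the moments.\<close>

lemma mixed_Suc: "mixed (Suc n) i = moment i * mixed n 0 - mixed n (Suc i)"
proof -
  have "mixed (Suc n) i = (\<integral>x. (\<integral>y. pvec n y \<partial>M) * vec i x + vec i x * sop (pvec n) x \<partial>M)"
    unfolding mixed_def
    by (intro Bochner_Integration.integral_cong refl)
      (simp add: pvec_def pop_eq bdd_fun_op_pow bdd_plus_one bdd_fun_const algebra_simps)
  also have "\<dots> = (\<integral>y. pvec n y \<partial>M) * moment i + (\<integral>x. vec i x * sop (pvec n) x \<partial>M)"
    by (subst Bochner_Integration.integral_add)
      (auto intro!: bdd_fun_integrable bdd_vec bdd_pvec bdd_fun_op[OF bdd] simp: moment_def)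
  also have "\<dots> = moment i * mixed n 0 - mixed n (Suc i)"
    by (subst adjoint[OF bdd_vec bdd_pvec]) (simp add: mixed_def vec_Suc)
  finally show ?thesis .
qed

text \<open>The trace of n factors 1 + S followed by i + 1 factors S; the columns
  \<open>S u x\<close> account for the extra factor.\<close>

definition mixed_trace :: "nat \<Rightarrow> nat \<Rightarrow> real" where
  "mixed_trace i n = (\<integral>x. (pop ^^ n) ((sop ^^ i) (\<lambda>u. S u x)) x \<partial>M)"

lemma mixed_trace_0: "mixed_trace i 0 = cycle_integral M S (Suc i)"
  by (simp add: mixed_trace_def cycle_integral_eq[OF bdd])

lemma bdd_diag_pow: "bdd_fun M (\<lambda>x. (pop ^^ n) ((sop ^^ i) (\<lambda>u. S u x)) x)"
  by (rule bdd_kernel_diag[OF bdd_kernel_op_pow[OF bdd_plus_one bdd_kernel_op_pow[OF bdd bdd_kernel_swap[OF bdd]]]])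

text \<open>The last factor 1 + S is split. Its rank-one part has as trace the inner product of the
  transpose of S ^ (i + 1) applied to 1 with \<open>pvec n\<close>; its other part is one more
  factor S.\<close>

lemma mixed_trace_Suc:
  "mixed_trace i (Suc n) = (-1) ^ Suc i * mixed n (Suc i) + mixed_trace (Suc i) n"
proof -
  have "(pop ^^ Suc n) ((sop ^^ i) (\<lambda>u. S u x)) x
      = (-1) ^ Suc i * (vec (Suc i) x * pvec n x) + (pop ^^ n) ((sop ^^ Suc i) (\<lambda>u. S u x)) x"
    if x: "x \<in> space M" for x
  proof -
    let ?g = "(sop ^^ i) (\<lambda>u. S u x)"
    have g: "bdd_fun M ?g" by (intro bdd_pow bdd_col x)
    have "(\<integral>u. ?g u \<partial>M) = (-1) ^ i * (\<integral>u. vec i u * S u x \<partial>M)"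
      using adjoint_pow[OF bdd_fun_const[of M 1] bdd_col[OF x], of i] by (simp add: vec_def)
    also have "(\<integral>u. vec i u * S u x \<partial>M) = (\<integral>u. - (S x u * vec i u) \<partial>M)"
      by (intro Bochner_Integration.integral_cong refl) (simp add: skewD[OF skew, of _ x])
    also have "\<dots> = - vec (Suc i) x"
      by (simp add: vec_Suc kernel_op_def[of M S "vec i" x])
    finally have int: "(\<integral>u. ?g u \<partial>M) = (-1) ^ Suc i * vec (Suc i) x"
      by simp
    have "(pop ^^ Suc n) ?g x = (pop ^^ n) (pop ?g) x"
      by (simp add: funpow_Suc_right del: funpow.simps)
    also have "\<dots> = (pop ^^ n) (\<lambda>u. (\<integral>u. ?g u \<partial>M) * 1 + sop ?g u) x"
      using pop_eq[OF g] by (intro kernel_op_pow_cong x) simp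
    also have "\<dots> = (\<integral>u. ?g u \<partial>M) * pvec n x + (pop ^^ n) (sop ?g) x"
      unfolding pvec_def
      by (intro kernel_op_pow_linear bdd_plus_one bdd_fun_const bdd_fun_op[OF bdd] g x)
    finally show ?thesis unfolding int by simp
  qed
  then have "mixed_trace i (Suc n) = (\<integral>x. (-1) ^ Suc i * (vec (Suc i) x * pvec n x)
      + (pop ^^ n) ((sop ^^ Suc i) (\<lambda>u. S u x)) x \<partial>M)"
    unfolding mixed_trace_def by (intro Bochner_Integration.integral_cong refl) auto
  also have "\<dots> = (-1) ^ Suc i * mixed n (Suc i) + mixed_trace (Suc i) n"
  proof -
    have 1: "integrable M (\<lambda>x. (-1) ^ Suc i * (vec (Suc i) x * pvec n x))"
      by (intro bdd_fun_integrable bdd_fun_cmult bdd_fun_mult bdd_vec bdd_pvec)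
    have 2: "integrable M (\<lambda>x. (pop ^^ n) ((sop ^^ Suc i) (\<lambda>u. S u x)) x)"
      by (rule bdd_fun_integrable[OF bdd_diag_pow])
    show ?thesis
      unfolding mixed_def mixed_trace_def Bochner_Integration.integral_add[OF 1 2] by simp
  qed
  finally show ?thesis .
qed

text \<open>Splitting the first factor: the trace with the rank-one part is the mean of
  \<open>pvec n\<close>.\<close>

lemma cycle_integral_plus_one:
  "cycle_integral M plus_one (Suc n) = mixed n 0 + mixed_trace 0 n"
proof -
  have "cycle_integral M plus_one (Suc n) = (\<integral>x. (pop ^^ n) (\<lambda>u. 1 * 1 + S u x) x \<partial>M)"
    by (simp add: cycle_integral_eq[OF bdd_plus_one] plus_one_def)
  also have "\<dots> = (\<integral>x. 1 * pvec n x + (pop ^^ n) (\<lambda>u. S u x) x \<partial>M)"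
    unfolding pvec_def
    by (intro Bochner_Integration.integral_cong refl kernel_op_pow_linear bdd_plus_one bdd_fun_const bdd_col)
  also have "\<dots> = mixed n 0 + mixed_trace 0 n"
    using bdd_diag_pow[of n 0] bdd_pvec[of n]
    by (subst Bochner_Integration.integral_add) (auto intro!: bdd_fun_integrable simp: mixed_def mixed_trace_def)
  finally show ?thesis .
qed

lemma cycle_integral_skew:
  "cycle_integral M S (Suc (Suc m)) = - (\<integral>x. (\<integral>u. S u x * (sop ^^ m) (\<lambda>u. S u x) u \<partial>M) \<partial>M)"
proof -
  have "(sop ^^ Suc m) (\<lambda>u. S u x) x = - (\<integral>u. S u x * (sop ^^ m) (\<lambda>u. S u x) u \<partial>M)" for x
    by (simp add: kernel_op_def skewD[OF skew, of x])
  then show ?thesis by (simp add: cycle_integral_eq[OF bdd] del: funpow.simps)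
qed

text \<open>Transposing an odd power of S changes its sign but not its trace.\<close>

lemma cycle_integral_odd:
  assumes "odd l" "1 < l" shows "cycle_integral M S l = 0"
proof -
  define m where "m = l - 2"
  have l: "l = Suc (Suc m)" using assms(2) by (simp add: m_def)
  have m: "odd m" using assms(1) l by simp
  have "(\<integral>u. S u x * (sop ^^ m) (\<lambda>u. S u x) u \<partial>M) = 0" if "x \<in> space M" for x
  proof -
    have "(\<integral>u. S u x * (sop ^^ m) (\<lambda>u. S u x) u \<partial>M) = (-1) ^ m * (\<integral>u. (sop ^^ m) (\<lambda>u. S u x) u * S u x \<partial>M)"
      by (rule adjoint_pow[OF bdd_col[OF that] bdd_col[OF that]])
    also have "(\<lambda>u. (sop ^^ m) (\<lambda>u. S u x) u * S u x) = (\<lambda>u. S u x * (sop ^^ m) (\<lambda>u. S u x) u)"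
      by (rule ext) (rule mult.commute)
    finally show ?thesis using m by simp
  qed
  then have "(\<integral>x. (\<integral>u. S u x * (sop ^^ m) (\<lambda>u. S u x) u \<partial>M) \<partial>M) = (\<integral>x. 0 \<partial>M)"
    by (intro Bochner_Integration.integral_cong refl)
  then show ?thesis unfolding l cycle_integral_skew by simp
qed

text \<open>Half of the factors are moved across the inner product. The trace becomes a mean over
  the base point x of squared norms, so a bound for single functions applied to the columns becomes
  a bound for traces.\<close>

lemma cycle_integral_even:
  "cycle_integral M S (2 * Suc j) = (-1) ^ Suc j * (\<integral>x. (\<integral>u. ((sop ^^ j) (\<lambda>u. S u x) u)\<^sup>2 \<partial>M) \<partial>M)"
proof -
  have "(\<integral>u. S u x * (sop ^^ (j + j)) (\<lambda>u. S u x) u \<partial>M) = (-1) ^ j * (\<integral>u. ((sop ^^ j) (\<lambda>u. S u x) u)\<^sup>2 \<partial>M)"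
    if "x \<in> space M" for x
    using adjoint_pow[OF bdd_col[OF that] bdd_pow[OF bdd_col[OF that]], of j j]
    by (simp add: funpow_add power2_eq_square)
  then have "(\<integral>x. (\<integral>u. S u x * (sop ^^ (j + j)) (\<lambda>u. S u x) u \<partial>M) \<partial>M)
     = (\<integral>x. (-1) ^ j * (\<integral>u. ((sop ^^ j) (\<lambda>u. S u x) u)\<^sup>2 \<partial>M) \<partial>M)"
    by (intro Bochner_Integration.integral_cong refl)
  then show ?thesis using cycle_integral_skew[of "j + j"] by (simp add: mult_2)
qed

definition "tt = (\<integral>x. (vec 1 x)\<^sup>2 \<partial>M)"
definition "qq = (\<integral>x. (vec 2 x)\<^sup>2 \<partial>M)"
definition "rr = (\<integral>x. (vec 3 x)\<^sup>2 \<partial>M)"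

lemma moments:
  "moment (Suc 0) = 0" "moment 2 = - tt" "moment 3 = 0" "moment 4 = qq" "moment 5 = 0" "moment 6 = - rr" "moment 7 = 0"
  using norm_vec[of 1] norm_vec[of 2] norm_vec[of 3]
  by (simp_all add: moment_odd tt_def qq_def rr_def)

lemmas Suc_folds = numeral_2_eq_2[symmetric]

text \<open>This and the following tables contain the entries with n + i at most 7, which is what
  unrolling the trace of the eighth power calls for. Each row follows from the previous one by
  \<open>mixed_Suc\<close>.\<close>

lemma mixed_0_vals:
  "mixed 0 0 = 1" "mixed 0 (Suc 0) = 0" "mixed 0 2 = - tt" "mixed 0 3 = 0" "mixed 0 4 = qq"
  "mixed 0 5 = 0" "mixed 0 6 = - rr" "mixed 0 7 = 0"
  by (simp_all add: mixed_0 moments)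

lemma mixed_1_vals:
  "mixed (Suc 0) 0 = 1"
  "mixed (Suc 0) (Suc 0) = tt"
  "mixed (Suc 0) 2 = - tt"
  "mixed (Suc 0) 3 = - qq"
  "mixed (Suc 0) 4 = qq"
  "mixed (Suc 0) 5 = rr"
  "mixed (Suc 0) 6 = - rr"
  using mixed_Suc[of 0 0] mixed_Suc[of 0 "Suc 0"] mixed_Suc[of 0 2] mixed_Suc[of 0 3] mixed_Suc[of 0 4] mixed_Suc[of 0 5] mixed_Suc[of 0 6]
  by (simp_all add: Suc_folds moments mixed_0_vals algebra_simps)

lemma mixed_2_vals:
  "mixed 2 0 = 1 - tt"
  "mixed 2 (Suc 0) = tt"
  "mixed 2 2 = qq - tt"
  "mixed 2 3 = - qq"
  "mixed 2 4 = qq - rr"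
  "mixed 2 5 = rr"
  using mixed_Suc[of "Suc 0" 0] mixed_Suc[of "Suc 0" "Suc 0"] mixed_Suc[of "Suc 0" 2] mixed_Suc[of "Suc 0" 3] mixed_Suc[of "Suc 0" 4] mixed_Suc[of "Suc 0" 5]
  by (simp_all add: Suc_folds moments mixed_1_vals algebra_simps)

lemma mixed_3_vals:
  "mixed 3 0 = 1 - 2 * tt"
  "mixed 3 (Suc 0) = tt - qq"
  "mixed 3 2 = tt * tt - tt + qq"
  "mixed 3 3 = rr - qq"
  "mixed 3 4 = qq - qq * tt - rr"
  using mixed_Suc[of 2 0] mixed_Suc[of 2 "Suc 0"] mixed_Suc[of 2 2] mixed_Suc[of 2 3] mixed_Suc[of 2 4]
  by (simp_all add: Suc_folds moments mixed_2_vals algebra_simps)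

lemma mixed_4_vals:
  "mixed 4 0 = 1 - 3 * tt + qq"
  "mixed 4 (Suc 0) = tt - tt * tt - qq"
  "mixed 4 2 = 2 * (tt * tt) - tt - rr + qq"
  "mixed 4 3 = qq * tt + rr - qq"
  using mixed_Suc[of 3 0] mixed_Suc[of 3 "Suc 0"] mixed_Suc[of 3 2] mixed_Suc[of 3 3]
  by (simp_all add: Suc_folds moments mixed_3_vals algebra_simps)

lemma mixed_5_vals:
  "mixed 5 0 = 1 - 4 * tt + tt * tt + 2 * qq"
  "mixed 5 (Suc 0) = tt - 2 * (tt * tt) + rr - qq"
  "mixed 5 2 = 3 * (tt * tt) - tt - 2 * (qq * tt) - rr + qq"
  using mixed_Suc[of 4 0] mixed_Suc[of 4 "Suc 0"] mixed_Suc[of 4 2]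
  by (simp_all add: Suc_folds moments mixed_4_vals algebra_simps)

lemma mixed_6_vals:
  "mixed 6 0 = 1 - 5 * tt + 3 * (tt * tt) + 3 * qq - rr"
  "mixed 6 (Suc 0) = tt - 3 * (tt * tt) + 2 * (qq * tt) + rr - qq"
  using mixed_Suc[of 5 0] mixed_Suc[of 5 "Suc 0"]
  by (simp_all add: Suc_folds moments mixed_5_vals algebra_simps)

lemma mixed_7_vals:
  "mixed 7 0 = 1 - 6 * tt + 6 * (tt * tt) + 4 * qq - 2 * rr - 2 * (qq * tt)"
  using mixed_Suc[of 6 0]
  by (simp_all add: Suc_folds moments mixed_6_vals algebra_simps)

lemma cycle_integral_plus_one_3:
  "cycle_integral M plus_one 3 = 1 - 3 * tt"
  using cycle_integral_plus_one[of 2] mixed_trace_Suc[of 0 "Suc 0"] mixed_trace_Suc[of "Suc 0" 0] mixed_trace_0[of 2]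
    cycle_integral_odd[of 3]
  by (simp add: Suc_folds mixed_0_vals mixed_1_vals mixed_2_vals mixed_3_vals mixed_4_vals mixed_5_vals
    mixed_6_vals mixed_7_vals power2_eq_square algebra_simps)

lemma cycle_integral_plus_one_4:
  "cycle_integral M plus_one 4 = 1 + cycle_integral M S 4 - 4 * tt"
  using cycle_integral_plus_one[of 3] mixed_trace_Suc[of 0 2] mixed_trace_Suc[of "Suc 0" "Suc 0"] mixed_trace_Suc[of 2 0]
    mixed_trace_0[of 3]
  by (simp add: Suc_folds mixed_0_vals mixed_1_vals mixed_2_vals mixed_3_vals mixed_4_vals mixed_5_vals
    mixed_6_vals mixed_7_vals power2_eq_square algebra_simps)

lemma cycle_integral_plus_one_5:
  "cycle_integral M plus_one 5 = 1 - 5 * tt + 5 * qq"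
  using cycle_integral_plus_one[of 4] mixed_trace_Suc[of 0 3] mixed_trace_Suc[of "Suc 0" 2] mixed_trace_Suc[of 2 "Suc 0"]
    mixed_trace_Suc[of 3 0] mixed_trace_0[of 4]
    cycle_integral_odd[of 5]
  by (simp add: Suc_folds mixed_0_vals mixed_1_vals mixed_2_vals mixed_3_vals mixed_4_vals mixed_5_vals
    mixed_6_vals mixed_7_vals power2_eq_square algebra_simps)

lemma cycle_integral_plus_one_7:
  "cycle_integral M plus_one 7 = 1 - 7 * tt + 7 * qq + 7 * tt\<^sup>2 - 7 * rr"
  using cycle_integral_plus_one[of 6] mixed_trace_Suc[of 0 5] mixed_trace_Suc[of "Suc 0" 4] mixed_trace_Suc[of 2 3]
    mixed_trace_Suc[of 3 2] mixed_trace_Suc[of 4 "Suc 0"] mixed_trace_Suc[of 5 0] mixed_trace_0[of 6]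
    cycle_integral_odd[of 7]
  by (simp add: Suc_folds mixed_0_vals mixed_1_vals mixed_2_vals mixed_3_vals mixed_4_vals mixed_5_vals
    mixed_6_vals mixed_7_vals power2_eq_square algebra_simps)

lemma cycle_integral_plus_one_8:
  "cycle_integral M plus_one 8 = 1 + cycle_integral M S 8 - 8 * tt + 8 * qq + 12 * tt\<^sup>2 - 8 * rr - 8 * tt * qq"
  using cycle_integral_plus_one[of 7] mixed_trace_Suc[of 0 6] mixed_trace_Suc[of "Suc 0" 5] mixed_trace_Suc[of 2 4]
    mixed_trace_Suc[of 3 3] mixed_trace_Suc[of 4 2] mixed_trace_Suc[of 5 "Suc 0"] mixed_trace_Suc[of 6 0]
    mixed_trace_0[of 7]
  by (simp add: Suc_folds mixed_0_vals mixed_1_vals mixed_2_vals mixed_3_vals mixed_4_vals mixed_5_vals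
    mixed_6_vals mixed_7_vals power2_eq_square algebra_simps)

lemmas cycle_integrals_plus_one = cycle_integral_plus_one_3 cycle_integral_plus_one_4
  cycle_integral_plus_one_5 cycle_integral_plus_one_7 cycle_integral_plus_one_8

end

section \<open>Skew kernels bounded by one\<close>

definition unit_interval :: "real measure" where
  "unit_interval = restrict_space lborel {0..1}"

lemma prob_space_unit_interval: "prob_space unit_interval"
  by (rule prob_spaceI) (simp add: unit_interval_def emeasure_restrict_space space_restrict_space)

lemma measurable_unit_interval_borel [measurable]: "(\<lambda>x. x) \<in> borel_measurable unit_interval"
  unfolding unit_interval_def by (rule measurable_restrict_space1) simp

lemma measure_unit_interval: "A \<in> sets borel \<Longrightarrow> measure unit_interval (A \<inter> {0..1}) = measure lborel (A \<inter> {0..1})"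
  unfolding unit_interval_def by (subst measure_restrict_space) auto

lemma quadratic_nonneg_discriminant:
  fixes a b c :: real
  assumes "\<And>l. 0 \<le> a - 2 * l * b + l\<^sup>2 * c"
  shows "b\<^sup>2 \<le> a * c"
proof -
  have a: "0 \<le> a" using assms[of 0] by simp
  show ?thesis
  proof (cases "c = 0")
    case True
    have "b = 0"
    proof (rule ccontr)
      assume b: "b \<noteq> 0"
      have "2 * ((a + 1) / (2 * b)) * b = a + 1" using b by (simp add: field_simps)
      then show False using assms[of "(a + 1) / (2 * b)"] True by simp
    qed
    then show ?thesis using True by simp
  next
    case False
    have "0 < c"
    proof (rule ccontr)
      assume "\<not> 0 < c"
      then have c: "c < 0" using False by simp
      \<comment> \<open>With this l the quadratic term equals -(a + 1); adding the values at l and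
        -l removes b and leaves a negative sum.\<close>
      define l where "l = sqrt ((a + 1) / - c)"
      have l2: "l\<^sup>2 * c = - (a + 1)" using a c by (simp add: l_def field_simps)
      have "0 \<le> a - 2 * l * b + l\<^sup>2 * c" "0 \<le> a - 2 * (- l) * b + (- l)\<^sup>2 * c" using assms by blast+
      then show False unfolding power2_minus l2 by simp
    qed
    moreover have "0 \<le> a - 2 * (b / c) * b + (b / c)\<^sup>2 * c" by (rule assms)
    ultimately show ?thesis by (simp add: power2_eq_square field_simps)
  qed
qed

locale bounded_skew_kernel = skew_kernel +
  assumes le_1: "\<bar>S x y\<bar> \<le> 1"
begin

text \<open>A skew kernel has its singular values in pairs, which gains a factor 2 over the trivial
  Hilbert-Schmidt bound.\<close>

lemma op_norm_bound:
  assumes g: "bdd_fun M g"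
  shows "2 * (\<integral>x. (sop g x)\<^sup>2 \<partial>M) \<le> (\<integral>x. (g x)\<^sup>2 \<partial>M)"
proof -
  define h where "h = sop g"
  define G where "G = (\<integral>x. (g x)\<^sup>2 \<partial>M)"
  define H where "H = (\<integral>x. (h x)\<^sup>2 \<partial>M)"
  have h: "bdd_fun M h" unfolding h_def by (rule bdd_fun_op[OF bdd g])
  have gh: "(\<integral>x. g x * h x \<partial>M) = 0"
    using adjoint[OF g g] by (simp add: h_def mult.commute)
  have gsh: "(\<integral>x. g x * sop h x \<partial>M) = - H"
    using adjoint[OF g h] by (simp add: h_def[symmetric] H_def power2_eq_square)
  \<comment> \<open>S is compared in mean square with c times the skew kernel
    \<open>h x * g y - g x * h y\<close>. Since g and h = \<open>sop g\<close> are orthogonal, the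
    two rank-one terms contribute equally, and this doubling is the gain of 2. The square of S
    itself has mean at most 1.\<close>
  have key: "0 \<le> 1 - 4 * c * H + 2 * c\<^sup>2 * (H * G)" for c
  proof -
    have inner: "0 \<le> 1 + c\<^sup>2 * G * (h x)\<^sup>2 + c\<^sup>2 * H * (g x)\<^sup>2 - 2 * c * (h x)\<^sup>2 + 2 * c * (g x * sop h x)"
      if x: "x \<in> space M" for x
    proof -
      have Sx: "bdd_fun M (S x)" by (rule bdd_kernel_section[OF bdd x])
      have int: "integrable M (\<lambda>y. (S x y)\<^sup>2)" "integrable M (\<lambda>y. (g y)\<^sup>2)" "integrable M (\<lambda>y. (h y)\<^sup>2)"
        "integrable M (\<lambda>y. S x y * g y)" "integrable M (\<lambda>y. S x y * h y)" "integrable M (\<lambda>y. g y * h y)"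
        by (intro bdd_fun_integrable bdd_fun_mult bdd_fun_power Sx g h)+
      have "0 \<le> (\<integral>y. (S x y - c * (h x * g y) + c * (g x * h y))\<^sup>2 \<partial>M)" by simp
      also have "\<dots> = (\<integral>y. (S x y)\<^sup>2 + (c * h x)\<^sup>2 * (g y)\<^sup>2 + (c * g x)\<^sup>2 * (h y)\<^sup>2
          - (2 * c * h x) * (S x y * g y) + (2 * c * g x) * (S x y * h y) - (2 * c\<^sup>2 * h x * g x) * (g y * h y) \<partial>M)"
        by (intro Bochner_Integration.integral_cong refl) (simp add: power2_eq_square algebra_simps)
      also have "\<dots> = (\<integral>y. (S x y)\<^sup>2 \<partial>M) + (c * h x)\<^sup>2 * G + (c * g x)\<^sup>2 * H
          - (2 * c * h x) * h x + (2 * c * g x) * sop h x"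
        using int gh by (simp add: G_def H_def kernel_op_def[of M S h] h_def[unfolded fun_eq_iff, rule_format, unfolded kernel_op_def])
      also have "(\<integral>y. (S x y)\<^sup>2 \<partial>M) \<le> (\<integral>y. 1 \<partial>M)"
        using int(1) le_1 by (intro integral_mono) (auto simp: abs_square_le_1)
      finally show ?thesis by (simp add: prob_space power2_eq_square algebra_simps)
    qed
    have int: "integrable M (\<lambda>x. (g x)\<^sup>2)" "integrable M (\<lambda>x. (h x)\<^sup>2)" "integrable M (\<lambda>x. g x * sop h x)"
      by (intro bdd_fun_integrable bdd_fun_mult bdd_fun_power bdd_fun_op[OF bdd] g h)+
    have "0 \<le> (\<integral>x. 1 + c\<^sup>2 * G * (h x)\<^sup>2 + c\<^sup>2 * H * (g x)\<^sup>2 - 2 * c * (h x)\<^sup>2 + 2 * c * (g x * sop h x) \<partial>M)"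
      by (rule Bochner_Integration.integral_nonneg) (rule inner)
    also have "\<dots> = 1 + c\<^sup>2 * G * H + c\<^sup>2 * H * G - 2 * c * H + 2 * c * (- H)"
      using int gsh by (simp add: G_def[symmetric] H_def[symmetric] prob_space)
    finally show ?thesis by (simp add: algebra_simps)
  qed
  have "0 \<le> H" "0 \<le> G" by (simp_all add: H_def G_def)
  have "2 * H \<le> G"
  proof (cases "G = 0")
    case True
    have "H = 0"
    proof (rule ccontr)
      assume "H \<noteq> 0"
      then show False using key[of "1 / H"] True by simp
    qed
    then show ?thesis using True by simp
  next
    case False
    then have "0 < G" using \<open>0 \<le> G\<close> by simp
    \<comment> \<open>The value of c that minimises the quadratic when H > 0.\<close>
    then show ?thesis using key[of "1 / G"] by (simp add: power2_eq_square field_simps)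
  qed
  then show ?thesis by (simp add: H_def G_def h_def)
qed

lemma qq_le: "2 * qq \<le> tt"
  using op_norm_bound[OF bdd_vec[of 1]] by (simp add: qq_def tt_def vec_Suc[symmetric] Suc_folds)

lemma rr_le: "2 * rr \<le> qq"
  using op_norm_bound[OF bdd_vec[of 2]] by (simp add: rr_def qq_def vec_Suc[symmetric])

lemma tqr_nonneg: "0 \<le> tt" "0 \<le> qq" "0 \<le> rr"
  by (simp_all add: tt_def qq_def rr_def)

text \<open>Cauchy-Schwarz for \<open>vec 1\<close> and \<open>vec 3\<close>, whose inner product is
  -\<open>qq\<close>.\<close>

lemma qq_square_le: "qq\<^sup>2 \<le> tt * rr"
proof (rule quadratic_nonneg_discriminant)
  fix l
  have int: "integrable M (\<lambda>x. (vec 1 x)\<^sup>2)" "integrable M (\<lambda>x. vec 1 x * vec 3 x)" "integrable M (\<lambda>x. (vec 3 x)\<^sup>2)"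
    by (intro bdd_fun_integrable bdd_fun_mult bdd_fun_power bdd_vec)+
  have "0 \<le> (\<integral>x. (vec 1 x + l * vec 3 x)\<^sup>2 \<partial>M)" by simp
  also have "\<dots> = (\<integral>x. (vec 1 x)\<^sup>2 + 2 * l * (vec 1 x * vec 3 x) + l\<^sup>2 * (vec 3 x)\<^sup>2 \<partial>M)"
    by (intro Bochner_Integration.integral_cong refl) (simp add: power2_eq_square algebra_simps)
  also have "\<dots> = tt + 2 * l * (\<integral>x. vec 1 x * vec 3 x \<partial>M) + l\<^sup>2 * rr"
    using int by (simp add: tt_def rr_def)
  also have "(\<integral>x. vec 1 x * vec 3 x \<partial>M) = - qq"
    using integral_vec_vec[of 1 3] by (simp add: moments)
  finally show "0 \<le> tt - 2 * l * qq + l\<^sup>2 * rr" by simp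
qed

definition ww :: "'a \<Rightarrow> 'a \<Rightarrow> real" where "ww x y = (1 + S x y) / 2"

lemma ww_range: "0 \<le> ww x y" "ww x y \<le> 1"
  using le_1[of x y] by (auto simp: ww_def abs_le_iff)

lemma ww_sum: "ww x y + ww y x = 1"
  by (simp add: ww_def skewD[OF skew, of y x] field_simps)

lemma bdd_ww: "bdd_kernel M ww"
proof -
  have "bdd_kernel M (\<lambda>x y. 1 / 2 * (1 + S x y))"
    by (intro bdd_kernel_mult bdd_kernel_const bdd_kernel_add bdd)
  then show ?thesis unfolding ww_def by simp
qed

lemma cycle_integral_ww: "cycle_integral M plus_one l = 2 ^ l * cycle_integral M ww l"
proof -
  have "plus_one = (\<lambda>x y. 2 * ww x y)" by (auto simp: plus_one_def ww_def fun_eq_iff)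
  then show ?thesis by (simp add: cycle_integral_cmult)
qed

lemma closed_walk_ww: "0 \<le> closed_walk (\<lambda>i j. ww (x i) (x j)) xs" "closed_walk (\<lambda>i j. ww (x i) (x j)) xs \<le> 1"
  unfolding closed_walk_def by (auto intro!: prod_nonneg prod_le_1 simp: ww_range)

lemma open_walk_ww: "0 \<le> open_walk (\<lambda>i j. ww (x i) (x j)) xs" "open_walk (\<lambda>i j. ww (x i) (x j)) xs \<le> 1"
  unfolding open_walk_eq_prod by (auto intro!: prod_nonneg prod_le_1 simp: ww_range)

lemma cycle_integral_ww_nonneg: "0 \<le> cycle_integral M ww l"
  unfolding cycle_integral_def by (intro Bochner_Integration.integral_nonneg closed_walk_ww)

text \<open>A closed walk on more than 3 vertices contains a triangle or can be shortened.\<close>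

lemma cycle_integral_ww_Suc:
  assumes "3 \<le> k"
  shows "cycle_integral M ww (Suc k) \<le> cycle_integral M ww 3 + cycle_integral M ww k"
proof -
  let ?I = "{..<Suc k}" and ?c = "\<lambda>xs x. closed_walk (\<lambda>i j. ww (x i) (x j)) xs"
  interpret P: prob_space "\<Pi>\<^sub>M i\<in>?I. M" by (rule prob_space_power)
  define ys where "ys = [3..<Suc k]"
  have l: "[0..<Suc k] = 0 # 1 # 2 # ys"
    using assms by (simp add: ys_def upt_conv_Cons numeral_eq_Suc del: upt_Suc)
  have d: "distinct ys" "set ys \<subseteq> ?I" "0 \<notin> set ys" "1 \<notin> set ys" "2 \<notin> set ys" "length ys = k - 2"
    by (auto simp: ys_def)
  \<comment> \<open>Either the chord between 0 and 2 points back to 0 and closes a triangle, or it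
    points to 2 and replaces the first two arcs. In weights: split a * R by b and drop one factor
    from each part.\<close>
  have le: "?c (0 # 1 # 2 # ys) x \<le> ?c [0, 1, 2] x + ?c (0 # 2 # ys) x" for x
  proof -
    define a where "a = ww (x 0) (x 1) * ww (x 1) (x 2)"
    define b where "b = ww (x 0) (x 2)"
    define R where "R = open_walk (\<lambda>i j. ww (x i) (x j)) (2 # ys @ [0])"
    have R: "0 \<le> R" "R \<le> 1" unfolding R_def by (rule open_walk_ww)+
    have a: "0 \<le> a" "a \<le> 1" unfolding a_def using ww_range by (auto intro: mult_le_one)
    have b: "0 \<le> b" "b \<le> 1" unfolding b_def by (rule ww_range)+
    have b': "ww (x 2) (x 0) = 1 - b" unfolding b_def using ww_sum[of "x 0" "x 2"] by simp
    have "a * R = a * (1 - b) * R + a * b * R" by (simp add: algebra_simps)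
    moreover have "a * (1 - b) * R \<le> a * (1 - b)" using a b R by (intro mult_left_le) auto
    moreover have "a * (b * R) \<le> b * R" using a b R by (intro mult_left_le_one_le) auto
    ultimately have "a * R \<le> a * (1 - b) + b * R" by (simp add: mult.assoc)
    moreover have "?c (0 # 1 # 2 # ys) x = a * R" "?c [0, 1, 2] x = a * (1 - b)" "?c (0 # 2 # ys) x = b * R"
      by (simp_all add: closed_walk_Cons a_def b_def R_def b'[unfolded b_def] mult.assoc)
    ultimately show ?thesis by simp
  qed
  have "(\<integral>x. ?c (0 # 1 # 2 # ys) x \<partial>(\<Pi>\<^sub>M i\<in>?I. M)) \<le> (\<integral>x. ?c [0, 1, 2] x + ?c (0 # 2 # ys) x \<partial>(\<Pi>\<^sub>M i\<in>?I. M))"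
    using d assms by (intro integral_mono le P.bdd_fun_integrable bdd_fun_add bdd_fun_closed_walk bdd_ww) auto
  also have "\<dots> = (\<integral>x. ?c [0, 1, 2] x \<partial>(\<Pi>\<^sub>M i\<in>?I. M)) + (\<integral>x. ?c (0 # 2 # ys) x \<partial>(\<Pi>\<^sub>M i\<in>?I. M))"
    using d assms by (intro Bochner_Integration.integral_add P.bdd_fun_integrable bdd_fun_closed_walk bdd_ww) auto
  also have "(\<integral>x. ?c [0, 1, 2] x \<partial>(\<Pi>\<^sub>M i\<in>?I. M)) = cycle_integral M ww 3"
    using assms by (subst integral_closed_walk[OF bdd_ww]) (auto simp: numeral_3_eq_3)
  also have "(\<integral>x. ?c (0 # 2 # ys) x \<partial>(\<Pi>\<^sub>M i\<in>?I. M)) = cycle_integral M ww k"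
  proof -
    have "distinct (0 # 2 # ys)" "set (0 # 2 # ys) \<subseteq> ?I" "length (0 # 2 # ys) = k" using assms d by auto
    then show ?thesis using integral_closed_walk[OF bdd_ww] by blast
  qed
  finally show ?thesis
    unfolding cycle_integral_def l by (simp add: cycle_integral_def)
qed

lemma card_dlists:
  "finite A \<Longrightarrow> k \<le> card A \<Longrightarrow> card (dlists k A) = \<Prod>{card A - k + 1..card A}"
  using card_lists_distinct_length_eq[of A k] unfolding dlists_def by (metis (no_types, lifting) Collect_cong)

text \<open>For random points every closed walk of one length has the same mean, so only the numbers
  of lists enter: the coefficients 1680, 7560 and 21600 divided by their common factor 30.\<close>

lemma local_form_integral:
  "0 \<le> 56 * cycle_integral M ww 3 - 252 * cycle_integral M ww 5 + 720 * cycle_integral M ww 7"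
proof -
  let ?I = "{..<7::nat}" and ?w = "\<lambda>x i j. ww (x i) (x j)"
  interpret P: prob_space "\<Pi>\<^sub>M i\<in>?I. M" by (rule prob_space_power)
  have 1: "(\<integral>x. (\<Sum>xs\<in>dlists k {..<6}. closed_walk (?w x) xs) \<partial>(\<Pi>\<^sub>M i\<in>?I. M))
      = real (card (dlists k {..<6::nat})) * cycle_integral M ww k" for k
  proof -
    have "(\<integral>x. (\<Sum>xs\<in>dlists k {..<6}. closed_walk (?w x) xs) \<partial>(\<Pi>\<^sub>M i\<in>?I. M))
      = (\<Sum>xs\<in>dlists k {..<6}. (\<integral>x. closed_walk (?w x) xs \<partial>(\<Pi>\<^sub>M i\<in>?I. M)))"
      by (intro Bochner_Integration.integral_sum P.bdd_fun_integrable bdd_fun_closed_walk bdd_ww)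
        (auto simp: dlists_def)
    also have "\<dots> = (\<Sum>xs\<in>dlists k {..<6::nat}. cycle_integral M ww k)"
    proof (rule sum.cong[OF refl])
      fix xs :: "nat list" assume "xs \<in> dlists k {..<6}"
      then have "distinct xs" "set xs \<subseteq> ?I" "length xs = k" by (auto simp: dlists_def)
      then show "(\<integral>x. closed_walk (?w x) xs \<partial>(\<Pi>\<^sub>M i\<in>?I. M)) = cycle_integral M ww k"
        using integral_closed_walk[OF bdd_ww] by blast
    qed
    finally show ?thesis by simp
  qed
  have 2: "(\<integral>x. (\<Sum>xs\<in>dlists k {..<6}. closed_walk (?w x) (6 # xs)) \<partial>(\<Pi>\<^sub>M i\<in>?I. M))
      = real (card (dlists k {..<6::nat})) * cycle_integral M ww (Suc k)" for k
  proof -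
    have "(\<integral>x. (\<Sum>xs\<in>dlists k {..<6}. closed_walk (?w x) (6 # xs)) \<partial>(\<Pi>\<^sub>M i\<in>?I. M))
      = (\<Sum>xs\<in>dlists k {..<6}. (\<integral>x. closed_walk (?w x) (6 # xs) \<partial>(\<Pi>\<^sub>M i\<in>?I. M)))"
      by (intro Bochner_Integration.integral_sum P.bdd_fun_integrable bdd_fun_closed_walk bdd_ww)
        (auto simp: dlists_def)
    also have "\<dots> = (\<Sum>xs\<in>dlists k {..<6::nat}. cycle_integral M ww (Suc k))"
    proof (rule sum.cong[OF refl])
      fix xs :: "nat list" assume "xs \<in> dlists k {..<6}"
      then have i: "distinct (6 # xs)" "set (6 # xs) \<subseteq> ?I" "length (6 # xs) = Suc k" by (auto simp: dlists_def)
      show "(\<integral>x. closed_walk (?w x) (6 # xs) \<partial>(\<Pi>\<^sub>M i\<in>?I. M)) = cycle_integral M ww (Suc k)"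
        unfolding i(3)[symmetric] by (rule integral_closed_walk[OF bdd_ww i(1,2)])
    qed
    finally show ?thesis by simp
  qed
  have c: "card (dlists 2 {..<6::nat}) = 30" "card (dlists 3 {..<6::nat}) = 120" "card (dlists 4 {..<6::nat}) = 360"
    "card (dlists 5 {..<6::nat}) = 720" "card (dlists 6 {..<6::nat}) = 720"
    by (simp_all add: card_dlists numeral_eq_Suc atLeastAtMostSuc_conv)
  have b1: "bdd_fun (\<Pi>\<^sub>M i\<in>?I. M) (\<lambda>x. \<Sum>xs\<in>dlists k {..<6}. closed_walk (?w x) xs)" for k
    by (intro bdd_fun_sum bdd_fun_closed_walk bdd_ww) (auto simp: dlists_def)
  have b2: "bdd_fun (\<Pi>\<^sub>M i\<in>?I. M) (\<lambda>x. \<Sum>xs\<in>dlists k {..<6}. closed_walk (?w x) (6 # xs))" for k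
    by (intro bdd_fun_sum bdd_fun_closed_walk bdd_ww) (auto simp: dlists_def)
  have "0 \<le> (\<integral>x. local_form (?w x) \<partial>(\<Pi>\<^sub>M i\<in>?I. M))"
    by (intro Bochner_Integration.integral_nonneg local_form_nonneg) (auto simp: ww_range ww_sum)
  also have "\<dots> = 8 * (120 * cycle_integral M ww 3) - 3 * (720 * cycle_integral M ww 5)
     + 3 * (8 * (30 * cycle_integral M ww 3) - 5 * (360 * cycle_integral M ww 5) + 10 * (720 * cycle_integral M ww 7))"
    unfolding local_form_def
    using P.bdd_fun_integrable[OF b1] P.bdd_fun_integrable[OF b2] by (simp add: 1 2 c)
  finally show ?thesis by simp
qed

lemma tt_eq: "tt = (1 - 8 * cycle_integral M ww 3) / 3"
  using cycle_integrals_plus_one(1) cycle_integral_ww[of 3] by simp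

lemma tt_le: "tt \<le> 1 / 3"
  using tt_eq cycle_integral_ww_nonneg[of 3] by simp

text \<open>In terms of \<open>tt\<close>, \<open>qq\<close> and \<open>rr\<close> the averaged
  cycle inequality does not contain \<open>qq\<close>, because 252 * 5 / 32 = 720 * 7 / 128. What
  remains bounds \<open>rr\<close> by a quadratic in \<open>tt\<close> with the value 17 / 315 at
  \<open>tt = 1 / 3\<close>.\<close>

theorem rr_bound: "rr \<le> 17 / 315" "rr = 17 / 315 \<longleftrightarrow> tt = 1 / 3"
proof -
  have w: "cycle_integral M ww 5 = (1 - 5 * tt + 5 * qq) / 32"
    "cycle_integral M ww 7 = (1 - 7 * tt + 7 * qq + 7 * tt\<^sup>2 - 7 * rr) / 128"
    "cycle_integral M ww 3 = (1 - 3 * tt) / 8"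
    using cycle_integrals_plus_one cycle_integral_ww[of 3] cycle_integral_ww[of 5] cycle_integral_ww[of 7] by simp_all
  have main: "315 * rr \<le> 38 - 168 * tt + 315 * tt\<^sup>2"
    using local_form_integral unfolding w by argo
  \<comment> \<open>For \<open>tt\<close> below 1/5 the quadratic is too large to be of use; there
    \<open>rr\<close> is small because \<open>tt\<close> is.\<close>
  have small: "4 * rr \<le> tt" using qq_le rr_le by simp
  have ge: "rr < 17 / 315" if "tt < 1 / 3"
  proof (rule ccontr)
    assume "\<not> rr < 17 / 315"
    then have t: "68 / 315 \<le> tt" using small by simp
    \<comment> \<open>The quadratic minus 17 is 315 * (tt - 1/3) * (tt - 1/5), and 68/315 exceeds
      1/5.\<close>
    have "(1 / 3 - tt) * (tt - 1 / 5) > 0" using t that by (intro mult_pos_pos) auto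
    then have "38 - 168 * tt + 315 * tt\<^sup>2 < 17"
      by (simp add: power2_eq_square algebra_simps)
    then show False using main \<open>\<not> rr < 17 / 315\<close> by simp
  qed
  have eq: "rr = 17 / 315" if "tt = 1 / 3"
  proof -
    \<comment> \<open>At the maximum of \<open>tt\<close> there are no cyclic triangles, hence no
      longer cycles, and the formulas for the 5- and 7-cycles determine \<open>qq\<close> and then
      \<open>rr\<close>.\<close>
    have "cycle_integral M ww 3 = 0" using w(3) that by simp
    moreover have "cycle_integral M ww 4 \<le> cycle_integral M ww 3 + cycle_integral M ww 3"
      "cycle_integral M ww 5 \<le> cycle_integral M ww 3 + cycle_integral M ww 4"
      "cycle_integral M ww 6 \<le> cycle_integral M ww 3 + cycle_integral M ww 5"
      "cycle_integral M ww 7 \<le> cycle_integral M ww 3 + cycle_integral M ww 6"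
      using cycle_integral_ww_Suc[of 3] cycle_integral_ww_Suc[of 4] cycle_integral_ww_Suc[of 5]
        cycle_integral_ww_Suc[of 6] by simp_all
    ultimately have "cycle_integral M ww 5 = 0" "cycle_integral M ww 7 = 0"
      using cycle_integral_ww_nonneg[of 5] cycle_integral_ww_nonneg[of 7] by linarith+
    then show ?thesis using w(1,2) that by (simp add: power2_eq_square)
  qed
  show "rr \<le> 17 / 315" "rr = 17 / 315 \<longleftrightarrow> tt = 1 / 3"
    using ge eq tt_le by (cases "tt = 1 / 3"; fastforce)+
qed

text \<open>The contribution of the irregularity of the out-degrees is negative.\<close>

lemma irregular_8:
  "- 8 * tt + 8 * qq + 12 * tt\<^sup>2 - 8 * rr - 8 * tt * qq \<le> 0"
  "- 8 * tt + 8 * qq + 12 * tt\<^sup>2 - 8 * rr - 8 * tt * qq = 0 \<longleftrightarrow> tt = 0"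
proof -
  let ?D = "- 8 * tt + 8 * qq + 12 * tt\<^sup>2 - 8 * rr - 8 * tt * qq"
  have zero: "?D = 0" if "tt = 0"
    using that qq_le rr_le tqr_nonneg by simp
  have neg: "?D < 0" if "tt \<noteq> 0"
  proof -
    have t: "0 < tt" using that tqr_nonneg by simp
    \<comment> \<open>The factor \<open>tt\<close> makes Cauchy-Schwarz applicable to the term with
      \<open>rr\<close>. Then the square in \<open>qq\<close> is completed, and -6 * tt^2 beats the
      cubic term because \<open>tt\<close> is at most 1/3.\<close>
    have "tt * ?D = - 8 * tt\<^sup>2 + 8 * (tt * qq) + 12 * tt\<^sup>2 * tt - 8 * (tt * rr) - 8 * tt\<^sup>2 * qq"
      by (simp add: power2_eq_square algebra_simps)
    also have "\<dots> \<le> - 8 * tt\<^sup>2 + 8 * (tt * qq) + 12 * tt\<^sup>2 * tt - 8 * qq\<^sup>2 - 8 * tt\<^sup>2 * qq"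
      using qq_square_le by simp
    also have "\<dots> = - 8 * (qq - tt / 2)\<^sup>2 - 6 * tt\<^sup>2 + 12 * tt\<^sup>2 * tt - 8 * tt\<^sup>2 * qq"
      by (simp add: power2_eq_square algebra_simps)
    also have "\<dots> \<le> - 6 * tt\<^sup>2 + 12 * tt\<^sup>2 * (1 / 3)"
    proof -
      have "12 * tt\<^sup>2 * tt \<le> 12 * tt\<^sup>2 * (1 / 3)" using tt_le by (intro mult_left_mono) auto
      moreover have "0 \<le> 8 * tt\<^sup>2 * qq" using tqr_nonneg by simp
      ultimately show ?thesis by (smt (verit) zero_le_power2)
    qed
    also have "\<dots> < 0" using t by simp
    finally show ?thesis using t by (simp add: mult_less_0_iff)
  qed
  show "?D \<le> 0" "?D = 0 \<longleftrightarrow> tt = 0" using zero neg by (cases "tt = 0"; force)+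
qed

end

section \<open>Switching by a random sign\<close>

definition sign_lift :: "('a \<Rightarrow> real) \<Rightarrow> 'a \<times> real \<Rightarrow> real" where
  "sign_lift f p = (if snd p \<le> (1 + f (fst p)) / 2 then 1 else - 1)"

lemma sign_lift_cases: "sign_lift f p = 1 \<or> sign_lift f p = - 1"
  by (simp add: sign_lift_def)

lemma sign_lift_square [simp]: "sign_lift f p * (sign_lift f p * y) = y"
  by (simp add: sign_lift_def)

lemma bdd_sign_lift:
  assumes "bdd_fun M f"
  shows "bdd_fun (M \<Otimes>\<^sub>M unit_interval) (sign_lift f)"
proof -
  have f [measurable]: "f \<in> borel_measurable M" using assms by (rule bdd_fun_measurable)
  have s [measurable]: "(\<lambda>p. snd p) \<in> borel_measurable (M \<Otimes>\<^sub>M unit_interval)"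
    using measurable_compose[OF measurable_snd measurable_unit_interval_borel] .
  have "sign_lift f \<in> borel_measurable (M \<Otimes>\<^sub>M unit_interval)"
    unfolding sign_lift_def[abs_def] by measurable
  moreover have "\<bar>sign_lift f p\<bar> \<le> 1" for p by (simp add: sign_lift_def)
  ultimately show ?thesis unfolding bdd_fun_def by blast
qed

text \<open>The second coordinate is uniform, and the sign is 1 on an interval of length (1 + f u) /
  2.\<close>

lemma integral_sign_lift:
  assumes "\<bar>f u\<bar> \<le> 1"
  shows "(\<integral>r. sign_lift f (u, r) \<partial>unit_interval) = f u"
proof -
  interpret U: prob_space unit_interval by (rule prob_space_unit_interval)
  define a where "a = (1 + f u) / 2"
  have a: "0 \<le> a" "a \<le> 1" using assms by (auto simp: a_def)
  have sets: "{0..a} \<in> sets unit_interval"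
    using a by (auto simp: unit_interval_def sets_restrict_space image_iff intro!: exI[of _ "{0..a}"] bexI[of _ "{0..a}"])
  have m: "measure unit_interval {0..a} = a"
    using measure_unit_interval[of "{0..a}"] a by (simp add: Int_absorb2)
  have "(\<integral>r. sign_lift f (u, r) \<partial>unit_interval) = (\<integral>r. 2 * indicator {0..a} r - 1 \<partial>unit_interval)"
  proof (rule Bochner_Integration.integral_cong[OF refl])
    fix r assume "r \<in> space unit_interval"
    then show "sign_lift f (u, r) = 2 * indicator {0..a} r - 1"
      by (auto simp: sign_lift_def a_def unit_interval_def space_restrict_space indicator_def)
  qed
  also have "\<dots> = 2 * a - 1"
    using sets m by (subst Bochner_Integration.integral_diff) (auto simp: U.prob_space less_top[symmetric])
  finally show ?thesis by (simp add: a_def field_simps)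
qed

context prob_space begin

lemma integral_max_iff:
  assumes A: "bdd_fun M A" and le: "\<And>x. x \<in> space M \<Longrightarrow> A x \<le> c"
  shows "(\<integral>x. A x \<partial>M) \<le> c" "(\<integral>x. A x \<partial>M) = c \<longleftrightarrow> (AE x in M. A x = c)"
proof -
  have int: "integrable M A" by (rule bdd_fun_integrable[OF A])
  have eq: "(\<integral>x. c - A x \<partial>M) = c - (\<integral>x. A x \<partial>M)" using int by (simp add: prob_space)
  have "0 \<le> (\<integral>x. c - A x \<partial>M)" using le by (intro Bochner_Integration.integral_nonneg) auto
  then show "(\<integral>x. A x \<partial>M) \<le> c" using eq by simp
  have "(\<integral>x. c - A x \<partial>M) = 0 \<longleftrightarrow> (AE x in M. c - A x = 0)"
    using int le by (intro integral_nonneg_eq_0_iff_AE) auto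
  then show "(\<integral>x. A x \<partial>M) = c \<longleftrightarrow> (AE x in M. A x = c)"
    using eq by (auto simp: eq_commute[of c])
qed

end

context bounded_skew_kernel begin

text \<open>A function with values in [-1, 1] is the conditional expectation of a random sign. Switching
  by that sign turns the function into the constant 1.\<close>

lemma lift_bounds:
  assumes f: "bdd_fun M f" and f1: "\<And>x. \<bar>f x\<bar> \<le> 1"
  shows "(\<integral>x. (sop f x)\<^sup>2 \<partial>M) \<le> 1 / 3"
    and "(\<integral>x. ((sop ^^ 3) f x)\<^sup>2 \<partial>M) \<le> 17 / 315"
    and "(\<integral>x. ((sop ^^ 3) f x)\<^sup>2 \<partial>M) = 17 / 315 \<longleftrightarrow> (\<integral>x. (sop f x)\<^sup>2 \<partial>M) = 1 / 3"
proof -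
  interpret U: prob_space unit_interval by (rule prob_space_unit_interval)
  interpret P: pair_prob_space M unit_interval ..
  let ?N = "M \<Otimes>\<^sub>M unit_interval"
  define e where "e = sign_lift f"
  define S' where "S' p q = e p * S (fst p) (fst q) * e q" for p q
  have e: "bdd_fun ?N e" unfolding e_def by (rule bdd_sign_lift[OF f])
  have e1: "\<bar>e p\<bar> = 1" for p unfolding e_def using sign_lift_cases[of f p] by auto
  have "bdd_kernel ?N (\<lambda>p q. S (fst p) (fst q))"
    unfolding bdd_kernel_def case_prod_beta by (rule bdd_kernel_comp[OF bdd]) auto
  then have bdd': "bdd_kernel ?N S'"
    unfolding S'_def[abs_def] by (intro bdd_kernel_mult bdd_kernel_left bdd_kernel_right e)
  have skew': "skew S'"
    unfolding skew_def
  proof (intro allI)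
    show "S' p q = - S' q p" for p q
      unfolding S'_def using skewD[OF skew, of "fst p" "fst q"] by simp
  qed
  interpret K: bounded_skew_kernel ?N S'
  proof unfold_locales
    show "skew S'" "bdd_kernel ?N S'" by fact+
    show "\<bar>S' p q\<bar> \<le> 1" for p q using le_1 by (simp add: S'_def abs_mult e1)
  qed
  have split: "(\<integral>p. F p \<partial>?N) = (\<integral>x. (\<integral>r. F (x, r) \<partial>unit_interval) \<partial>M)" if "bdd_fun ?N F" for F
    using P.integral_fst'[OF P.bdd_fun_integrable[OF that]] by simp
  have marg: "(\<integral>p. F (fst p) \<partial>?N) = (\<integral>x. F x \<partial>M)" if "bdd_fun M F" for F
    using split[OF bdd_fun_comp[OF that measurable_fst]] by (simp add: U.prob_space)
  \<comment> \<open>The outer sign does not depend on the integration variable, and the inner sign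
    averages to f.\<close>
  have v1: "kernel_op ?N S' (\<lambda>_. 1) p = e p * sop f (fst p)" if p: "p \<in> space ?N" for p
  proof -
    have x: "fst p \<in> space M" using p by (auto simp: space_pair_measure)
    have "kernel_op ?N S' (\<lambda>_. 1) p = (\<integral>q. e p * (S (fst p) (fst q) * e q) \<partial>?N)"
      by (simp add: kernel_op_def S'_def mult.assoc)
    also have "\<dots> = e p * (\<integral>q. S (fst p) (fst q) * e q \<partial>?N)" by simp
    also have "(\<integral>q. S (fst p) (fst q) * e q \<partial>?N) = (\<integral>y. (\<integral>r. S (fst p) y * e (y, r) \<partial>unit_interval) \<partial>M)"
      using split[OF bdd_fun_mult[OF bdd_fun_comp[OF bdd_kernel_section[OF bdd x] measurable_fst] e]] by simp
    also have "\<dots> = sop f (fst p)"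
      unfolding kernel_op_def e_def by (simp add: integral_sign_lift f1)
    finally show ?thesis .
  qed
  \<comment> \<open>From the second application on, the two copies of the inner sign cancel, so the
    kernel acts as S on the first coordinate.\<close>
  have step: "kernel_op ?N S' (\<lambda>q. e q * g (fst q)) p = e p * sop g (fst p)"
    if p: "p \<in> space ?N" and g: "bdd_fun M g" for g p
  proof -
    have x: "fst p \<in> space M" using p by (auto simp: space_pair_measure)
    have "kernel_op ?N S' (\<lambda>q. e q * g (fst q)) p = (\<integral>q. e p * (S (fst p) (fst q) * g (fst q)) \<partial>?N)"
      unfolding kernel_op_def S'_def e_def by (simp add: mult.assoc mult.left_commute)
    also have "\<dots> = e p * (\<integral>q. S (fst p) (fst q) * g (fst q) \<partial>?N)" by simp
    also have "(\<integral>q. S (fst p) (fst q) * g (fst q) \<partial>?N) = sop g (fst p)"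
      unfolding kernel_op_def using marg[OF bdd_fun_mult[OF bdd_kernel_section[OF bdd x] g]] by simp
    finally show ?thesis .
  qed
  have vec: "K.vec (Suc n) p = e p * (sop ^^ Suc n) f (fst p)" if "p \<in> space ?N" for n p
    using that
  proof (induction n arbitrary: p)
    case 0
    then show ?case using v1 by (simp add: K.vec_Suc)
  next
    case (Suc n)
    have "K.vec (Suc (Suc n)) p = kernel_op ?N S' (\<lambda>q. e q * (sop ^^ Suc n) f (fst q)) p"
      unfolding K.vec_Suc[of "Suc n"] using Suc.IH by (intro fun_cong[OF P.kernel_op_cong])
    also have "\<dots> = e p * sop ((sop ^^ Suc n) f) (fst p)"
      by (rule step[OF Suc.prems bdd_pow[OF f]])
    finally show ?case by simp
  qed
  have norm: "(\<integral>p. (K.vec (Suc n) p)\<^sup>2 \<partial>?N) = (\<integral>x. ((sop ^^ Suc n) f x)\<^sup>2 \<partial>M)" for n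
  proof -
    have "(\<integral>p. (K.vec (Suc n) p)\<^sup>2 \<partial>?N) = (\<integral>p. ((sop ^^ Suc n) f (fst p))\<^sup>2 \<partial>?N)"
    proof (rule Bochner_Integration.integral_cong[OF refl])
      fix p assume "p \<in> space ?N"
      then have "(K.vec (Suc n) p)\<^sup>2 = \<bar>e p\<bar>\<^sup>2 * ((sop ^^ Suc n) f (fst p))\<^sup>2"
        by (simp only: vec power_mult_distrib power2_abs)
      then show "(K.vec (Suc n) p)\<^sup>2 = ((sop ^^ Suc n) f (fst p))\<^sup>2" by (simp only: e1) simp
    qed
    also have "\<dots> = (\<integral>x. ((sop ^^ Suc n) f x)\<^sup>2 \<partial>M)"
      by (rule marg[OF bdd_fun_power[OF bdd_pow[OF f]]])
    finally show ?thesis .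
  qed
  have tt: "K.tt = (\<integral>x. (sop f x)\<^sup>2 \<partial>M)" using norm[of 0] by (simp add: K.tt_def)
  have rr: "K.rr = (\<integral>x. ((sop ^^ 3) f x)\<^sup>2 \<partial>M)" using norm[of 2] by (simp add: K.rr_def numeral_3_eq_3)
  show "(\<integral>x. (sop f x)\<^sup>2 \<partial>M) \<le> 1 / 3" using K.tt_le tt by simp
  show "(\<integral>x. ((sop ^^ 3) f x)\<^sup>2 \<partial>M) \<le> 17 / 315" using K.rr_bound(1) rr by simp
  show "(\<integral>x. ((sop ^^ 3) f x)\<^sup>2 \<partial>M) = 17 / 315 \<longleftrightarrow> (\<integral>x. (sop f x)\<^sup>2 \<partial>M) = 1 / 3"
    using K.rr_bound(2) tt rr by simp
qed

text \<open>Maximal trace of the fourth power together with regularity, since \<open>tt\<close> is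
  the squared norm of \<open>S 1\<close>.\<close>

definition extremal :: bool where
  "extremal \<longleftrightarrow> cycle_integral M S 4 = 1 / 3 \<and> tt = 0"

text \<open>Both traces are means over x of the norms in \<open>lift_bounds\<close> for the column
  at x. A mean attains a pointwise bound only if almost every term does, and for each x the two
  bounds are attained simultaneously.\<close>

lemma skew_cycle_bounds:
  "cycle_integral M S 4 \<le> 1 / 3" "cycle_integral M S 8 \<le> 17 / 315"
  "cycle_integral M S 8 = 17 / 315 \<longleftrightarrow> cycle_integral M S 4 = 1 / 3"
proof -
  define A where "A j x = (\<integral>u. ((sop ^^ j) (\<lambda>u. S u x) u)\<^sup>2 \<partial>M)" for j x
  have A: "bdd_fun M (A j)" for j
    unfolding A_def[abs_def] power2_eq_square
    by (intro bdd_fun_integral bdd_kernel_mult bdd_kernel_op_pow[OF bdd bdd_kernel_swap[OF bdd]])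
  have 4: "cycle_integral M S 4 = (\<integral>x. A 1 x \<partial>M)" and 8: "cycle_integral M S 8 = (\<integral>x. A 3 x \<partial>M)"
    using cycle_integral_even[of 1] cycle_integral_even[of 3] by (simp_all add: A_def)
  have A1: "A 1 x \<le> 1 / 3" and A3: "A 3 x \<le> 17 / 315" and A13: "A 3 x = 17 / 315 \<longleftrightarrow> A 1 x = 1 / 3"
    if "x \<in> space M" for x
    using lift_bounds[OF bdd_col[OF that]] le_1 unfolding A_def by simp_all
  show "cycle_integral M S 4 \<le> 1 / 3" unfolding 4 by (rule integral_max_iff(1)[OF A A1])
  show "cycle_integral M S 8 \<le> 17 / 315" unfolding 8 by (rule integral_max_iff(1)[OF A A3])
  have "(AE x in M. A 3 x = 17 / 315) \<longleftrightarrow> (AE x in M. A 1 x = 1 / 3)"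
    using A13 by (intro AE_cong) auto
  then show "cycle_integral M S 8 = 17 / 315 \<longleftrightarrow> cycle_integral M S 4 = 1 / 3"
    unfolding 4 8 using integral_max_iff(2)[OF A A1] integral_max_iff(2)[OF A A3] by simp
qed

text \<open>The trace of the power of S and the correction have separate upper bounds, so equality
  in the sum forces equality in both.\<close>

theorem cycle_density_bounds:
  "2 ^ 4 * cycle_integral M ww 4 \<le> 4 / 3" "2 ^ 4 * cycle_integral M ww 4 = 4 / 3 \<longleftrightarrow> extremal"
  "2 ^ 8 * cycle_integral M ww 8 \<le> 332 / 315" "2 ^ 8 * cycle_integral M ww 8 = 332 / 315 \<longleftrightarrow> extremal"
proof -
  have 4: "2 ^ 4 * cycle_integral M ww 4 = 1 + cycle_integral M S 4 - 4 * tt"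
    using cycle_integrals_plus_one(2) cycle_integral_ww[of 4] by simp
  have 8: "2 ^ 8 * cycle_integral M ww 8 = 1 + cycle_integral M S 8 +
      (- 8 * tt + 8 * qq + 12 * tt\<^sup>2 - 8 * rr - 8 * tt * qq)"
    using cycle_integrals_plus_one(5) cycle_integral_ww[of 8] by simp
  show "2 ^ 4 * cycle_integral M ww 4 \<le> 4 / 3"
    unfolding 4 using skew_cycle_bounds(1) tqr_nonneg(1) by linarith
  show "2 ^ 4 * cycle_integral M ww 4 = 4 / 3 \<longleftrightarrow> extremal"
    unfolding 4 extremal_def using skew_cycle_bounds(1) tqr_nonneg(1) by (auto simp: field_simps)
  show "2 ^ 8 * cycle_integral M ww 8 \<le> 332 / 315"
    unfolding 8 using skew_cycle_bounds(2) irregular_8(1) by linarith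
  have "1 + cycle_integral M S 8 + (- 8 * tt + 8 * qq + 12 * tt\<^sup>2 - 8 * rr - 8 * tt * qq) = 332 / 315
    \<longleftrightarrow> cycle_integral M S 8 = 17 / 315 \<and> - 8 * tt + 8 * qq + 12 * tt\<^sup>2 - 8 * rr - 8 * tt * qq = 0"
    using skew_cycle_bounds(2) irregular_8(1) by linarith
  then show "2 ^ 8 * cycle_integral M ww 8 = 332 / 315 \<longleftrightarrow> extremal"
    unfolding 8 extremal_def using skew_cycle_bounds(3) irregular_8(2) by simp
qed

end

section \<open>Locally transitive tournaments and labelled densities\<close>

definition tours :: "nat \<Rightarrow> (nat \<times> nat) set set" where
  "tours n = {E. E \<subseteq> {..<n} \<times> {..<n} \<and> (\<forall>i<n. (i, i) \<notin> E) \<and>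
     (\<forall>i<n. \<forall>j<n. i \<noteq> j \<longrightarrow> ((i, j) \<in> E) = ((j, i) \<notin> E))}"

lemma toursD:
  assumes "E \<in> tours n"
  shows "E \<subseteq> {..<n} \<times> {..<n}" "(i, i) \<notin> E"
    "i < n \<Longrightarrow> j < n \<Longrightarrow> i \<noteq> j \<Longrightarrow> ((i, j) \<in> E) = ((j, i) \<notin> E)"
  using assms unfolding tours_def by blast+

lemma toursI:
  assumes "E \<subseteq> {..<n} \<times> {..<n}" "\<And>i. i < n \<Longrightarrow> (i, i) \<notin> E"
    "\<And>i j. i < n \<Longrightarrow> j < n \<Longrightarrow> i \<noteq> j \<Longrightarrow> ((i, j) \<in> E) = ((j, i) \<notin> E)"
  shows "E \<in> tours n"
  using assms unfolding tours_def by blast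

lemma finite_tours [simp]: "finite (tours n)"
  by (rule finite_subset[of _ "Pow ({..<n} \<times> {..<n})"]) (auto simp: tours_def)

lemma finite_arcs: "E \<in> tours n \<Longrightarrow> finite E"
  by (rule finite_subset[OF toursD(1)]) auto

definition upairs :: "nat \<Rightarrow> (nat \<times> nat) set" where
  "upairs n = {(i, j). i < j \<and> j < n}"

text \<open>X is the set of pairs oriented upwards. This identifies the tournaments with a power
  set, over which products of sums can be expanded.\<close>

definition orient :: "nat \<Rightarrow> (nat \<times> nat) set \<Rightarrow> (nat \<times> nat) set" where
  "orient n X = X \<union> prod.swap ` (upairs n - X)"

lemma finite_upairs [simp]: "finite (upairs n)"
  by (rule finite_subset[of _ "{..<n} \<times> {..<n}"]) (auto simp: upairs_def)

lemma mem_orient: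
  "X \<subseteq> upairs n \<Longrightarrow> (i, j) \<in> orient n X \<longleftrightarrow> (if i < j then (i, j) \<in> X else j < i \<and> i < n \<and> (j, i) \<notin> X)"
proof -
  have "(i, j) \<in> prod.swap ` (upairs n - X) \<longleftrightarrow> (j, i) \<in> upairs n - X" by force
  then show "X \<subseteq> upairs n \<Longrightarrow> ?thesis" by (auto simp: orient_def upairs_def)
qed

lemma orient_bij: "bij_betw (orient n) (Pow (upairs n)) (tours n)"
proof (rule bij_betw_byWitness[where f' = "\<lambda>E. E \<inter> upairs n"])
  show "\<forall>X\<in>Pow (upairs n). orient n X \<inter> upairs n = X"
    by (auto simp: orient_def upairs_def)
  show "\<forall>E\<in>tours n. orient n (E \<inter> upairs n) = E"
  proof
    fix E assume E: "E \<in> tours n"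
    have "(i, j) \<in> orient n (E \<inter> upairs n) \<longleftrightarrow> (i, j) \<in> E" for i j
    proof (cases i j rule: linorder_cases)
      case less
      then show ?thesis using toursD(1)[OF E] by (subst mem_orient) (auto simp: upairs_def)
    next
      case equal
      then show ?thesis using toursD(2)[OF E] by (subst mem_orient) auto
    next
      case greater
      then have "(i, j) \<in> orient n (E \<inter> upairs n) \<longleftrightarrow> i < n \<and> (j, i) \<notin> E"
        by (subst mem_orient) (auto simp: upairs_def)
      also have "\<dots> \<longleftrightarrow> (i, j) \<in> E"
        using toursD(1)[OF E] toursD(3)[OF E, of j i] greater by auto
      finally show ?thesis .
    qed
    then show "orient n (E \<inter> upairs n) = E" by auto
  qed
  show "orient n ` Pow (upairs n) \<subseteq> tours n"
  proof safe
    fix X assume "X \<subseteq> upairs n"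
    then have m: "(i, j) \<in> orient n X \<longleftrightarrow> (if i < j then (i, j) \<in> X else j < i \<and> i < n \<and> (j, i) \<notin> X)" for i j
      by (rule mem_orient)
    show "orient n X \<in> tours n"
    proof (rule toursI)
      show "orient n X \<subseteq> {..<n} \<times> {..<n}" using \<open>X \<subseteq> upairs n\<close> by (auto simp: orient_def upairs_def)
      show "(i, i) \<notin> orient n X" for i by (simp add: m)
      show "((i, j) \<in> orient n X) = ((j, i) \<notin> orient n X)" if "i < n" "j < n" "i \<noteq> j" for i j
        using that unfolding m by (cases "i < j") auto
    qed
  qed
  show "(\<lambda>E. E \<inter> upairs n) ` tours n \<subseteq> Pow (upairs n)" by auto
qed

lemma prod_orient:
  assumes "X \<subseteq> upairs n"
  shows "(\<Prod>(i, j)\<in>orient n X. w i j) = (\<Prod>(i, j)\<in>X. w i j) * (\<Prod>(i, j)\<in>upairs n - X. (w j i :: real))"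
proof -
  have fin: "finite X" by (rule finite_subset[OF assms]) simp
  have "X \<inter> prod.swap ` (upairs n - X) = {}" using assms by (auto simp: upairs_def)
  then have "(\<Prod>(i, j)\<in>orient n X. w i j) = (\<Prod>(i, j)\<in>X. w i j) * (\<Prod>(i, j)\<in>prod.swap ` (upairs n - X). w i j)"
    unfolding orient_def using fin by (intro prod.union_disjoint) auto
  also have "(\<Prod>(i, j)\<in>prod.swap ` (upairs n - X). w i j) = (\<Prod>(i, j)\<in>upairs n - X. w j i)"
    by (subst prod.reindex) (auto simp: case_prod_beta inj_on_def prod.swap_def)
  finally show ?thesis .
qed

lemma sum_tours_prod:
  fixes w :: "nat \<Rightarrow> nat \<Rightarrow> real"
  shows "(\<Sum>E\<in>tours n. \<Prod>(i, j)\<in>E. w i j) = (\<Prod>(i, j)\<in>upairs n. w i j + w j i)"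
proof -
  have "(\<Sum>E\<in>tours n. \<Prod>(i, j)\<in>E. w i j) = (\<Sum>X\<in>Pow (upairs n). \<Prod>(i, j)\<in>orient n X. w i j)"
    by (rule sum.reindex_bij_betw[OF orient_bij, symmetric])
  also have "\<dots> = (\<Sum>X\<in>Pow (upairs n). (\<Prod>p\<in>X. w (fst p) (snd p)) * (\<Prod>p\<in>upairs n - X. w (snd p) (fst p)))"
  proof (intro sum.cong refl)
    fix X assume "X \<in> Pow (upairs n)"
    then show "(\<Prod>(i, j)\<in>orient n X. w i j)
      = (\<Prod>p\<in>X. w (fst p) (snd p)) * (\<Prod>p\<in>upairs n - X. w (snd p) (fst p))"
      using prod_orient[of X n w] by (simp add: case_prod_beta)
  qed
  also have "\<dots> = (\<Prod>p\<in>upairs n. w (fst p) (snd p) + w (snd p) (fst p))"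
    by (rule prod_add[symmetric]) simp
  finally show ?thesis by (simp add: case_prod_beta)
qed

text \<open>The diagonal value -1 violates skewness; the transfer lemmas for \<open>c4\<close>
  therefore compare signs at different vertices only.\<close>

definition sg :: "(nat \<times> nat) set \<Rightarrow> nat \<Rightarrow> nat \<Rightarrow> real" where
  "sg E i j = (if (i, j) \<in> E then 1 else - 1)"

text \<open>The sum of the three 4-cycles on four vertices. For signs it is 1 or -3, it is invariant
  under switching, and it is 1 iff no vertex dominates or is dominated by a cyclic triangle.\<close>

definition c4 :: "('b \<Rightarrow> 'b \<Rightarrow> real) \<Rightarrow> 'b \<Rightarrow> 'b \<Rightarrow> 'b \<Rightarrow> 'b \<Rightarrow> real" where
  "c4 s a b c d = closed_walk s [a, b, c, d] + closed_walk s [a, b, d, c] + closed_walk s [a, c, b, d]"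

lemma c4_eq:
  "c4 s a b c d = s a b * s b c * s c d * s d a + s a b * s b d * s d c * s c a + s a c * s c b * s b d * s d a"
  by (simp add: c4_def closed_walk_Cons mult.assoc)

text \<open>The key estimate is \<bar>y + z\<bar> <= 1 + y z; the factor x only shrinks the left
  side.\<close>

lemma xyz_bound:
  fixes x y z :: real
  assumes "\<bar>x\<bar> \<le> 1" "\<bar>y\<bar> \<le> 1" "\<bar>z\<bar> \<le> 1"
  shows "x * y + x * z - y * z \<le> 1"
proof -
  have "0 \<le> (1 - y) * (1 - z)" "0 \<le> (1 + y) * (1 + z)" using assms by auto
  then have "\<bar>y + z\<bar> \<le> 1 + y * z" by (auto simp: algebra_simps abs_le_iff)
  moreover have "x * (y + z) \<le> \<bar>y + z\<bar>"
    using assms(1) mult_right_mono[of "\<bar>x\<bar>" 1 "\<bar>y + z\<bar>"] abs_ge_self[of "x * (y + z)"] by (simp add: abs_mult)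
  ultimately show ?thesis by (simp add: algebra_simps)
qed

text \<open>Each 4-cycle is the union of two of the three perfect matchings of the four vertices.
  With x, y, z the products over the matchings, skewness turns the sum into x y + x z - y z.\<close>

lemma c4_rewrite:
  assumes "\<And>x y. s x y = - s y x"
  shows "c4 s a b c d = (s a c * s b d) * (s a b * s c d) + (s a c * s b d) * (s a d * s b c) - (s a b * s c d) * (s a d * s b c)"
  unfolding c4_eq assms[of d a] assms[of c a] assms[of d c] assms[of c b] by (simp add: algebra_simps)

lemma c4_le_1:
  assumes "\<And>x y. s x y = - s y x" "\<And>x y. \<bar>s x y\<bar> \<le> 1"
  shows "c4 s a b c d \<le> 1"
  unfolding c4_rewrite[of s, OF assms(1)] using assms(2) by (intro xyz_bound) (auto simp: abs_mult intro: mult_le_one)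

text \<open>Each perfect matching contains exactly one arc at a, so all three products are smaller
  than 1 in modulus and the bound becomes strict.\<close>

lemma c4_less_1:
  assumes "\<And>x y. s x y = - s y x" "\<And>x y. \<bar>s x y\<bar> \<le> 1"
    and "\<bar>s a b\<bar> < 1" "\<bar>s a c\<bar> < 1" "\<bar>s a d\<bar> < 1"
  shows "c4 s a b c d < 1"
proof -
  define x where "x = s a c * s b d"
  define y where "y = s a b * s c d"
  define z where "z = s a d * s b c"
  have less: "\<bar>p * q\<bar> < 1" if "\<bar>p\<bar> < 1" "\<bar>q\<bar> \<le> 1" for p q :: real
    using that mult_left_le[of "\<bar>q\<bar>" "\<bar>p\<bar>"] by (simp add: abs_mult)
  have xyz: "\<bar>x\<bar> < 1" "\<bar>y\<bar> < 1" "\<bar>z\<bar> < 1" unfolding x_def y_def z_def by (intro less assms(2-5))+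
  have "0 < (1 - y) * (1 - z)" "0 < (1 + y) * (1 + z)" using xyz by (auto intro!: mult_pos_pos)
  then have "\<bar>y + z\<bar> < 1 + y * z" by (auto simp: algebra_simps abs_less_iff)
  moreover have "x * (y + z) \<le> \<bar>y + z\<bar>"
    using xyz(1) mult_right_mono[of "\<bar>x\<bar>" 1 "\<bar>y + z\<bar>"] abs_ge_self[of "x * (y + z)"] by (simp add: abs_mult)
  ultimately have "x * y + x * z - y * z < 1" by (simp add: algebra_simps)
  then show ?thesis unfolding c4_rewrite[of s, OF assms(1)] x_def y_def z_def by (simp add: mult.commute mult.left_commute)
qed

lemma c4_sign_transfer:
  assumes "\<And>x y. x \<in> {a, b, c, d} \<Longrightarrow> y \<in> {a, b, c, d} \<Longrightarrow> x \<noteq> y \<Longrightarrow> s x y = t (f x) (f y)"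
    and "distinct [a, b, c, d]"
  shows "c4 s a b c d = c4 t (f a) (f b) (f c) (f d)"
proof -
  have "s a b = t (f a) (f b)" "s b c = t (f b) (f c)" "s c d = t (f c) (f d)" "s d a = t (f d) (f a)"
    "s b d = t (f b) (f d)" "s d c = t (f d) (f c)" "s c a = t (f c) (f a)" "s a c = t (f a) (f c)" "s c b = t (f c) (f b)"
    using assms(2) by (auto intro!: assms(1))
  then show ?thesis unfolding c4_eq by simp
qed

text \<open>A 4-cycle visits each vertex with two arcs, so every switching sign occurs
  squared.\<close>

lemma c4_switch:
  assumes "\<And>x y. x \<in> {a, b, c, d} \<Longrightarrow> y \<in> {a, b, c, d} \<Longrightarrow> x \<noteq> y \<Longrightarrow> s x y = e x * e y * t x y"
    and "distinct [a, b, c, d]" "\<And>x. e x * e x = (1::real)"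
  shows "c4 s a b c d = c4 t a b c d"
proof -
  have q: "(e a * e b * w) * (e b * e c * x) * (e c * e d * y) * (e d * e a * z) = w * x * y * z"
    for a b c d w x y z
  proof -
    have "(e a * e b * w) * (e b * e c * x) * (e c * e d * y) * (e d * e a * z)
      = (e a * e a) * (e b * e b) * (e c * e c) * (e d * e d) * (w * x * y * z)" by (simp only: ac_simps)
    then show ?thesis by (simp add: assms(3))
  qed
  have s: "s a b = e a * e b * t a b" "s b c = e b * e c * t b c" "s c d = e c * e d * t c d" "s d a = e d * e a * t d a"
    "s b d = e b * e d * t b d" "s d c = e d * e c * t d c" "s c a = e c * e a * t c a" "s a c = e a * e c * t a c"
    "s c b = e c * e b * t c b"
    using assms(2) by (auto intro!: assms(1))
  show ?thesis
    unfolding c4_eq s by (simp only: q)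
qed

text \<open>If the source f of V does not beat the new vertex v, then v beats f, and it beats every
  other j, as otherwise v, f, j would form a cyclic triangle. Applied to a relation and its
  converse, this yields a source and a sink.\<close>

lemma ex_source:
  assumes "finite V" "V \<noteq> {}"
    and tot: "\<And>i j. i \<in> V \<Longrightarrow> j \<in> V \<Longrightarrow> i \<noteq> j \<Longrightarrow> R i j \<or> R j i"
    and acyc: "\<And>i j k. i \<in> V \<Longrightarrow> j \<in> V \<Longrightarrow> k \<in> V \<Longrightarrow> distinct [i, j, k] \<Longrightarrow> R i j \<Longrightarrow> R j k \<Longrightarrow> \<not> R k i"
  shows "\<exists>f\<in>V. \<forall>j\<in>V - {f}. R f j"
  using assms
proof (induction V rule: finite_ne_induct)
  case (singleton x)
  show ?case by blast
next
  case (insert v V)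
  have "\<exists>f\<in>V. \<forall>j\<in>V - {f}. R f j"
    using insert.prems by (intro insert.IH) blast+
  then obtain f where f: "f \<in> V" "\<forall>j\<in>V - {f}. R f j" by blast
  show ?case
  proof (cases "R f v")
    case True then show ?thesis using f by blast
  next
    case False
    have vf: "R v f" using insert.prems(1)[of v f] insert.hyps f False by blast
    have "R v j" if j: "j \<in> V" for j
    proof (cases "j = f")
      case False
      then have "R f j" using f j by blast
      moreover have "distinct [v, f, j]" using insert.hyps f j False by auto
      ultimately have "\<not> R j v" using insert.prems(2)[of v f j] vf f j by blast
      then show ?thesis using insert.prems(1)[of v j] insert.hyps j by blast
    qed (use vf in simp)
    then show ?thesis by blast
  qed
qed

text \<open>The last vertex u is compared with a switched transitive tournament on the others. If the source
  f and the sink l agree about u, then everybody does, so two vertices decide the pattern.\<close>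

lemma pattern_difference:
  fixes s :: "nat \<Rightarrow> nat \<Rightarrow> real" and a :: "nat \<Rightarrow> real"
  assumes skew: "\<And>x y. s x y = - s y x"
    and a: "\<And>i. a i = 1 \<or> a i = - 1"
    and fl: "f < n" "l < n"
    and f: "\<And>j. j < n \<Longrightarrow> j \<noteq> f \<Longrightarrow> a f * a j * s f j = 1"
    and l: "\<And>j. j < n \<Longrightarrow> j \<noteq> l \<Longrightarrow> a j * a l * s j l = 1"
    and u: "\<And>i. i < n \<Longrightarrow> s i n = 1 \<or> s i n = - 1"
    and c4: "\<And>i j k. i < n \<Longrightarrow> j < n \<Longrightarrow> k < n \<Longrightarrow> distinct [i, j, k] \<Longrightarrow> c4 s i j k n = 1"
  shows "(\<Prod>i<n. (1 + a i * s i n) / 2) - (\<Prod>i<n. (1 - a i * s i n) / 2) = (a f * s f n + a l * s l n) / 2"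
proof -
  define b where "b i = a i * s i n" for i
  have b: "b i = 1 \<or> b i = - 1" if "i < n" for i using a[of i] u[OF that] by (auto simp: b_def)
  \<comment> \<open>After switching, f precedes i and i precedes l. If n agreed on f and l but not
    on i, it would form with i and one of f, l a cyclic triangle that the other one dominates or is
    dominated by.\<close>
  have mid: "b i = b f" if i: "i < n" and eq: "b f = b l" for i
  proof (cases "i = f \<or> i = l")
    case False
    have fl': "f \<noteq> l"
    proof
      assume "f = l"
      then have "a f * a i * s f i = 1" "a i * a f * s i f = 1" using f l i False by auto
      moreover have "a i * a f * s i f = - (a f * a i * s f i)" using skew[of i f] by simp
      ultimately show False by simp
    qed
    have "a f * a i * s f i = 1" "a f * a l * s f l = 1" "a i * a l * s i l = 1"
      using f[of i] f[of l] l[of i] fl fl' i False by auto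
    moreover have "c4 s f i l n = 1" using c4[of f i l] fl i False fl' by auto
    ultimately show ?thesis
      using a[of f] a[of i] a[of l] u[of f] u[of i] u[of l] fl i eq
      unfolding c4_rewrite[of s, OF skew] b_def by (elim disjE) (simp_all, (auto simp: field_simps)?)
  qed (use eq in auto)
  have "(\<Prod>i<n. (1 + b i) / 2) - (\<Prod>i<n. (1 - b i) / 2) = (b f + b l) / 2"
  proof (cases "b f = b l")
    case True
    have all: "b i = b f" if "i < n" for i using mid[OF that True] .
    show ?thesis
    proof (cases "b f = 1")
      case True
      have "(\<Prod>i<n. (1 + b i) / 2) = 1" using all True by (intro prod.neutral) auto
      moreover have "(\<Prod>i<n. (1 - b i) / 2) = 0" using True fl by (intro prod_zero) auto
      ultimately show ?thesis using True \<open>b f = b l\<close> by simp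
    next
      case False
      then have m: "b f = - 1" using b fl by blast
      have "(\<Prod>i<n. (1 - b i) / 2) = 1" using all m by (intro prod.neutral) auto
      moreover have "(\<Prod>i<n. (1 + b i) / 2) = 0" using m fl by (intro prod_zero bexI[of _ f]) auto
      ultimately show ?thesis using m \<open>b f = b l\<close> by simp
    qed
  next
    case False
    \<comment> \<open>If f and l disagree, n shows neither the pattern a nor its opposite, and the
      right-hand side is 0 as well.\<close>
    then have mixed: "(b f = 1 \<and> b l = - 1) \<or> (b f = - 1 \<and> b l = 1)" using b[OF fl(1)] b[OF fl(2)] by auto
    have p: "(\<Prod>i<n. (1 + b i) / 2) = 0"
      using mixed fl by (intro prod_zero) (auto intro: bexI[of _ f] bexI[of _ l])
    have q: "(\<Prod>i<n. (1 - b i) / 2) = 0"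
      using mixed fl by (intro prod_zero) (auto intro: bexI[of _ f] bexI[of _ l])
    show ?thesis unfolding p q using mixed by auto
  qed
  then show ?thesis by (simp add: b_def)
qed

text \<open>After switching by a, the vertices i, j, k form a cyclic triangle. Showing the pattern a
  or its opposite would make n dominated by that triangle or dominate it.\<close>

lemma pattern_zero:
  fixes s :: "nat \<Rightarrow> nat \<Rightarrow> real" and a :: "nat \<Rightarrow> real"
  assumes skew: "\<And>x y. s x y = - s y x"
    and a: "\<And>i. a i = 1 \<or> a i = - 1"
    and ijk: "i < n" "j < n" "k < n" "distinct [i, j, k]"
    and cyc: "a i * a j * s i j = 1" "a j * a k * s j k = 1" "a k * a i * s k i = 1"
    and u: "\<And>i. i < n \<Longrightarrow> s i n = 1 \<or> s i n = - 1"
    and c4: "c4 s i j k n = 1"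
  shows "(\<Prod>i<n. (1 + a i * s i n) / 2) = 0" "(\<Prod>i<n. (1 - a i * s i n) / 2) = 0"
proof -
  have "\<not> (a i * s i n = a j * s j n \<and> a j * s j n = a k * s k n)"
    using a[of i] a[of j] a[of k] u[of i] u[of j] u[of k] ijk cyc c4 skew[of i k]
    unfolding c4_rewrite[of s, OF skew] by (elim disjE) (simp_all, (auto simp: field_simps)?)
  moreover have b: "a i * s i n = 1 \<or> a i * s i n = - 1" if "i < n" for i
    using a[of i] u[OF that] by auto
  ultimately have "\<exists>m\<in>{..<n}. a m * s m n = 1" "\<exists>m\<in>{..<n}. a m * s m n = - 1"
    using ijk by (metis lessThan_iff)+
  then obtain m m' where m: "m < n" "a m * s m n = 1" "m' < n" "a m' * s m' n = - 1" by auto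
  show "(\<Prod>i<n. (1 + a i * s i n) / 2) = 0" using m by (intro prod_zero bexI[of _ m']) auto
  show "(\<Prod>i<n. (1 - a i * s i n) / 2) = 0" using m by (intro prod_zero bexI[of _ m]) auto
qed

section \<open>Switching and relabelling of labelled tournaments\<close>

definition labelled_density :: "'a measure \<Rightarrow> ('a \<Rightarrow> 'a \<Rightarrow> real) \<Rightarrow> nat \<Rightarrow> (nat \<times> nat) set \<Rightarrow> real" where
  "labelled_density M W n E = (\<integral>x. (\<Prod>(i, j)\<in>E. W (x i) (x j)) \<partial>(\<Pi>\<^sub>M i\<in>{..<n}. M))"

definition locally_transitive :: "nat \<Rightarrow> (nat \<times> nat) set \<Rightarrow> bool" where
  "locally_transitive n E \<longleftrightarrow> (\<forall>a<n. \<forall>b<n. \<forall>c<n. \<forall>d<n. distinct [a, b, c, d] \<longrightarrow> c4 (sg E) a b c d = 1)"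

definition switch :: "nat \<Rightarrow> (nat \<times> nat) set \<Rightarrow> (nat \<times> nat) set" where
  "switch k E = {(i, j). if (i = k) \<noteq> (j = k) then (j, i) \<in> E else (i, j) \<in> E}"

lemma mem_switch: "(i, j) \<in> switch k E \<longleftrightarrow> (if (i = k) \<noteq> (j = k) then (j, i) \<in> E else (i, j) \<in> E)"
  by (simp add: switch_def)

lemma switch_tours:
  assumes "E \<in> tours n" "k < n"
  shows "switch k E \<in> tours n"
proof (rule toursI)
  show "switch k E \<subseteq> {..<n} \<times> {..<n}"
    using toursD(1)[OF assms(1)] by (auto simp: switch_def split: if_splits)
  show "(i, i) \<notin> switch k E" for i using toursD(2)[OF assms(1)] by (simp add: mem_switch)
  show "((i, j) \<in> switch k E) = ((j, i) \<notin> switch k E)" if "i < n" "j < n" "i \<noteq> j" for i j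
    using toursD(3)[OF assms(1), of i j] that unfolding mem_switch by (cases "i = k"; cases "j = k") simp_all
qed

lemma sg_switch:
  assumes E: "E \<in> tours n" and "i < n" "j < n" "i \<noteq> j"
  shows "sg (switch k E) i j = (if i = k then - 1 else 1) * (if j = k then - 1 else 1) * sg E i j"
  using toursD(3)[OF E, of i j] assms unfolding sg_def mem_switch by (cases "i = k"; cases "j = k") simp_all

lemma locally_transitive_switch:
  assumes E: "E \<in> tours n" and lt: "locally_transitive n E"
  shows "locally_transitive n (switch k E)"
  unfolding locally_transitive_def
proof (intro allI impI)
  fix a b c d assume abcd: "a < n" "b < n" "c < n" "d < n" "distinct [a, b, c, d]"
  have "c4 (sg (switch k E)) a b c d = c4 (sg E) a b c d"
  proof (rule c4_switch[where e = "\<lambda>x. if x = k then - 1 else 1"])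
    fix x y assume xy: "x \<in> {a, b, c, d}" "y \<in> {a, b, c, d}" "x \<noteq> y"
    then have "x < n" "y < n" using abcd by auto
    then show "sg (switch k E) x y = (if x = k then - 1 else 1) * (if y = k then - 1 else 1) * sg E x y"
      using sg_switch[OF E _ _ xy(3)] by blast
  qed (use abcd in auto)
  then show "c4 (sg (switch k E)) a b c d = 1"
    using lt abcd unfolding locally_transitive_def by metis
qed

lemma mem_map_prod_transpose:
  "(a, b) \<in> map_prod (Transposition.transpose k m) (Transposition.transpose k m) ` E \<longleftrightarrow> (Transposition.transpose k m a, Transposition.transpose k m b) \<in> E"
proof
  show "(a, b) \<in> map_prod (Transposition.transpose k m) (Transposition.transpose k m) ` E \<Longrightarrow> (Transposition.transpose k m a, Transposition.transpose k m b) \<in> E"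
    by (auto simp: map_prod_def)
  assume "(Transposition.transpose k m a, Transposition.transpose k m b) \<in> E"
  then have "map_prod (Transposition.transpose k m) (Transposition.transpose k m) (Transposition.transpose k m a, Transposition.transpose k m b) \<in> map_prod (Transposition.transpose k m) (Transposition.transpose k m) ` E"
    by (rule imageI)
  then show "(a, b) \<in> map_prod (Transposition.transpose k m) (Transposition.transpose k m) ` E" by simp
qed

text \<open>Conjugation by a transposition moves the switched vertex to m; it suffices later to
  treat the last vertex.\<close>

lemma switch_transpose:
  "switch k E = map_prod (Transposition.transpose k m) (Transposition.transpose k m) ` switch m (map_prod (Transposition.transpose k m) (Transposition.transpose k m) ` E)"
proof -
  have t: "Transposition.transpose k m i = m \<longleftrightarrow> i = k" for i
    by (auto simp: Transposition.transpose_def)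
  have "(i, j) \<in> switch k E \<longleftrightarrow>
      (i, j) \<in> map_prod (Transposition.transpose k m) (Transposition.transpose k m) ` switch m (map_prod (Transposition.transpose k m) (Transposition.transpose k m) ` E)" for i j
    unfolding mem_map_prod_transpose mem_switch by (simp add: t)
  then show ?thesis by auto
qed

lemma map_prod_tours:
  assumes E: "E \<in> tours n" and \<sigma>: "bij_betw \<sigma> {..<n} {..<n}"
  shows "map_prod \<sigma> \<sigma> ` E \<in> tours n"
proof -
  have inj: "inj_on \<sigma> {..<n}" and im: "\<sigma> ` {..<n} = {..<n}" using \<sigma> by (auto simp: bij_betw_def)
  have mem: "(\<sigma> i, \<sigma> j) \<in> map_prod \<sigma> \<sigma> ` E \<longleftrightarrow> (i, j) \<in> E" if ij: "i < n" "j < n" for i j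
  proof
    assume "(\<sigma> i, \<sigma> j) \<in> map_prod \<sigma> \<sigma> ` E"
    then obtain a b where ab: "(a, b) \<in> E" "\<sigma> i = \<sigma> a" "\<sigma> j = \<sigma> b" by auto
    then have "a < n" "b < n" using toursD(1)[OF E] by auto
    then have "i = a" "j = b" using inj_onD[OF inj] ab ij by auto
    then show "(i, j) \<in> E" using ab by simp
  qed auto
  have ex: "\<exists>a<n. i = \<sigma> a" if "i < n" for i
  proof -
    have "i \<in> \<sigma> ` {..<n}" using im that by simp
    then show ?thesis by auto
  qed
  show ?thesis
  proof (rule toursI)
    show "map_prod \<sigma> \<sigma> ` E \<subseteq> {..<n} \<times> {..<n}"
    proof
      fix p assume "p \<in> map_prod \<sigma> \<sigma> ` E"
      then obtain a b where "(a, b) \<in> E" "p = (\<sigma> a, \<sigma> b)" by auto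
      then show "p \<in> {..<n} \<times> {..<n}" using toursD(1)[OF E] bij_betwE[OF \<sigma>] by auto
    qed
    show "(i, i) \<notin> map_prod \<sigma> \<sigma> ` E" if i: "i < n" for i
    proof -
      obtain a where "a < n" "i = \<sigma> a" using ex[OF i] by auto
      then show ?thesis using mem[of a a] toursD(2)[OF E] by simp
    qed
    show "((i, j) \<in> map_prod \<sigma> \<sigma> ` E) = ((j, i) \<notin> map_prod \<sigma> \<sigma> ` E)" if ij: "i < n" "j < n" "i \<noteq> j" for i j
    proof -
      obtain a b where "a < n" "i = \<sigma> a" "b < n" "j = \<sigma> b" using ex ij by meson
      then show ?thesis using mem[of a b] mem[of b a] toursD(3)[OF E, of a b] ij by auto
    qed
  qed
qed

text \<open>A transitive tournament is relabelled to the standard one by the number of in-neighbours.\<close>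

lemma transitive_relabel:
  assumes E: "E \<in> tours n"
    and trans: "\<And>i j k. (i, j) \<in> E \<Longrightarrow> (j, k) \<in> E \<Longrightarrow> (i, k) \<in> E"
  shows "\<exists>r. bij_betw r {..<n} {..<n} \<and> map_prod r r ` E = upairs n"
proof -
  define r where "r i = card {j. (j, i) \<in> E}" for i
  have fin: "finite {j. (j, i) \<in> E}" for i
    by (rule finite_subset[of _ "{..<n}"]) (use toursD(1)[OF E] in auto)
  have less: "r i < r j" if "(i, j) \<in> E" for i j
    unfolding r_def using that trans toursD(2)[OF E] by (intro psubset_card_mono fin) blast
  have rn: "r i < n" if "i < n" for i
  proof -
    have "{j. (j, i) \<in> E} \<subset> {..<n}" using toursD(1,2)[OF E] that by blast
    from psubset_card_mono[OF finite_lessThan this] show ?thesis by (simp add: r_def)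
  qed
  have inj: "inj_on r {..<n}"
  proof (rule inj_onI)
    fix i j assume ij: "i \<in> {..<n}" "j \<in> {..<n}" "r i = r j"
    show "i = j"
    proof (rule ccontr)
      assume "i \<noteq> j"
      then have "(i, j) \<in> E \<or> (j, i) \<in> E" using toursD(3)[OF E, of i j] ij by auto
      then show False using less[of i j] less[of j i] ij(3) by auto
    qed
  qed
  have bij: "bij_betw r {..<n} {..<n}"
    unfolding bij_betw_def using inj rn by (intro conjI endo_inj_surj) auto
  have "map_prod r r ` E = upairs n"
  proof
    show "map_prod r r ` E \<subseteq> upairs n"
    proof
      fix p assume "p \<in> map_prod r r ` E"
      then obtain i j where ij: "(i, j) \<in> E" "p = (r i, r j)" by auto
      then have "j < n" using toursD(1)[OF E] by auto
      then show "p \<in> upairs n" using less[OF ij(1)] rn[of j] ij(2) by (simp add: upairs_def)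
    qed
    show "upairs n \<subseteq> map_prod r r ` E"
    proof
      fix p assume "p \<in> upairs n"
      then obtain a b where p: "p = (a, b)" "a < b" "b < n" by (auto simp: upairs_def)
      have "a \<in> r ` {..<n}" "b \<in> r ` {..<n}" using bij p by (auto simp: bij_betw_def)
      then obtain i j where ij: "i < n" "j < n" "a = r i" "b = r j" by auto
      have "i \<noteq> j" using ij p by auto
      then have "(i, j) \<in> E \<or> (j, i) \<in> E" using toursD(3)[OF E, of i j] ij by auto
      then have "(i, j) \<in> E" using less[of j i] ij p by auto
      then show "p \<in> map_prod r r ` E" using p ij by (auto intro: rev_image_eqI)
    qed
  qed
  then show ?thesis using bij by blast
qed

text \<open>A failure of transitivity is a cyclic triangle, and it avoids the source 0. The source
  would dominate it, which gives \<open>c4\<close> the value -3.\<close>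

lemma source_transitive:
  assumes E: "E \<in> tours n" and lt: "locally_transitive n E"
    and source: "\<And>k. (k, 0) \<notin> E"
    and ij: "(i, j) \<in> E" and jk: "(j, k) \<in> E"
  shows "(i, k) \<in> E"
proof (rule ccontr)
  assume ik: "(i, k) \<notin> E"
  have n: "i < n" "j < n" "k < n" using toursD(1)[OF E] ij jk by auto
  have "i \<noteq> j" "j \<noteq> k" using toursD(2)[OF E] ij jk by auto
  moreover have ki: "i \<noteq> k" using toursD(3)[OF E, of i j] n \<open>i \<noteq> j\<close> ij jk by auto
  ultimately have d: "i \<noteq> j" "j \<noteq> k" "i \<noteq> k" by auto
  have kiE: "(k, i) \<in> E" using toursD(3)[OF E, of i k] n d ik by simp
  have nz: "i \<noteq> 0" "j \<noteq> 0" "k \<noteq> 0" using source ij jk kiE by metis+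
  have z: "(0, m) \<in> E" if "m < n" "m \<noteq> 0" for m
    using toursD(3)[OF E, of 0 m] that source by auto
  have "c4 (sg E) 0 i j k = 1"
    using lt n d nz unfolding locally_transitive_def by auto
  moreover have "sg E 0 i = 1" "sg E 0 j = 1" "sg E 0 k = 1" "sg E i j = 1" "sg E j k = 1" "sg E k i = 1"
    using z n nz ij jk kiE by (simp_all add: sg_def)
  moreover have "sg E i 0 = - 1" "sg E j 0 = - 1" "sg E k 0 = - 1" "sg E j i = - 1" "sg E k j = - 1" "sg E i k = - 1"
    using source toursD(3)[OF E, of i j] toursD(3)[OF E, of j k] n d ij jk ik by (simp_all add: sg_def)
  ultimately show False by (simp add: c4_eq)
qed

section \<open>Labelled densities and integration over single vertices\<close>

context prob_space begin

lemma bdd_arc_prod: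
  assumes "bdd_kernel M W" "E \<subseteq> I \<times> I"
  shows "bdd_fun (\<Pi>\<^sub>M i\<in>I. M) (\<lambda>x. \<Prod>(i, j)\<in>E. W (x i) (x j))"
  unfolding case_prod_beta
  by (intro bdd_fun_prod bdd_kernel_comp[OF assms(1)] measurable_component_singleton) (use assms(2) in auto)

lemma labelled_density_relabel:
  assumes W: "bdd_kernel M W" and E: "E \<in> tours n" and \<sigma>: "bij_betw \<sigma> {..<n} {..<n}"
  shows "labelled_density M W n (map_prod \<sigma> \<sigma> ` E) = labelled_density M W n E"
proof -
  let ?g = "\<lambda>x. \<Prod>(i, j)\<in>E. W (x i) (x j)"
  have inj: "inj_on \<sigma> {..<n}" and im: "\<sigma> ` {..<n} = {..<n}" using \<sigma> by (auto simp: bij_betw_def)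
  have "inj_on (map_prod \<sigma> \<sigma>) E"
    using map_prod_inj_on[OF inj inj] inj_on_subset toursD(1)[OF E] by blast
  then have *: "(\<Prod>(i, j)\<in>map_prod \<sigma> \<sigma> ` E. W (x i) (x j)) = ?g (\<lambda>j\<in>{..<n}. x (\<sigma> j))" for x
    using toursD(1)[OF E] by (subst prod.reindex) (auto intro!: prod.cong)
  show ?thesis
    unfolding labelled_density_def *
    by (rule integral_PiM_reindex[OF inj])
      (use im bdd_fun_measurable[OF bdd_arc_prod[OF W toursD(1)[OF E]]] in auto)
qed

lemma sum_labelled_density:
  assumes W: "bdd_kernel M W" and 1: "\<And>x y. W x y + W y x = 1"
  shows "(\<Sum>E\<in>tours n. labelled_density M W n E) = 1"
proof -
  interpret P: prob_space "\<Pi>\<^sub>M i\<in>{..<n}. M" by (rule prob_space_power)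
  have "(\<Sum>E\<in>tours n. labelled_density M W n E)
      = (\<integral>x. (\<Sum>E\<in>tours n. \<Prod>(i, j)\<in>E. W (x i) (x j)) \<partial>(\<Pi>\<^sub>M i\<in>{..<n}. M))"
    unfolding labelled_density_def
    by (intro Bochner_Integration.integral_sum[symmetric] P.bdd_fun_integrable bdd_arc_prod W) (auto dest: toursD(1))
  also have "\<dots> = 1"
    using sum_tours_prod[of "\<lambda>i j. W (x i) (x j)" n for x] by (simp add: 1 case_prod_beta P.prob_space)
  finally show ?thesis .
qed

lemma upd_measurable:
  "(\<lambda>(y, u). y(n := u)) \<in> (\<Pi>\<^sub>M i\<in>{..<n}. M) \<Otimes>\<^sub>M M \<rightarrow>\<^sub>M (\<Pi>\<^sub>M i\<in>{..<Suc n}. M)"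
  using measurable_add_dim[of n "{..<n}" "\<lambda>_. M"] by (simp add: lessThan_Suc)

lemma integral_PiM_last:
  assumes "bdd_fun (\<Pi>\<^sub>M i\<in>{..<Suc n}. M) B"
  shows "(\<integral>x. B x \<partial>(\<Pi>\<^sub>M i\<in>{..<Suc n}. M)) = (\<integral>y. (\<integral>u. B (y(n := u)) \<partial>M) \<partial>(\<Pi>\<^sub>M i\<in>{..<n}. M))"
proof -
  interpret P: product_sigma_finite "\<lambda>_::nat. M" ..
  interpret Q: prob_space "\<Pi>\<^sub>M i\<in>{..<Suc n}. M" by (rule prob_space_power)
  show ?thesis
    using P.product_integral_insert[of "{..<n}" n B] Q.bdd_fun_integrable[OF assms]
    by (simp add: lessThan_Suc)
qed

lemma bdd_fun_PiM_last:
  assumes B: "bdd_fun (\<Pi>\<^sub>M i\<in>{..<Suc n}. M) B"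
  shows "bdd_fun (\<Pi>\<^sub>M i\<in>{..<n}. M) (\<lambda>y. \<integral>u. B (y(n := u)) \<partial>M)"
    and "y \<in> space (\<Pi>\<^sub>M i\<in>{..<n}. M) \<Longrightarrow> bdd_fun M (\<lambda>u. B (y(n := u)))"
proof -
  obtain C where C: "\<And>x. \<bar>B x\<bar> \<le> C" using B by (auto simp: bdd_fun_def)
  have C0: "0 \<le> C" using order_trans[OF abs_ge_zero C] .
  have m: "(\<lambda>(y, u). B (y(n := u))) \<in> borel_measurable ((\<Pi>\<^sub>M i\<in>{..<n}. M) \<Otimes>\<^sub>M M)"
    using measurable_compose[OF upd_measurable bdd_fun_measurable[OF B]] by (simp add: case_prod_beta')
  have "\<bar>\<integral>u. B (y(n := u)) \<partial>M\<bar> \<le> C" for y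
  proof (cases "integrable M (\<lambda>u. B (y(n := u)))")
    case True
    have "\<bar>\<integral>u. B (y(n := u)) \<partial>M\<bar> \<le> (\<integral>u. \<bar>B (y(n := u))\<bar> \<partial>M)" by (rule integral_abs_bound)
    also have "\<dots> \<le> (\<integral>u. C \<partial>M)" using True C by (intro integral_mono) auto
    finally show ?thesis by (simp add: prob_space)
  qed (simp add: not_integrable_integral_eq C0)
  then show "bdd_fun (\<Pi>\<^sub>M i\<in>{..<n}. M) (\<lambda>y. \<integral>u. B (y(n := u)) \<partial>M)"
    using borel_measurable_lebesgue_integral[OF m] unfolding bdd_fun_def by blast
  assume y: "y \<in> space (\<Pi>\<^sub>M i\<in>{..<n}. M)"
  show "bdd_fun M (\<lambda>u. B (y(n := u)))"
    using measurable_compose[OF measurable_Pair1'[OF y, of M] m] C by (auto simp: bdd_fun_def)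
qed

text \<open>The exceptional set is presented as the set where a nonnegative bounded function is
  nonzero, so Fubini for integrals applies directly.\<close>

lemma AE_PiM_last:
  assumes B: "bdd_fun (\<Pi>\<^sub>M i\<in>{..<Suc n}. M) B" and nn: "\<And>x. 0 \<le> B x"
    and 0: "AE x in (\<Pi>\<^sub>M i\<in>{..<Suc n}. M). B x = 0"
  shows "AE y in (\<Pi>\<^sub>M i\<in>{..<n}. M). AE u in M. B (y(n := u)) = 0"
proof -
  interpret Q: prob_space "\<Pi>\<^sub>M i\<in>{..<n}. M" by (rule prob_space_power)
  have "(\<integral>y. (\<integral>u. B (y(n := u)) \<partial>M) \<partial>(\<Pi>\<^sub>M i\<in>{..<n}. M)) = 0"
    unfolding integral_PiM_last[OF B, symmetric] using 0 by (intro integral_eq_zero_AE)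
  then have "AE y in (\<Pi>\<^sub>M i\<in>{..<n}. M). (\<integral>u. B (y(n := u)) \<partial>M) = 0"
    using Q.bdd_fun_integrable[OF bdd_fun_PiM_last(1)[OF B]] nn
    by (subst (asm) integral_nonneg_eq_0_iff_AE) auto
  then show ?thesis
  proof (rule AE_mp[OF _ AE_I2], intro impI)
    fix y assume y: "y \<in> space (\<Pi>\<^sub>M i\<in>{..<n}. M)" and "(\<integral>u. B (y(n := u)) \<partial>M) = 0"
    then show "AE u in M. B (y(n := u)) = 0"
      using bdd_fun_integrable[OF bdd_fun_PiM_last(2)[OF B y]] nn
      by (subst (asm) integral_nonneg_eq_0_iff_AE) auto
  qed
qed

text \<open>Given the centre x 0, the leaves are independent. The factor H absorbs a leaf that has
  been integrated out, which makes the induction go through.\<close>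

lemma star_integral:
  assumes K: "bdd_kernel M K" and H: "bdd_fun M H"
  shows "(\<integral>x. (\<Prod>i<n. K (x 0) (x (Suc i))) * H (x 0) \<partial>(\<Pi>\<^sub>M i\<in>{..<Suc n}. M)) = (\<integral>x. (\<integral>y. K x y \<partial>M) ^ n * H x \<partial>M)"
  using H
proof (induction n arbitrary: H)
  case 0
  interpret P: product_sigma_finite "\<lambda>_::nat. M" ..
  have "(\<integral>x. H (x 0) \<partial>(\<Pi>\<^sub>M i\<in>{0::nat}. M)) = (\<integral>x. H x \<partial>M)"
    using bdd_fun_measurable[OF 0] by (intro P.product_integral_singleton) auto
  then show ?case by (simp add: lessThan_Suc)
next
  case (Suc n)
  let ?B = "\<lambda>x. \<integral>y. K x y \<partial>M"
  have b: "bdd_fun (\<Pi>\<^sub>M i\<in>{..<Suc (Suc n)}. M) (\<lambda>x. (\<Prod>i<Suc n. K (x 0) (x (Suc i))) * H (x 0))"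
    by (intro bdd_fun_mult bdd_fun_prod bdd_kernel_comp[OF K] bdd_fun_comp[OF Suc.prems]) auto
  have "(\<integral>x. (\<Prod>i<Suc n. K (x 0) (x (Suc i))) * H (x 0) \<partial>(\<Pi>\<^sub>M i\<in>{..<Suc (Suc n)}. M))
    = (\<integral>x. (\<integral>u. (\<Prod>i<Suc n. K ((x(Suc n := u)) 0) ((x(Suc n := u)) (Suc i))) * H ((x(Suc n := u)) 0) \<partial>M) \<partial>(\<Pi>\<^sub>M i\<in>{..<Suc n}. M))"
    by (rule integral_PiM_last[OF b])
  also have "\<dots> = (\<integral>x. (\<Prod>i<n. K (x 0) (x (Suc i))) * (?B (x 0) * H (x 0)) \<partial>(\<Pi>\<^sub>M i\<in>{..<Suc n}. M))"
  proof (rule Bochner_Integration.integral_cong[OF refl])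
    fix x :: "nat \<Rightarrow> 'a"
    have "(\<Prod>i<Suc n. K ((x(Suc n := u)) 0) ((x(Suc n := u)) (Suc i))) * H ((x(Suc n := u)) 0)
      = ((\<Prod>i<n. K (x 0) (x (Suc i))) * H (x 0)) * K (x 0) u" for u
      by simp
    then show "(\<integral>u. (\<Prod>i<Suc n. K ((x(Suc n := u)) 0) ((x(Suc n := u)) (Suc i))) * H ((x(Suc n := u)) 0) \<partial>M)
      = (\<Prod>i<n. K (x 0) (x (Suc i))) * (?B (x 0) * H (x 0))"
      by (simp only: integral_mult_right_zero) simp
  qed
  also have "\<dots> = (\<integral>x. ?B x ^ n * (?B x * H x) \<partial>M)"
    by (rule Suc.IH) (intro bdd_fun_mult bdd_fun_integral K Suc.prems)
  finally show ?case by (simp add: mult.assoc power_commutes[symmetric] mult.left_commute)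
qed

lemma pair_integral:
  assumes K: "bdd_kernel M K" and ab: "a \<in> I" "b \<in> I" "a \<noteq> b"
  shows "(\<integral>x. K (x a) (x b) \<partial>(\<Pi>\<^sub>M i\<in>I. M)) = (\<integral>x. (\<integral>y. K x y \<partial>M) \<partial>M)"
proof -
  let ?f = "\<lambda>i::nat. if i = 0 then a else b"
  have "(\<integral>x. K (x a) (x b) \<partial>(\<Pi>\<^sub>M i\<in>I. M)) = (\<integral>x. K ((\<lambda>j\<in>{..<Suc (Suc 0)}. x (?f j)) 0) ((\<lambda>j\<in>{..<Suc (Suc 0)}. x (?f j)) 1) \<partial>(\<Pi>\<^sub>M i\<in>I. M))"
    by simp
  also have "\<dots> = (\<integral>x. K (x 0) (x 1) \<partial>(\<Pi>\<^sub>M i\<in>{..<Suc (Suc 0)}. M))"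
    using ab by (intro integral_PiM_reindex) (auto simp: inj_on_def intro!: bdd_fun_measurable bdd_kernel_comp[OF K])
  also have "\<dots> = (\<integral>x. (\<integral>y. K x y \<partial>M) \<partial>M)"
    using star_integral[OF K bdd_fun_const[of M 1], of "Suc 0"] by simp
  finally show ?thesis .
qed

lemma single_integral:
  assumes f: "bdd_fun M f" and a: "a \<in> I"
  shows "(\<integral>x. f (x a) \<partial>(\<Pi>\<^sub>M i\<in>I. M)) = (\<integral>x. f x \<partial>M)"
proof -
  have "(\<integral>x. f (x a) \<partial>(\<Pi>\<^sub>M i\<in>I. M)) = (\<integral>x. f ((\<lambda>j\<in>{..<Suc 0}. x a) 0) \<partial>(\<Pi>\<^sub>M i\<in>I. M))"
    by simp
  also have "\<dots> = (\<integral>x. f (x 0) \<partial>(\<Pi>\<^sub>M i\<in>{..<Suc 0}. M))"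
    using a by (intro integral_PiM_reindex) (auto simp: inj_on_def intro!: bdd_fun_measurable bdd_fun_comp[OF f])
  also have "\<dots> = (\<integral>x. f x \<partial>M)"
    using star_integral[OF bdd_kernel_const[of M 1] f, of 0] by simp
  finally show ?thesis .
qed

end

section \<open>Labelled densities of extremal kernels\<close>

context bounded_skew_kernel begin

lemma S_skew: "S x y = - S y x"
  by (rule skewD[OF skew])

lemma c4_S_le: "c4 (\<lambda>i j. S (x i) (x j)) a b c d \<le> 1"
proof (rule c4_le_1)
  show "S (x i) (x j) = - S (x j) (x i)" for i j by (rule S_skew)
  show "\<bar>S (x i) (x j)\<bar> \<le> 1" for i j by (rule le_1)
qed

lemma c4_S_less:
  assumes "\<bar>S (x a) (x b)\<bar> < 1" "\<bar>S (x a) (x c)\<bar> < 1" "\<bar>S (x a) (x d)\<bar> < 1"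
  shows "c4 (\<lambda>i j. S (x i) (x j)) a b c d < 1"
proof (rule c4_less_1)
  show "S (x i) (x j) = - S (x j) (x i)" for i j by (rule S_skew)
  show "\<bar>S (x i) (x j)\<bar> \<le> 1" for i j by (rule le_1)
qed (use assms in auto)

lemma bdd_c4:
  assumes "a \<in> I" "b \<in> I" "c \<in> I" "d \<in> I"
  shows "bdd_fun (\<Pi>\<^sub>M i\<in>I. M) (\<lambda>x. c4 (\<lambda>i j. S (x i) (x j)) a b c d)"
  unfolding c4_def using assms by (intro bdd_fun_add bdd_fun_closed_walk bdd) auto

lemma integral_c4:
  assumes "distinct [a, b, c, d]" "{a, b, c, d} \<subseteq> I"
  shows "(\<integral>x. c4 (\<lambda>i j. S (x i) (x j)) a b c d \<partial>(\<Pi>\<^sub>M i\<in>I. M)) = 3 * cycle_integral M S 4"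
proof -
  interpret P: prob_space "\<Pi>\<^sub>M i\<in>I. M" by (rule prob_space_power)
  have w: "integrable (\<Pi>\<^sub>M i\<in>I. M) (\<lambda>x. closed_walk (\<lambda>i j. S (x i) (x j)) xs)"
      "(\<integral>x. closed_walk (\<lambda>i j. S (x i) (x j)) xs \<partial>(\<Pi>\<^sub>M i\<in>I. M)) = cycle_integral M S 4"
    if "distinct xs" "set xs \<subseteq> I" "length xs = 4" for xs
    using P.bdd_fun_integrable[OF bdd_fun_closed_walk[OF bdd that(2)]] integral_closed_walk[OF bdd that(1,2)] that(3)
    by simp_all
  have "distinct [a, b, c, d]" "set [a, b, c, d] \<subseteq> I" "length [a, b, c, d] = 4"
    "distinct [a, b, d, c]" "set [a, b, d, c] \<subseteq> I" "length [a, b, d, c] = 4"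
    "distinct [a, c, b, d]" "set [a, c, b, d] \<subseteq> I" "length [a, c, b, d] = 4"
    using assms by auto
  then show ?thesis
    unfolding c4_def by (simp add: w del: distinct.simps list.set)
qed

text \<open>By \<open>integral_c4\<close> the mean of \<open>c4\<close> is 3 * (1 / 3), equal to its
  pointwise upper bound.\<close>

lemma AE_c4:
  assumes S4: "cycle_integral M S 4 = 1 / 3"
    and d: "distinct [a, b, c, d]" "{a, b, c, d} \<subseteq> I"
  shows "AE x in (\<Pi>\<^sub>M i\<in>I. M). c4 (\<lambda>i j. S (x i) (x j)) a b c d = 1"
proof -
  interpret P: prob_space "\<Pi>\<^sub>M i\<in>I. M" by (rule prob_space_power)
  have b: "bdd_fun (\<Pi>\<^sub>M i\<in>I. M) (\<lambda>x. c4 (\<lambda>i j. S (x i) (x j)) a b c d)"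
    using d by (intro bdd_c4) auto
  have "(\<integral>x. c4 (\<lambda>i j. S (x i) (x j)) a b c d \<partial>(\<Pi>\<^sub>M i\<in>I. M)) = 1"
    using integral_c4[OF d] S4 by simp
  then show ?thesis using P.integral_max_iff(2)[OF b c4_S_le] by blast
qed

text \<open>If |S| < 1 on a set of positive measure, three independent points lie in it simultaneously.\<close>

lemma AE_sign:
  assumes S4: "cycle_integral M S 4 = 1 / 3" and ab: "a \<in> I" "b \<in> I" "a \<noteq> b"
  shows "AE x in (\<Pi>\<^sub>M i\<in>I. M). \<bar>S (x a) (x b)\<bar> = 1"
proof -
  \<comment> \<open>The indicator of the pairs on which S is not a sign.\<close>
  define K where "K x y = (if \<bar>S x y\<bar> < 1 then 1 else 0 :: real)" for x y
  have "bdd_fun (M \<Otimes>\<^sub>M M) (\<lambda>p. K (fst p) (snd p))"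
  proof -
    have [measurable]: "(\<lambda>p. S (fst p) (snd p)) \<in> borel_measurable (M \<Otimes>\<^sub>M M)"
      using bdd_fun_measurable[OF bdd[unfolded bdd_kernel_def case_prod_beta]] .
    have "(\<lambda>p. K (fst p) (snd p)) \<in> borel_measurable (M \<Otimes>\<^sub>M M)" unfolding K_def by measurable
    moreover have "\<bar>K (fst p) (snd p)\<bar> \<le> 1" for p by (simp add: K_def)
    ultimately show ?thesis unfolding bdd_fun_def by blast
  qed
  then have K: "bdd_kernel M K" unfolding bdd_kernel_def case_prod_beta .
  have "AE x in (\<Pi>\<^sub>M i\<in>{..<Suc 3}. M). c4 (\<lambda>i j. S (x i) (x j)) 0 1 2 3 = 1"
    by (rule AE_c4[OF S4]) auto
  then have "AE x in (\<Pi>\<^sub>M i\<in>{..<Suc 3}. M). (\<Prod>i<3. K (x 0) (x (Suc i))) * 1 = 0"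
  proof (rule AE_mp[OF _ AE_I2], intro impI)
    fix x :: "nat \<Rightarrow> 'a" assume c: "c4 (\<lambda>i j. S (x i) (x j)) 0 1 2 3 = 1"
    have "\<not> (\<bar>S (x 0) (x 1)\<bar> < 1 \<and> \<bar>S (x 0) (x 2)\<bar> < 1 \<and> \<bar>S (x 0) (x 3)\<bar> < 1)"
      using c4_S_less[of x 0 1 2 3] c by auto
    then show "(\<Prod>i<3. K (x 0) (x (Suc i))) * 1 = 0"
      by (auto simp: K_def numeral_3_eq_3 numeral_2_eq_2)
  qed
  \<comment> \<open>By \<open>c4_S_less\<close> no vertex has three such pairs almost surely. The
    left side is the mean of the cubed degree in the graph of these pairs, so almost every degree
    vanishes.\<close>
  then have "(\<integral>x. (\<integral>y. K x y \<partial>M) ^ 3 * 1 \<partial>M) = 0"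
    unfolding star_integral[OF K bdd_fun_const[of M 1], of 3, symmetric] by (rule integral_eq_zero_AE)
  moreover have int: "integrable M (\<lambda>x. (\<integral>y. K x y \<partial>M) ^ 3 * 1)"
    by (intro bdd_fun_integrable bdd_fun_mult bdd_fun_power bdd_fun_integral K bdd_fun_const)
  moreover have nn: "0 \<le> (\<integral>y. K x y \<partial>M)" for x
    by (intro Bochner_Integration.integral_nonneg) (simp add: K_def)
  ultimately have "AE x in M. (\<integral>y. K x y \<partial>M) ^ 3 * 1 = 0"
    by (subst (asm) integral_nonneg_eq_0_iff_AE) auto
  then have "(\<integral>x. (\<integral>y. K x y \<partial>M) \<partial>M) = 0"
    by (intro integral_eq_zero_AE) auto
  then have "(\<integral>x. K (x a) (x b) \<partial>(\<Pi>\<^sub>M i\<in>I. M)) = 0"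
    using pair_integral[OF K ab] by simp
  moreover interpret P: prob_space "\<Pi>\<^sub>M i\<in>I. M" by (rule prob_space_power)
  have "integrable (\<Pi>\<^sub>M i\<in>I. M) (\<lambda>x. K (x a) (x b))"
    using ab by (intro P.bdd_fun_integrable bdd_kernel_comp[OF K] measurable_component_singleton)
  ultimately have "AE x in (\<Pi>\<^sub>M i\<in>I. M). K (x a) (x b) = 0"
    by (subst (asm) integral_nonneg_eq_0_iff_AE) (auto simp: K_def)
  then show ?thesis
  proof (rule AE_mp[OF _ AE_I2], intro impI)
    fix x :: "'b \<Rightarrow> 'a" assume "K (x a) (x b) = 0"
    then show "\<bar>S (x a) (x b)\<bar> = 1" using le_1[of "x a" "x b"] by (auto simp: K_def split: if_splits)
  qed
qed

lemma AE_regular: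
  assumes "tt = 0" "a \<in> I"
  shows "AE x in (\<Pi>\<^sub>M i\<in>I. M). (\<integral>u. S (x a) u \<partial>M) = 0"
proof -
  have v: "vec 1 x = (\<integral>u. S x u \<partial>M)" for x by (simp add: vec_def kernel_op_def)
  interpret P: prob_space "\<Pi>\<^sub>M i\<in>I. M" by (rule prob_space_power)
  have "(\<integral>x. (vec 1 (x a))\<^sup>2 \<partial>(\<Pi>\<^sub>M i\<in>I. M)) = 0"
    using single_integral[OF bdd_fun_power[OF bdd_vec] assms(2)] assms(1) by (simp add: tt_def)
  moreover have "integrable (\<Pi>\<^sub>M i\<in>I. M) (\<lambda>x. (vec 1 (x a))\<^sup>2)"
    using assms(2) by (intro P.bdd_fun_integrable bdd_fun_power bdd_fun_comp[OF bdd_vec] measurable_component_singleton)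
  ultimately have "AE x in (\<Pi>\<^sub>M i\<in>I. M). (vec 1 (x a))\<^sup>2 = 0"
    by (subst (asm) integral_nonneg_eq_0_iff_AE) auto
  then show ?thesis
    unfolding v[symmetric] by eventually_elim simp
qed

text \<open>The arcs at the last vertex are separated from the rest. By skewness both orientations
  take the same form, with the sign \<open>sg E i n\<close> in front of S.\<close>

lemma arc_prod_Suc:
  assumes E: "E \<in> tours (Suc n)"
  shows "(\<Prod>(i, j)\<in>E. ww (x i) (x j))
    = (\<Prod>(i, j)\<in>E \<inter> {..<n} \<times> {..<n}. ww (x i) (x j)) * (\<Prod>i<n. (1 + sg E i n * S (x i) (x n)) / 2)"
proof -
  let ?f = "\<lambda>i. if (i, n) \<in> E then (i, n) else (n, i)"
  have inj: "inj_on ?f {..<n}" by (rule inj_onI) (auto split: if_splits)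
  have E_eq: "E = (E \<inter> {..<n} \<times> {..<n}) \<union> ?f ` {..<n}"
  proof
    show "E \<subseteq> (E \<inter> {..<n} \<times> {..<n}) \<union> ?f ` {..<n}"
    proof
      fix p assume p: "p \<in> E"
      obtain i j where ij: "p = (i, j)" by (cases p)
      have "i < Suc n" "j < Suc n" "i \<noteq> j" using toursD(1,2)[OF E] p ij by auto
      then consider "i < n" "j < n" | "i < n" "j = n" | "i = n" "j < n" by linarith
      then show "p \<in> (E \<inter> {..<n} \<times> {..<n}) \<union> ?f ` {..<n}"
      proof cases
        case 3
        then have "(j, n) \<notin> E" using toursD(3)[OF E, of j n] p ij by auto
        then have "p = ?f j" using 3 ij by simp
        then show ?thesis using 3 by blast
      next
        case 2
        then have "p = ?f i" using p ij by simp
        then show ?thesis using 2 by blast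
      qed (use p ij in auto)
    qed
    have "?f i \<in> E" if "i < n" for i using toursD(3)[OF E, of i n] that by auto
    then show "(E \<inter> {..<n} \<times> {..<n}) \<union> ?f ` {..<n} \<subseteq> E" by blast
  qed
  have disj: "(E \<inter> {..<n} \<times> {..<n}) \<inter> ?f ` {..<n} = {}" by (auto split: if_splits)
  have "(\<Prod>(i, j)\<in>E. ww (x i) (x j))
     = (\<Prod>(i, j)\<in>E \<inter> {..<n} \<times> {..<n}. ww (x i) (x j)) * (\<Prod>(i, j)\<in>?f ` {..<n}. ww (x i) (x j))"
    by (subst E_eq, subst prod.union_disjoint) (use disj finite_arcs[OF E] in auto)
  also have "(\<Prod>(i, j)\<in>?f ` {..<n}. ww (x i) (x j)) = (\<Prod>i<n. (1 + sg E i n * S (x i) (x n)) / 2)"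
    unfolding prod.reindex[OF inj]
  proof (rule prod.cong[OF refl])
    fix i
    show "((\<lambda>(i, j). ww (x i) (x j)) \<circ> ?f) i = (1 + sg E i n * S (x i) (x n)) / 2"
      using S_skew[of "x n" "x i"] by (simp add: ww_def sg_def)
  qed
  finally show ?thesis .
qed

text \<open>For given points y, the two integrals are the conditional probabilities that one more
  point u shows the pattern a towards them, or the opposite one. This is the only place where
  regularity and the condition on 4-cycles meet.\<close>

lemma pattern_integral:
  assumes ext: "extremal" and a: "\<And>i. a i = 1 \<or> a i = - 1"
  shows "AE y in (\<Pi>\<^sub>M i\<in>{..<n::nat}. M).
    (\<integral>u. (\<Prod>i<n. (1 + a i * S (y i) u) / 2) \<partial>M) = (\<integral>u. (\<Prod>i<n. (1 - a i * S (y i) u) / 2) \<partial>M)"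
proof -
  have S4: "cycle_integral M S 4 = 1 / 3" and tt: "tt = 0" using ext by (simp_all add: extremal_def)
  define T where "T = {(i, j, k). i < n \<and> j < n \<and> k < n \<and> distinct [i, j, k]}"
  have T: "finite T" by (rule finite_subset[of _ "{..<n} \<times> {..<n} \<times> {..<n}"]) (auto simp: T_def)
  \<comment> \<open>All conditions that involve the last point, collected in one nonnegative
    function so that \<open>AE_PiM_last\<close> can be applied once.\<close>
  define B where "B x = (\<Sum>i<n. 1 - (S (x i) (x n))\<^sup>2) + (\<Sum>(i, j, k)\<in>T. 1 - c4 (\<lambda>i j. S (x i) (x j)) i j k n)" for x
  have bddB: "bdd_fun (\<Pi>\<^sub>M i\<in>{..<Suc n}. M) B"
    unfolding B_def case_prod_beta
    by (intro bdd_fun_add bdd_fun_sum bdd_fun_diff bdd_fun_const bdd_fun_power bdd_kernel_comp[OF bdd] bdd_c4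
        measurable_component_singleton) (auto simp: T_def)
  have sq: "0 \<le> 1 - (S u v)\<^sup>2" for u v using le_1[of u v] by (simp add: abs_square_le_1)
  have c4: "0 \<le> 1 - c4 (\<lambda>i j. S (x i) (x j)) i j k l" for x :: "nat \<Rightarrow> 'a" and i j k l
    using c4_S_le[of x i j k l] by simp
  have nn: "0 \<le> B x" for x
    unfolding B_def case_prod_beta by (intro add_nonneg_nonneg sum_nonneg sq c4)
  have "AE x in (\<Pi>\<^sub>M i\<in>{..<Suc n}. M). \<forall>i\<in>{..<n}. \<bar>S (x i) (x n)\<bar> = 1"
    by (rule AE_finite_allI) (auto intro!: AE_sign[OF S4])
  moreover have "AE x in (\<Pi>\<^sub>M i\<in>{..<Suc n}. M). \<forall>t\<in>T. c4 (\<lambda>i j. S (x i) (x j)) (fst t) (fst (snd t)) (snd (snd t)) n = 1"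
    by (rule AE_finite_allI[OF T]) (auto intro!: AE_c4[OF S4] simp: T_def)
  ultimately have "AE x in (\<Pi>\<^sub>M i\<in>{..<Suc n}. M). B x = 0"
  proof eventually_elim
    fix x assume s: "\<forall>i\<in>{..<n}. \<bar>S (x i) (x n)\<bar> = 1"
      and t: "\<forall>t\<in>T. c4 (\<lambda>i j. S (x i) (x j)) (fst t) (fst (snd t)) (snd (snd t)) n = 1"
    have "(S (x i) (x n))\<^sup>2 = 1" if "i < n" for i using s that by (metis lessThan_iff one_power2 power2_abs)
    then show "B x = 0" unfolding B_def case_prod_beta using t by simp
  qed
  then have 1: "AE y in (\<Pi>\<^sub>M i\<in>{..<n}. M). AE u in M. B (y(n := u)) = 0"
    by (rule AE_PiM_last[OF bddB nn])
  have 2: "AE y in (\<Pi>\<^sub>M i\<in>{..<n}. M). \<forall>i\<in>{..<n}. (\<integral>u. S (y i) u \<partial>M) = 0"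
    by (rule AE_finite_allI) (auto intro!: AE_regular[OF tt])
  have 3: "AE y in (\<Pi>\<^sub>M i\<in>{..<n}. M). \<forall>p\<in>{..<n} \<times> {..<n}. fst p \<noteq> snd p \<longrightarrow> \<bar>S (y (fst p)) (y (snd p))\<bar> = 1"
  proof (rule AE_finite_allI)
    fix p :: "nat \<times> nat" assume p: "p \<in> {..<n} \<times> {..<n}"
    show "AE y in (\<Pi>\<^sub>M i\<in>{..<n}. M). fst p \<noteq> snd p \<longrightarrow> \<bar>S (y (fst p)) (y (snd p))\<bar> = 1"
    proof (cases "fst p = snd p")
      case False
      then have "AE y in (\<Pi>\<^sub>M i\<in>{..<n}. M). \<bar>S (y (fst p)) (y (snd p))\<bar> = 1"
        using p by (intro AE_sign[OF S4]) auto
      then show ?thesis by eventually_elim simp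
    qed simp
  qed simp
  show ?thesis
    using 1 2 3 AE_space
  proof eventually_elim
    fix y assume AEB: "AE u in M. B (y(n := u)) = 0"
      and reg: "\<forall>i\<in>{..<n}. (\<integral>u. S (y i) u \<partial>M) = 0"
      and sgn: "\<forall>p\<in>{..<n} \<times> {..<n}. fst p \<noteq> snd p \<longrightarrow> \<bar>S (y (fst p)) (y (snd p))\<bar> = 1"
      and y: "y \<in> space (\<Pi>\<^sub>M i\<in>{..<n}. M)"
    let ?P = "\<lambda>u. \<Prod>i<n. (1 + a i * S (y i) u) / 2" and ?Q = "\<lambda>u. \<Prod>i<n. (1 - a i * S (y i) u) / 2"
    have yi: "y i \<in> space M" if "i < n" for i using y that by (auto simp: space_PiM PiE_iff)
    have bS: "bdd_fun M (S (y i))" if "i < n" for i by (rule bdd_kernel_section[OF bdd yi[OF that]])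
    have "bdd_fun M (\<lambda>u. \<Prod>i<n. (1 + a i * S (y i) u) * (1 / 2))" "bdd_fun M (\<lambda>u. \<Prod>i<n. (1 - a i * S (y i) u) * (1 / 2))"
      using bS by (intro bdd_fun_prod bdd_fun_mult bdd_fun_add bdd_fun_diff bdd_fun_const; auto)+
    then have int: "integrable M ?P" "integrable M ?Q" by (auto dest: bdd_fun_integrable)
    define s where "s u i j = S ((y(n := u)) i) ((y(n := u)) j)" for u i j
    have s: "s u i j = - s u j i" for u i j unfolding s_def by (rule S_skew)
    have s1: "s u i j = S (y i) (y j)" if "i < n" "j < n" for u i j using that by (simp add: s_def)
    have sn: "s u i n = S (y i) u" if "i < n" for u i using that by (simp add: s_def)
    have PQ: "(\<Prod>i<n. (1 + a i * s u i n) / 2) = ?P u" "(\<Prod>i<n. (1 - a i * s u i n) / 2) = ?Q u" for u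
      by (intro prod.cong refl; simp add: sn)+
    have good: "AE u in M. (\<forall>i<n. s u i n = 1 \<or> s u i n = - 1) \<and>
        (\<forall>i j k. i < n \<longrightarrow> j < n \<longrightarrow> k < n \<longrightarrow> distinct [i, j, k] \<longrightarrow> c4 (s u) i j k n = 1)"
      using AEB
    proof eventually_elim
      fix u assume B0: "B (y(n := u)) = 0"
      let ?x = "y(n := u)"
      have p1: "0 \<le> (\<Sum>i<n. 1 - (S (?x i) (?x n))\<^sup>2)" by (intro sum_nonneg sq)
      have p2: "0 \<le> (\<Sum>(i, j, k)\<in>T. 1 - c4 (\<lambda>i j. S (?x i) (?x j)) i j k n)"
        unfolding case_prod_beta by (intro sum_nonneg c4)
      have z1: "(\<Sum>i<n. 1 - (S (?x i) (?x n))\<^sup>2) = 0" and z2: "(\<Sum>(i, j, k)\<in>T. 1 - c4 (\<lambda>i j. S (?x i) (?x j)) i j k n) = 0"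
        using B0 p1 p2 unfolding B_def by linarith+
      have "\<forall>i\<in>{..<n}. 1 - (S (?x i) (?x n))\<^sup>2 = 0"
        using z1 sum_nonneg_eq_0_iff[of "{..<n}" "\<lambda>i. 1 - (S (?x i) (?x n))\<^sup>2"] sq by blast
      then have "s u i n = 1 \<or> s u i n = - 1" if "i < n" for i
      proof -
        have "(s u i n)\<^sup>2 = 1" using \<open>\<forall>i\<in>{..<n}. 1 - (S (?x i) (?x n))\<^sup>2 = 0\<close> that unfolding s_def by simp
        then show ?thesis by (simp add: power2_eq_1_iff)
      qed
      moreover have "\<forall>t\<in>T. (case t of (i, j, k) \<Rightarrow> 1 - c4 (\<lambda>i j. S (?x i) (?x j)) i j k n) = 0"
        using z2 sum_nonneg_eq_0_iff[OF T, of "\<lambda>(i, j, k). 1 - c4 (\<lambda>i j. S (?x i) (?x j)) i j k n"] c4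
        unfolding case_prod_beta by blast
      then have "c4 (s u) i j k n = 1" if "i < n" "j < n" "k < n" "distinct [i, j, k]" for i j k
      proof -
        have "(i, j, k) \<in> T" using that by (simp add: T_def)
        from bspec[OF \<open>\<forall>t\<in>T. (case t of (i, j, k) \<Rightarrow> 1 - c4 (\<lambda>i j. S (?x i) (?x j)) i j k n) = 0\<close> this]
        have "1 - c4 (\<lambda>i j. S (?x i) (?x j)) i j k n = 0" by (simp only: prod.case)
        then show ?thesis unfolding s_def by simp
      qed
      ultimately show "(\<forall>i<n. s u i n = 1 \<or> s u i n = - 1) \<and>
        (\<forall>i j k. i < n \<longrightarrow> j < n \<longrightarrow> k < n \<longrightarrow> distinct [i, j, k] \<longrightarrow> c4 (s u) i j k n = 1)" by blast
    qed
    \<comment> \<open>The tournament on the points y, switched by a. Either it contains a cyclic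
      triangle and both integrands vanish, or it has a source f and a sink l.\<close>
    define R where "R i j \<longleftrightarrow> a i * a j * S (y i) (y j) = 1" for i j
    have tot: "R i j \<or> R j i" if "i < n" "j < n" "i \<noteq> j" for i j
    proof -
      have "\<bar>S (y i) (y j)\<bar> = 1" using sgn that by force
      then show ?thesis using a[of i] a[of j] S_skew[of "y j" "y i"] unfolding R_def by auto
    qed
    have main: "(\<integral>u. ?P u - ?Q u \<partial>M) = 0"
    proof (cases "\<exists>i j k. i < n \<and> j < n \<and> k < n \<and> distinct [i, j, k] \<and> R i j \<and> R j k \<and> R k i")
      case True
      then obtain i j k where ijk: "i < n" "j < n" "k < n" "distinct [i, j, k]" and c: "R i j" "R j k" "R k i" by blast
      have "AE u in M. ?P u - ?Q u = 0"
        using good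
      proof eventually_elim
        fix u assume g: "(\<forall>i<n. s u i n = 1 \<or> s u i n = - 1) \<and>
          (\<forall>i j k. i < n \<longrightarrow> j < n \<longrightarrow> k < n \<longrightarrow> distinct [i, j, k] \<longrightarrow> c4 (s u) i j k n = 1)"
        have "(\<Prod>i<n. (1 + a i * s u i n) / 2) = 0" "(\<Prod>i<n. (1 - a i * s u i n) / 2) = 0"
          by (rule pattern_zero[OF s a ijk]; use g c ijk in \<open>auto simp: R_def s1\<close>)+
        then show "?P u - ?Q u = 0" unfolding PQ by (simp only: diff_self)
      qed
      then show ?thesis by (rule integral_eq_zero_AE)
    next
      case False
      show ?thesis
      proof (cases "n = 0")
        case False
        then have ne: "{..<n} \<noteq> {}" by auto
        have acyc: "\<not> R k i" if "i < n" "j < n" "k < n" "distinct [i, j, k]" "R i j" "R j k" for i j k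
          using that \<open>\<not> (\<exists>i j k. _ i j k)\<close> by blast
        have "\<exists>f\<in>{..<n}. \<forall>j\<in>{..<n} - {f}. R f j"
        proof (rule ex_source)
          show "R i j \<or> R j i" if "i \<in> {..<n}" "j \<in> {..<n}" "i \<noteq> j" for i j
            by (rule tot) (use that in simp_all)
          show "\<not> R k i" if "i \<in> {..<n}" "j \<in> {..<n}" "k \<in> {..<n}" "distinct [i, j, k]" "R i j" "R j k" for i j k
            by (rule acyc[of i j k]) (use that in simp_all)
        qed (use ne in simp_all)
        then obtain f where f: "f < n" "\<And>j. j < n \<Longrightarrow> j \<noteq> f \<Longrightarrow> R f j" by auto
        have acyc': "\<not> R i k" if "i < n" "j < n" "k < n" "distinct [i, j, k]" "R j i" "R k j" for i j k
          using that acyc[of k j i] by auto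
        have "\<exists>l\<in>{..<n}. \<forall>j\<in>{..<n} - {l}. R j l"
        proof (rule ex_source[where R = "\<lambda>i j. R j i"])
          show "R j i \<or> R i j" if "i \<in> {..<n}" "j \<in> {..<n}" "i \<noteq> j" for i j
            by (rule tot) (use that in simp_all)
          show "\<not> R i k" if "i \<in> {..<n}" "j \<in> {..<n}" "k \<in> {..<n}" "distinct [i, j, k]" "R j i" "R k j" for i j k
            by (rule acyc'[of i j k]) (use that in simp_all)
        qed (use ne in simp_all)
        then obtain l where l: "l < n" "\<And>j. j < n \<Longrightarrow> j \<noteq> l \<Longrightarrow> R j l" by auto
        \<comment> \<open>The difference is linear in two sections of S, whose means are 0 by
          regularity.\<close>
        have "AE u in M. ?P u - ?Q u = (a f / 2) * S (y f) u + (a l / 2) * S (y l) u"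
          using good
        proof eventually_elim
          fix u assume g: "(\<forall>i<n. s u i n = 1 \<or> s u i n = - 1) \<and>
            (\<forall>i j k. i < n \<longrightarrow> j < n \<longrightarrow> k < n \<longrightarrow> distinct [i, j, k] \<longrightarrow> c4 (s u) i j k n = 1)"
          have "(\<Prod>i<n. (1 + a i * s u i n) / 2) - (\<Prod>i<n. (1 - a i * s u i n) / 2) = (a f * s u f n + a l * s u l n) / 2"
            by (rule pattern_difference[OF s a f(1) l(1)]) (use g f l in \<open>auto simp: R_def s1\<close>)
          then show "?P u - ?Q u = (a f / 2) * S (y f) u + (a l / 2) * S (y l) u"
            unfolding PQ using f(1) l(1) by (simp only: sn add_divide_distrib times_divide_eq_left)
        qed
        then have "(\<integral>u. ?P u - ?Q u \<partial>M) = (\<integral>u. (a f / 2) * S (y f) u + (a l / 2) * S (y l) u \<partial>M)"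
          by (rule integral_cong_AE[rotated 2])
            (intro borel_measurable_diff borel_measurable_integrable int bdd_fun_measurable bdd_fun_add
              bdd_fun_mult bdd_fun_const bS f(1) l(1))+
        also have "\<dots> = (a f / 2) * (\<integral>u. S (y f) u \<partial>M) + (a l / 2) * (\<integral>u. S (y l) u \<partial>M)"
          using bS[OF f(1), THEN bdd_fun_integrable] bS[OF l(1), THEN bdd_fun_integrable] by simp
        also have "\<dots> = 0" using reg f(1) l(1) by simp
        finally show ?thesis .
      qed simp
    qed
    then show "(\<integral>u. ?P u \<partial>M) = (\<integral>u. ?Q u \<partial>M)"
      using int by simp
  qed
qed

text \<open>The arcs among the first n points are unchanged and leave the inner integral as a
  factor. Switching replaces the pattern of the last point by its opposite, which is equally
  likely.\<close>

lemma labelled_density_switch_last: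
  assumes ext: "extremal" and E: "E \<in> tours (Suc n)"
  shows "labelled_density M ww (Suc n) (switch n E) = labelled_density M ww (Suc n) E"
proof -
  have E': "switch n E \<in> tours (Suc n)" by (rule switch_tours[OF E]) simp
  define R where "R y = (\<Prod>(i, j)\<in>E \<inter> {..<n} \<times> {..<n}. ww (y i) (y j))" for y
  have inner: "switch n E \<inter> {..<n} \<times> {..<n} = E \<inter> {..<n} \<times> {..<n}"
    by (auto simp: switch_def)
  have R_upd: "R (y(n := u)) = R y" for y u
    unfolding R_def by (intro prod.cong) auto
  have dens: "labelled_density M ww (Suc n) F = (\<integral>y. R y * (\<integral>u. (\<Prod>i<n. (1 + sg F i n * S (y i) u) / 2) \<partial>M) \<partial>(\<Pi>\<^sub>M i\<in>{..<n}. M))"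
    if F: "F \<in> tours (Suc n)" "F \<inter> {..<n} \<times> {..<n} = E \<inter> {..<n} \<times> {..<n}" for F
  proof -
    have "labelled_density M ww (Suc n) F
      = (\<integral>y. (\<integral>u. (\<Prod>(i, j)\<in>F. ww ((y(n := u)) i) ((y(n := u)) j)) \<partial>M) \<partial>(\<Pi>\<^sub>M i\<in>{..<n}. M))"
      unfolding labelled_density_def by (rule integral_PiM_last[OF bdd_arc_prod[OF bdd_ww toursD(1)[OF F(1)]]])
    also have "(\<lambda>y. \<integral>u. (\<Prod>(i, j)\<in>F. ww ((y(n := u)) i) ((y(n := u)) j)) \<partial>M)
      = (\<lambda>y. R y * (\<integral>u. (\<Prod>i<n. (1 + sg F i n * S (y i) u) / 2) \<partial>M))"
    proof
      fix y
      have "(\<Prod>(i, j)\<in>F. ww ((y(n := u)) i) ((y(n := u)) j)) = R y * (\<Prod>i<n. (1 + sg F i n * S (y i) u) / 2)" for u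
        unfolding arc_prod_Suc[OF F(1)] F(2) R_def[symmetric] R_upd by simp
      then show "(\<integral>u. (\<Prod>(i, j)\<in>F. ww ((y(n := u)) i) ((y(n := u)) j)) \<partial>M)
          = R y * (\<integral>u. (\<Prod>i<n. (1 + sg F i n * S (y i) u) / 2) \<partial>M)"
        by (simp only: integral_mult_right_zero)
    qed
    finally show ?thesis .
  qed
  have sg: "sg (switch n E) i n = - sg E i n" if "i < n" for i
    using sg_switch[OF E, of i n n] that by simp
  have neg: "(\<Prod>i<n. (1 + sg (switch n E) i n * S (y i) u) / 2) = (\<Prod>i<n. (1 - sg E i n * S (y i) u) / 2)" for y u
    by (intro prod.cong refl) (simp add: sg)
  have bf: "bdd_fun (\<Pi>\<^sub>M i\<in>{..<n}. M) (\<lambda>y. R y * (\<integral>u. (\<Prod>i<n. (1 + c i * S (y i) u) / 2) \<partial>M))" for c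
  proof (intro bdd_fun_mult)
    show "bdd_fun (\<Pi>\<^sub>M i\<in>{..<n}. M) R"
      unfolding R_def[abs_def] by (intro bdd_arc_prod bdd_ww) auto
    have "bdd_fun (\<Pi>\<^sub>M i\<in>{..<Suc n}. M) (\<lambda>x. \<Prod>i<n. (1 + c i * S (x i) (x n)) * (1 / 2))"
      by (intro bdd_fun_prod bdd_fun_mult bdd_fun_add bdd_fun_const bdd_kernel_comp[OF bdd] measurable_component_singleton) auto
    from bdd_fun_PiM_last(1)[OF this]
    show "bdd_fun (\<Pi>\<^sub>M i\<in>{..<n}. M) (\<lambda>y. \<integral>u. (\<Prod>i<n. (1 + c i * S (y i) u) / 2) \<partial>M)"
      by simp
  qed
  have ae: "AE y in (\<Pi>\<^sub>M i\<in>{..<n}. M).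
    (\<integral>u. (\<Prod>i<n. (1 + sg E i n * S (y i) u) / 2) \<partial>M) = (\<integral>u. (\<Prod>i<n. (1 - sg E i n * S (y i) u) / 2) \<partial>M)"
    by (rule pattern_integral[OF ext]) (simp add: sg_def)
  have eq: "(\<integral>y. R y * (\<integral>u. (\<Prod>i<n. (1 + sg (switch n E) i n * S (y i) u) / 2) \<partial>M) \<partial>(\<Pi>\<^sub>M i\<in>{..<n}. M))
    = (\<integral>y. R y * (\<integral>u. (\<Prod>i<n. (1 + sg E i n * S (y i) u) / 2) \<partial>M) \<partial>(\<Pi>\<^sub>M i\<in>{..<n}. M))"
  proof (intro integral_cong_AE bdd_fun_measurable[OF bf])
    show "AE y in (\<Pi>\<^sub>M i\<in>{..<n}. M).
      R y * (\<integral>u. (\<Prod>i<n. (1 + sg (switch n E) i n * S (y i) u) / 2) \<partial>M)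
      = R y * (\<integral>u. (\<Prod>i<n. (1 + sg E i n * S (y i) u) / 2) \<partial>M)"
      using ae unfolding neg by eventually_elim simp
  qed
  then show ?thesis unfolding dens[OF E' inner] dens[OF E refl] .
qed

lemma labelled_density_switch:
  assumes ext: "extremal" and E: "E \<in> tours n" and k: "k < n"
  shows "labelled_density M ww n (switch k E) = labelled_density M ww n E"
proof -
  obtain m where n: "n = Suc m" using k by (cases n) auto
  let ?t = "map_prod (Transposition.transpose k m) (Transposition.transpose k m)"
  have bij: "bij_betw (Transposition.transpose k m) {..<n} {..<n}"
    by (rule bij_betw_transpose_iff) (use k n in simp)
  have 1: "?t ` E \<in> tours n" by (rule map_prod_tours[OF E bij])
  have 2: "switch m (?t ` E) \<in> tours n" by (rule switch_tours[OF 1]) (simp add: n)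
  have "labelled_density M ww n (switch k E) = labelled_density M ww n (?t ` switch m (?t ` E))"
    by (simp only: switch_transpose[of k E m])
  also have "\<dots> = labelled_density M ww n (switch m (?t ` E))"
    by (rule labelled_density_relabel[OF bdd_ww 2 bij])
  also have "\<dots> = labelled_density M ww n (?t ` E)"
    using labelled_density_switch_last[OF ext 1[unfolded n]] by (simp add: n)
  also have "\<dots> = labelled_density M ww n E"
    by (rule labelled_density_relabel[OF bdd_ww E bij])
  finally show ?thesis .
qed

text \<open>Almost surely S is a sign on each arc. A nonzero product would make these signs equal to
  \<open>sg E\<close>, so the offending \<open>c4\<close> would equal 1.\<close>

lemma labelled_density_zero:
  assumes ext: "extremal" and E: "E \<in> tours n" and nlt: "\<not> locally_transitive n E"
  shows "labelled_density M ww n E = 0"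
proof -
  have S4: "cycle_integral M S 4 = 1 / 3" using ext by (simp add: extremal_def)
  obtain a b c d where abcd: "a < n" "b < n" "c < n" "d < n" "distinct [a, b, c, d]" "c4 (sg E) a b c d \<noteq> 1"
    using nlt unfolding locally_transitive_def by blast
  have "AE x in (\<Pi>\<^sub>M i\<in>{..<n}. M). c4 (\<lambda>i j. S (x i) (x j)) a b c d = 1"
    using abcd by (intro AE_c4[OF S4]) auto
  moreover have "AE x in (\<Pi>\<^sub>M i\<in>{..<n}. M). \<forall>p\<in>E. \<bar>S (x (fst p)) (x (snd p))\<bar> = 1"
  proof (rule AE_finite_allI[OF finite_arcs[OF E]])
    fix p assume p: "p \<in> E"
    obtain i j where ij: "p = (i, j)" by (cases p)
    have "fst p < n" "snd p < n" "fst p \<noteq> snd p"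
      using toursD(1,2)[OF E] p ij by auto
    then show "AE x in (\<Pi>\<^sub>M i\<in>{..<n}. M). \<bar>S (x (fst p)) (x (snd p))\<bar> = 1"
      by (intro AE_sign[OF S4]) auto
  qed
  ultimately have "AE x in (\<Pi>\<^sub>M i\<in>{..<n}. M). (\<Prod>(i, j)\<in>E. ww (x i) (x j)) = 0"
  proof eventually_elim
    fix x assume c: "c4 (\<lambda>i j. S (x i) (x j)) a b c d = 1" and s: "\<forall>p\<in>E. \<bar>S (x (fst p)) (x (snd p))\<bar> = 1"
    show "(\<Prod>(i, j)\<in>E. ww (x i) (x j)) = 0"
    proof (rule ccontr)
      assume nz: "(\<Prod>(i, j)\<in>E. ww (x i) (x j)) \<noteq> 0"
      have one: "S (x i) (x j) = 1" if "(i, j) \<in> E" for i j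
      proof -
        have "ww (x i) (x j) \<noteq> 0" using nz finite_arcs[OF E] that by (auto simp: prod_zero_iff)
        moreover have "\<bar>S (x i) (x j)\<bar> = 1" using s that by force
        ultimately show ?thesis by (auto simp: ww_def)
      qed
      have "c4 (sg E) a b c d = c4 (\<lambda>i j. S (x i) (x j)) a b c d"
      proof (rule c4_sign_transfer[where f = "\<lambda>i. i"])
        fix i j assume "i \<in> {a, b, c, d}" "j \<in> {a, b, c, d}" "i \<noteq> j"
        then have "i < n" "j < n" "i \<noteq> j" using abcd by auto
        then show "sg E i j = S (x i) (x j)"
          using toursD(3)[OF E, of i j] one[of i j] one[of j i] S_skew[of "x i" "x j"] by (auto simp: sg_def)
      qed (use abcd in simp)
      then show False using c abcd by simp
    qed
  qed
  then show ?thesis unfolding labelled_density_def by (rule integral_eq_zero_AE)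
qed

text \<open>Switching an in-neighbour of 0 removes it from the in-neighbours of 0 and adds none.
  Once 0 is a source, the tournament is transitive and relabels to the standard one.\<close>

lemma labelled_density_const:
  assumes ext: "extremal" and E: "E \<in> tours n" and lt: "locally_transitive n E"
  shows "labelled_density M ww n E = labelled_density M ww n (upairs n)"
  using E lt
proof (induction "card {k. (k, 0) \<in> E}" arbitrary: E rule: less_induct)
  case less
  show ?case
  proof (cases "\<exists>k. (k, 0) \<in> E")
    case True
    then obtain k where k: "(k, 0) \<in> E" by blast
    have kn: "k < n" "0 < n" using toursD(1)[OF less.prems(1)] k by auto
    have k0: "k \<noteq> 0" using toursD(2)[OF less.prems(1), of 0] k by (cases "k = 0") auto
    have "{j. (j, 0) \<in> switch k E} \<subset> {j. (j, 0) \<in> E}"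
      using k kn k0 toursD(3)[OF less.prems(1), of k 0] by (auto simp: switch_def)
    moreover have "finite {j. (j, 0) \<in> E}"
      by (rule finite_subset[of _ "{..<n}"]) (use toursD(1)[OF less.prems(1)] in auto)
    ultimately have "card {j. (j, 0) \<in> switch k E} < card {j. (j, 0) \<in> E}" by (intro psubset_card_mono)
    from less.hyps[OF this switch_tours[OF less.prems(1) kn(1)] locally_transitive_switch[OF less.prems]]
    show ?thesis using labelled_density_switch[OF ext less.prems(1) kn(1)] by simp
  next
    case False
    have trans: "(i, k) \<in> E" if "(i, j) \<in> E" "(j, k) \<in> E" for i j k
      using source_transitive[OF less.prems] False that by blast
    have "\<exists>r. bij_betw r {..<n} {..<n} \<and> map_prod r r ` E = upairs n"
      by (rule transitive_relabel[OF less.prems(1)]) (rule trans)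
    then obtain r where r: "bij_betw r {..<n} {..<n}" "map_prod r r ` E = upairs n" by blast
    then show ?thesis using labelled_density_relabel[OF bdd_ww less.prems(1) r(1)] by simp
  qed
qed

text \<open>The densities of all labelled tournaments sum to 1, so the common value on the locally
  transitive ones is the inverse of their number. The right side does not mention S; this is the
  uniqueness.\<close>

theorem labelled_density_extremal:
  assumes ext: "extremal" and E: "E \<in> tours n"
  shows "labelled_density M ww n E
    = (if locally_transitive n E then 1 / real (card {E \<in> tours n. locally_transitive n E}) else 0)"
proof (cases "locally_transitive n E")
  case True
  have "1 = (\<Sum>E\<in>tours n. labelled_density M ww n E)"
    by (rule sum_labelled_density[OF bdd_ww ww_sum, symmetric])
  also have "\<dots> = (\<Sum>E\<in>{E \<in> tours n. locally_transitive n E}. labelled_density M ww n E)"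
    by (intro sum.mono_neutral_right) (auto intro: labelled_density_zero[OF ext])
  also have "\<dots> = real (card {E \<in> tours n. locally_transitive n E}) * labelled_density M ww n (upairs n)"
    using labelled_density_const[OF ext] by simp
  finally have "labelled_density M ww n (upairs n) = 1 / real (card {E \<in> tours n. locally_transitive n E})"
    by (metis mult_zero_left nonzero_eq_divide_eq mult.commute zero_neq_one)
  then show ?thesis using True labelled_density_const[OF ext E True] by simp
next
  case False
  then show ?thesis using labelled_density_zero[OF ext E] by simp
qed

end

section \<open>Counting cycles in finite tournaments\<close>

definition labelled :: "nat \<Rightarrow> (nat \<times> nat) set \<Rightarrow> nat pair_pre_digraph" where
  "labelled n E = \<lparr>pverts = {..<n}, parcs = E\<rparr>"

lemma labelled_simps [simp]: "pverts (labelled n E) = {..<n}" "parcs (labelled n E) = E"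
  by (simp_all add: labelled_def)

lemma tournament_labelled: "E \<in> tours n \<Longrightarrow> tournament (labelled n E)"
proof
  assume E: "E \<in> tours n"
  show "fst e \<in> pverts (labelled n E)" "snd e \<in> pverts (labelled n E)" if "e \<in> parcs (labelled n E)" for e
    using toursD(1)[OF E] that by auto
  show "finite (pverts (labelled n E))" "finite (parcs (labelled n E))"
    using finite_arcs[OF E] by simp_all
  show "fst e \<noteq> snd e" if "e \<in> parcs (labelled n E)" for e
    using toursD(2)[OF E] that by (cases e) auto
  show "((u, v) \<in> parcs (labelled n E)) = ((v, u) \<notin> parcs (labelled n E))"
    if "u \<in> pverts (labelled n E)" "v \<in> pverts (labelled n E)" "u \<noteq> v" for u v
    using toursD(3)[OF E, of u v] that by simp
qed

lemma tournament_iff_labelled: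
  "tournament T \<and> pverts T = {..<n} \<longleftrightarrow> (\<exists>E\<in>tours n. T = labelled n E)"
proof
  assume T: "tournament T \<and> pverts T = {..<n}"
  then interpret tournament T by simp
  have "parcs T \<in> tours n"
  proof (rule toursI)
    show "parcs T \<subseteq> {..<n} \<times> {..<n}" using T arc_fst_in_verts arc_snd_in_verts by fastforce
    show "(i, i) \<notin> parcs T" for i using pair_no_loops by fastforce
    show "((i, j) \<in> parcs T) = ((j, i) \<notin> parcs T)" if "i < n" "j < n" "i \<noteq> j" for i j
      using tournament_arcs[of i j] T that by auto
  qed
  moreover have "T = labelled n (parcs T)" using T by (simp add: labelled_def)
  ultimately show "\<exists>E\<in>tours n. T = labelled n E" by blast
qed (use tournament_labelled in auto)

section \<open>Cycles as rotation classes of vertex lists\<close>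

definition arc_set :: "'a list \<Rightarrow> ('a \<times> 'a) set" where
  "arc_set xs = set (zip xs (rotate1 xs))"

lemma arc_set_index: "arc_set xs = (\<lambda>i. (xs ! i, xs ! (Suc i mod length xs))) ` {..<length xs}"
proof -
  have "arc_set xs = (\<lambda>i. (xs ! i, rotate1 xs ! i)) ` {..<length xs}"
    by (auto simp: arc_set_def set_zip)
  also have "\<dots> = (\<lambda>i. (xs ! i, xs ! (Suc i mod length xs))) ` {..<length xs}"
    by (intro image_cong refl) (simp add: nth_rotate1)
  finally show ?thesis .
qed

lemma arc_set_rotate1: "arc_set (rotate1 xs) = arc_set xs"
proof (cases xs)
  case (Cons a as)
  show ?thesis
  proof (cases as)
    case (Cons b bs)
    have "zip ((b # bs) @ [a]) ((bs @ [a]) @ [b]) = zip (b # bs) (bs @ [a]) @ zip [a] [b]"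
      by (rule zip_append) simp
    then show ?thesis using \<open>xs = a # as\<close> Cons by (auto simp: arc_set_def)
  qed (use Cons in \<open>simp add: arc_set_def\<close>)
qed (simp add: arc_set_def)

lemma arc_set_rotate: "arc_set (rotate k xs) = arc_set xs"
  by (induction k) (auto simp: arc_set_rotate1)

lemma fst_arc_set: "fst ` arc_set xs = set xs"
proof -
  have "map fst (zip xs (rotate1 xs)) = xs" by (rule map_fst_zip) simp
  then show ?thesis unfolding arc_set_def set_map[symmetric] by (simp only:)
qed

lemma pcas_iff:
  "p \<noteq> [] \<Longrightarrow> pcas u p v \<longleftrightarrow> fst (p ! 0) = u \<and> snd (last p) = v \<and> (\<forall>i. Suc i < length p \<longrightarrow> snd (p ! i) = fst (p ! Suc i))"
proof (induction p arbitrary: u)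
  case (Cons e es)
  show ?case
  proof (cases es)
    case (Cons e' es')
    have H: "(\<forall>i. Suc i < length (e # es) \<longrightarrow> snd ((e # es) ! i) = fst ((e # es) ! Suc i))
      \<longleftrightarrow> snd e = fst (es ! 0) \<and> (\<forall>i. Suc i < length es \<longrightarrow> snd (es ! i) = fst (es ! Suc i))"
      (is "?L \<longleftrightarrow> ?R")
    proof
      assume L: ?L
      have "snd e = fst (es ! 0)" using L[rule_format, of 0] Cons by simp
      moreover have "snd (es ! i) = fst (es ! Suc i)" if "Suc i < length es" for i
        using L[rule_format, of "Suc i"] that by simp
      ultimately show ?R by blast
    next
      assume R: ?R
      show ?L
      proof (intro allI impI)
        fix i assume "Suc i < length (e # es)"
        then show "snd ((e # es) ! i) = fst ((e # es) ! Suc i)" using R by (cases i) auto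
      qed
    qed
    have ne: "es \<noteq> []" using Cons by simp
    show ?thesis
      unfolding H pcas.simps Cons.IH[OF ne] nth_Cons_0 last_ConsR[OF ne]
      by (simp only: eq_commute[of "snd e" "fst (es ! 0)"] conj_ac)
  qed auto
qed simp

lemma pawalk_verts_eq: "pcas u p v \<Longrightarrow> pawalk_verts u p = u # map snd p"
  by (induction p arbitrary: u) auto

text \<open>The tails of the arcs of a cycle form a list xs, and the heads are the same list shifted
  by one.\<close>

lemma cycle_iff:
  assumes wf: "\<And>e. e \<in> parcs T \<Longrightarrow> fst e \<in> pverts T"
  shows "pre_digraph.cycle (with_proj T) p \<longleftrightarrow>
    (\<exists>xs. xs \<noteq> [] \<and> distinct xs \<and> p = zip xs (rotate1 xs) \<and> arc_set xs \<subseteq> parcs T)"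
proof
  assume "pre_digraph.cycle (with_proj T) p"
  then obtain u where u: "set p \<subseteq> parcs T" "pcas u p u" "distinct (tl (pawalk_verts u p))" "p \<noteq> []"
    by (auto simp: pre_digraph.cycle_def pre_digraph.awalk_def cas_with_proj_eq awalk_verts_with_proj_eq)
  have d: "distinct (map snd p)" using u(3) pawalk_verts_eq[OF u(2)] by simp
  have c: "fst (p ! 0) = u" "snd (last p) = u" "\<And>i. Suc i < length p \<Longrightarrow> snd (p ! i) = fst (p ! Suc i)"
    using iffD1[OF pcas_iff[OF u(4)] u(2)] by blast+
  have r: "rotate1 (map fst p) = map snd p"
  proof (rule nth_equalityI)
    fix i assume "i < length (rotate1 (map fst p))"
    then have i: "i < length p" by simp
    show "rotate1 (map fst p) ! i = map snd p ! i"
    proof (cases "Suc i = length p")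
      case True
      then have "last p = p ! i" using last_conv_nth[OF u(4)] by (simp flip: True)
      then have "snd (p ! i) = fst (p ! 0)" using c(1,2) by simp
      then show ?thesis using True i u(4) by (simp add: nth_rotate1)
    next
      case False
      then have "Suc i < length p" using i by simp
      then show ?thesis using c(3)[of i] i by (simp add: nth_rotate1)
    qed
  qed simp
  have "p = zip (map fst p) (rotate1 (map fst p))" unfolding r by (simp add: zip_map_fst_snd)
  moreover have "distinct (map fst p)" using d r by (metis distinct1_rotate)
  ultimately show "\<exists>xs. xs \<noteq> [] \<and> distinct xs \<and> p = zip xs (rotate1 xs) \<and> arc_set xs \<subseteq> parcs T"
    using u(1,4) unfolding arc_set_def by (intro exI[of _ "map fst p"]) auto
next
  assume "\<exists>xs. xs \<noteq> [] \<and> distinct xs \<and> p = zip xs (rotate1 xs) \<and> arc_set xs \<subseteq> parcs T"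
  then obtain xs where xs: "xs \<noteq> []" "distinct xs" and p: "p = zip xs (rotate1 xs)" and a: "set p \<subseteq> parcs T"
    by (auto simp: arc_set_def)
  have ne: "p \<noteq> []" and len: "length p = length xs" using xs p by (cases xs; auto)+
  have nth: "p ! i = (xs ! i, xs ! (Suc i mod length xs))" if "i < length xs" for i
    using that p by (simp add: nth_rotate1)
  have l0: "0 < length xs" using xs by simp
  have "pcas (xs ! 0) p (xs ! 0)"
    unfolding pcas_iff[OF ne]
  proof (intro conjI allI impI)
    show "fst (p ! 0) = xs ! 0" using nth[OF l0] by simp
    show "snd (last p) = xs ! 0" using nth[of "length xs - 1"] l0 ne len by (simp add: last_conv_nth)
    show "snd (p ! i) = fst (p ! Suc i)" if "Suc i < length p" for i
      using nth[of i] nth[of "Suc i"] that len by simp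
  qed
  moreover have "distinct (tl (pawalk_verts (xs ! 0) p))"
  proof -
    have "map snd p = rotate1 xs" using p by (simp add: map_snd_zip)
    then show ?thesis using pawalk_verts_eq[OF \<open>pcas (xs ! 0) p (xs ! 0)\<close>] xs by simp
  qed
  moreover have "xs ! 0 \<in> pverts T"
  proof -
    have "p ! 0 \<in> parcs T" using a ne by (meson length_greater_0_conv nth_mem subsetD)
    then show ?thesis using wf nth[OF l0] by force
  qed
  ultimately show "pre_digraph.cycle (with_proj T) p"
    using a ne by (auto simp: pre_digraph.cycle_def pre_digraph.awalk_def cas_with_proj_eq awalk_verts_with_proj_eq)
qed

definition cyclic_lists :: "'a pair_pre_digraph \<Rightarrow> nat \<Rightarrow> 'a list set" where
  "cyclic_lists T l = {xs \<in> dlists l (pverts T). arc_set xs \<subseteq> parcs T}"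

text \<open>The arcs of a distinct list are the graph of its successor map; a list is thus
  determined by its arcs and its first entry.\<close>

lemma arc_set_functional:
  assumes "distinct xs" "(a, b) \<in> arc_set xs" "(a, c) \<in> arc_set xs"
  shows "b = c"
  using assms by (auto simp: arc_set_index nth_eq_iff_index_eq)

lemma arc_set_eq_rotate:
  assumes xs: "distinct xs" "xs \<noteq> []" and ys: "length ys = length xs" and eq: "arc_set ys = arc_set xs"
  shows "\<exists>k<length xs. ys = rotate k xs"
proof -
  have "ys ! 0 \<in> set ys" using xs ys by (intro nth_mem) simp
  then have "ys ! 0 \<in> set xs" using eq fst_arc_set[of ys] fst_arc_set[of xs] by simp
  then obtain k where k: "k < length xs" "xs ! k = ys ! 0" by (auto simp: in_set_conv_nth)
  define zs where "zs = rotate k xs"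
  have zs: "distinct zs" "length zs = length xs" "arc_set zs = arc_set xs"
    using xs by (simp_all add: zs_def arc_set_rotate)
  have "ys ! i = zs ! i" if "i < length xs" for i
    using that
  proof (induction i)
    case 0
    then show ?case using k xs by (simp add: zs_def nth_rotate)
  next
    case (Suc i)
    have "(ys ! i, ys ! Suc i) \<in> arc_set zs"
      using Suc.prems ys eq zs(3) by (auto simp: arc_set_index[of ys] intro!: rev_image_eqI[of i])
    moreover have "(zs ! i, zs ! Suc i) \<in> arc_set zs"
      using Suc.prems zs(2) by (auto simp: arc_set_index intro!: rev_image_eqI[of i])
    ultimately show ?case using arc_set_functional[OF zs(1)] Suc by auto
  qed
  then have "ys = zs" using ys zs by (intro nth_equalityI) auto
  then show ?thesis using k zs_def by blast
qed

text \<open>The lists with a given arc set are the l rotations of one of them, and these are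
  different because the entries are distinct.\<close>

lemma card_cyclic_lists:
  assumes fin: "finite (pverts T)" and wf: "\<And>e. e \<in> parcs T \<Longrightarrow> fst e \<in> pverts T" and l: "0 < l"
  shows "card (cyclic_lists T l) = l * num_cycles T l"
proof -
  have finC: "finite (cyclic_lists T l)"
    unfolding cyclic_lists_def using fin by simp
  have "{set p | p. pre_digraph.cycle (with_proj T) p \<and> length p = l} = arc_set ` cyclic_lists T l"
  proof
    show "{set p | p. pre_digraph.cycle (with_proj T) p \<and> length p = l} \<subseteq> arc_set ` cyclic_lists T l"
    proof clarify
      fix p assume "pre_digraph.cycle (with_proj T) p" and lp: "l = length p"
      then obtain xs where xs: "distinct xs" "p = zip xs (rotate1 xs)" "arc_set xs \<subseteq> parcs T"
        using cycle_iff[of T p, OF wf] by blast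
      have "fst e \<in> pverts T" if "e \<in> arc_set xs" for e
        using wf subsetD[OF xs(3) that] by blast
      then have "fst ` arc_set xs \<subseteq> pverts T" by (rule image_subsetI)
      then have "set xs \<subseteq> pverts T" by (simp only: fst_arc_set)
      then have "xs \<in> cyclic_lists T (length p)" using xs by (simp add: cyclic_lists_def dlists_def)
      then show "set p \<in> arc_set ` cyclic_lists T (length p)" using xs(2) by (auto simp: arc_set_def)
    qed
    show "arc_set ` cyclic_lists T l \<subseteq> {set p | p. pre_digraph.cycle (with_proj T) p \<and> length p = l}"
    proof clarify
      fix xs assume "xs \<in> cyclic_lists T l"
      then have xs: "distinct xs" "length xs = l" "arc_set xs \<subseteq> parcs T" by (auto simp: cyclic_lists_def dlists_def)
      then have "pre_digraph.cycle (with_proj T) (zip xs (rotate1 xs))"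
        using cycle_iff[of T "zip xs (rotate1 xs)", OF wf] l by auto
      then show "\<exists>p. arc_set xs = set p \<and> pre_digraph.cycle (with_proj T) p \<and> length p = l"
        using xs by (intro exI[of _ "zip xs (rotate1 xs)"]) (simp add: arc_set_def)
    qed
  qed
  then have num: "num_cycles T l = card (arc_set ` cyclic_lists T l)"
    unfolding num_cycles_def by simp
  have fibre: "card {ys. ys \<in> cyclic_lists T l \<and> arc_set ys = arc_set xs} = l" if "xs \<in> cyclic_lists T l" for xs
  proof -
    have xs: "distinct xs" "length xs = l" "set xs \<subseteq> pverts T" "arc_set xs \<subseteq> parcs T"
      using that by (auto simp: cyclic_lists_def dlists_def)
    have "{ys. ys \<in> cyclic_lists T l \<and> arc_set ys = arc_set xs} = (\<lambda>k. rotate k xs) ` {..<l}"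
    proof
      show "{ys. ys \<in> cyclic_lists T l \<and> arc_set ys = arc_set xs} \<subseteq> (\<lambda>k. rotate k xs) ` {..<l}"
      proof clarify
        fix ys assume "ys \<in> cyclic_lists T l" "arc_set ys = arc_set xs"
        then have "\<exists>k<length xs. ys = rotate k xs"
          using xs l by (intro arc_set_eq_rotate) (auto simp: cyclic_lists_def dlists_def)
        then show "ys \<in> (\<lambda>k. rotate k xs) ` {..<l}" using xs(2) by auto
      qed
      show "(\<lambda>k. rotate k xs) ` {..<l} \<subseteq> {ys. ys \<in> cyclic_lists T l \<and> arc_set ys = arc_set xs}"
        using xs by (auto simp: cyclic_lists_def dlists_def arc_set_rotate)
    qed
    moreover have "inj_on (\<lambda>k. rotate k xs) {..<l}"
    proof (rule inj_onI)
      fix j k assume jk: "j \<in> {..<l}" "k \<in> {..<l}" "rotate j xs = rotate k xs"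
      have "rotate j xs ! 0 = xs ! j" "rotate k xs ! 0 = xs ! k"
        using jk(1,2) xs(2) l by (simp_all add: nth_rotate)
      then have "xs ! j = xs ! k" using jk(3) by simp
      then show "j = k" using jk xs by (simp add: nth_eq_iff_index_eq)
    qed
    ultimately show ?thesis by (simp add: card_image)
  qed
  have "card (cyclic_lists T l) = (\<Sum>xs\<in>cyclic_lists T l. 1)" by simp
  also have "\<dots> = (\<Sum>A\<in>arc_set ` cyclic_lists T l. \<Sum>ys\<in>{ys. ys \<in> cyclic_lists T l \<and> arc_set ys = A}. 1)"
    by (rule sum.image_gen[OF finC])
  also have "\<dots> = (\<Sum>A\<in>arc_set ` cyclic_lists T l. l)"
    by (intro sum.cong refl) (use fibre in auto)
  finally show ?thesis using num by simp
qed

lemma closed_walk_ind: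
  "closed_walk (\<lambda>i j. of_bool ((i, j) \<in> E)) xs = (of_bool (arc_set xs \<subseteq> E) :: real)"
proof (cases "arc_set xs \<subseteq> E")
  case True
  then show ?thesis unfolding closed_walk_def by (auto simp: arc_set_index intro!: prod.neutral)
next
  case False
  then obtain i where "i < length xs" "(xs ! i, xs ! (Suc i mod length xs)) \<notin> E"
    by (auto simp: arc_set_index)
  then have "closed_walk (\<lambda>i j. of_bool ((i, j) \<in> E)) xs = (0 :: real)"
    unfolding closed_walk_def by (intro prod_zero) auto
  then show ?thesis using False by simp
qed

lemma num_cycles_labelled:
  assumes E: "E \<in> tours n" and l: "0 < l"
  shows "real l * real (num_cycles (labelled n E) l)
    = (\<Sum>xs\<in>dlists l {..<n}. closed_walk (\<lambda>i j. of_bool ((i, j) \<in> E)) xs)"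
proof -
  have "card (cyclic_lists (labelled n E) l) = l * num_cycles (labelled n E) l"
    using toursD(1)[OF E] l by (intro card_cyclic_lists) auto
  then have "real l * real (num_cycles (labelled n E) l) = real (card (cyclic_lists (labelled n E) l))"
    by simp
  also have "\<dots> = (\<Sum>xs\<in>dlists l {..<n}. of_bool (arc_set xs \<subseteq> E))"
    by (simp add: cyclic_lists_def Int_def)
  finally show ?thesis by (simp add: closed_walk_ind)
qed

section \<open>From kernel bounds to the maximal number of cycles\<close>

lemma max_cycles_eq: "max_cycles n l = Max ((\<lambda>E. num_cycles (labelled n E) l) ` tours n)"
proof -
  have "{T :: nat pair_pre_digraph. tournament T \<and> pverts T = {..<n}} = labelled n ` tours n"
    using tournament_iff_labelled by auto
  then show ?thesis unfolding max_cycles_def by (simp add: image_image)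
qed

lemma tours_nonempty: "tours n \<noteq> {}"
  using bij_betw_imp_surj_on[OF orient_bij[of n]] by blast

text \<open>The tournament is read as a kernel on n equally likely points. A sample of l points
  equals a given cyclic list with probability n ^ (-l) and then contributes 1; all other samples
  contribute at least 0.\<close>

lemma cycle_count_upper:
  assumes E: "E \<in> tours n" and n: "0 < n" and l: "2 \<le> l"
    and bound: "\<And>S. bounded_skew_kernel (measure_pmf (pmf_of_set {..<n})) S \<Longrightarrow>
      cycle_integral (measure_pmf (pmf_of_set {..<n})) (\<lambda>x y. (1 + S x y) / 2) l \<le> c"
  shows "real l * real (num_cycles (labelled n E) l) \<le> real n ^ l * c"
proof -
  let ?N = "measure_pmf (pmf_of_set {..<n})"
  \<comment> \<open>Skewness forces 0 on the diagonal, so repeated points get weight 1/2. Closed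
    walks through them are only used as nonnegative terms.\<close>
  define S where "S i j = (if (i, j) \<in> E then 1 else if (j, i) \<in> E then - 1 else 0 :: real)" for i j
  have setsN: "sets (?N \<Otimes>\<^sub>M ?N) = sets (count_space (UNIV :: (nat \<times> nat) set))"
    using pair_measure_countable[of "UNIV :: nat set" "UNIV :: nat set"]
    by (metis UNIV_Times_UNIV countableI_type sets_measure_pmf_count_space sets_pair_measure_cong)
  have skew: "S i j = - S j i" for i j
    using toursD(1)[OF E] toursD(2)[OF E, of i] toursD(3)[OF E, of i j]
    by (cases "i = j") (auto simp: S_def)
  have "bdd_kernel ?N S"
    unfolding bdd_kernel_def bdd_fun_def
  proof
    show "(\<lambda>(x, y). S x y) \<in> borel_measurable (?N \<Otimes>\<^sub>M ?N)"
      by (simp add: measurable_cong_sets[OF setsN refl])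
    show "\<exists>B. \<forall>x. \<bar>case x of (x, y) \<Rightarrow> S x y\<bar> \<le> B" by (intro exI[of _ 1]) (auto simp: S_def)
  qed
  then interpret K: bounded_skew_kernel ?N S
  proof unfold_locales
    show "skew S" unfolding skew_def using skew by blast
    show "\<bar>S x y\<bar> \<le> 1" for x y by (simp add: S_def)
  qed
  interpret P: prob_space "\<Pi>\<^sub>M i\<in>{..<l}. ?N" by (rule prob_space.prob_space_power[OF measure_pmf.prob_space_axioms])
  interpret F: finite_product_sigma_finite "\<lambda>_::nat. ?N" "{..<l}" by standard auto
  let ?C = "{xs \<in> dlists l {..<n}. arc_set xs \<subseteq> E}"
  let ?f = "\<lambda>x. closed_walk (\<lambda>i j. K.ww (x i) (x j)) [0..<l]"
  define B where "B xs = (\<Pi>\<^sub>E i\<in>{..<l}. {xs ! i})" for xs :: "nat list"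
  have B: "B xs \<in> sets (\<Pi>\<^sub>M i\<in>{..<l}. ?N)" for xs unfolding B_def by (intro sets_PiM_I_finite) auto
  have mB: "measure (\<Pi>\<^sub>M i\<in>{..<l}. ?N) (B xs) = (1 / real n) ^ l" if "xs \<in> ?C" for xs
  proof -
    have xs: "set xs \<subseteq> {..<n}" "length xs = l" using that by (auto simp: dlists_def)
    have "emeasure (\<Pi>\<^sub>M i\<in>{..<l}. ?N) (B xs) = (\<Prod>i\<in>{..<l}. emeasure ?N {xs ! i})"
      unfolding B_def by (intro F.measure_times) auto
    also have "\<dots> = (\<Prod>i\<in>{..<l}. ennreal (1 / real n))"
    proof (rule prod.cong[OF refl])
      fix i assume "i \<in> {..<l}"
      then have "xs ! i \<in> {..<n}" using xs nth_mem by blast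
      then show "emeasure ?N {xs ! i} = ennreal (1 / real n)"
        using n by (simp add: emeasure_pmf_single pmf_of_set lessThan_empty_iff)
    qed
    also have "\<dots> = ennreal ((1 / real n) ^ l)" by (simp add: ennreal_power)
    finally show ?thesis by (simp add: measure_def)
  qed
  \<comment> \<open>The boxes \<open>B xs\<close> are disjoint, and on each of them the closed walk
    has weight 1.\<close>
  have le: "(\<Sum>xs\<in>?C. indicator (B xs) x) \<le> ?f x" for x
  proof (cases "\<exists>xs\<in>?C. x \<in> B xs")
    case True
    then obtain xs where xs: "xs \<in> ?C" "x \<in> B xs" by blast
    have len: "length xs = l" using xs by (simp add: dlists_def)
    have x: "x i = xs ! i" if "i < l" for i using xs(2) that by (auto simp: B_def PiE_iff)
    have uniq: "ys = xs" if "ys \<in> ?C" "x \<in> B ys" for ys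
    proof (rule nth_equalityI)
      show "length ys = length xs" using that len by (simp add: dlists_def)
      fix i assume "i < length ys"
      then have "i < l" using that by (simp add: dlists_def)
      then have "x i = ys ! i" using that(2) by (auto simp: B_def PiE_iff)
      then show "ys ! i = xs ! i" using x[OF \<open>i < l\<close>] by simp
    qed
    have "(\<Sum>ys\<in>?C. indicator (B ys) x) = (\<Sum>ys\<in>?C. if ys = xs then 1 else 0 :: real)"
    proof (rule sum.cong[OF refl])
      fix ys assume ys: "ys \<in> ?C"
      show "indicator (B ys) x = (if ys = xs then 1 else 0 :: real)"
      proof (cases "ys = xs")
        case True
        then show ?thesis using xs(2) by (simp add: indicator_def)
      next
        case False
        then have "x \<notin> B ys" using uniq[OF ys] by blast
        then show ?thesis using False by (simp add: indicator_def)
      qed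
    qed
    also have "\<dots> = (if xs \<in> ?C then 1 else 0)"
      by (rule sum.delta) (rule finite_subset[of _ "dlists l {..<n}"]; simp)
    also have "\<dots> = 1" using xs(1) by (simp only: if_True)
    also have "1 \<le> ?f x"
    proof -
      have "K.ww (x ([0..<l] ! i)) (x ([0..<l] ! (Suc i mod length [0..<l]))) = 1" if i: "i < length [0..<l]" for i
      proof -
        have "i < l" "Suc i mod l < l" using i by (auto intro: Suc_mod_less)
        moreover have "(xs ! i, xs ! (Suc i mod l)) \<in> arc_set xs"
          using i len by (auto simp: arc_set_index)
        ultimately show ?thesis using xs(1) by (auto simp: x K.ww_def S_def)
      qed
      then have "?f x = 1" unfolding closed_walk_def by (intro prod.neutral) auto
      then show ?thesis by simp
    qed
    finally show ?thesis .
  next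
    case False
    then have "(\<Sum>xs\<in>?C. indicator (B xs) x) = (0::real)" by (intro sum.neutral) (auto simp: indicator_def)
    then show ?thesis using K.closed_walk_ww(1)[of x "[0..<l]"] by simp
  qed
  have intB: "integrable (\<Pi>\<^sub>M i\<in>{..<l}. ?N) (indicator (B xs) :: _ \<Rightarrow> real)" for xs
    using B by (simp add: integrable_indicator_iff less_top[symmetric])
  have "real (card ?C) * (1 / real n) ^ l = (\<Sum>xs\<in>?C. measure (\<Pi>\<^sub>M i\<in>{..<l}. ?N) (B xs))"
    by (simp add: mB)
  also have "\<dots> = (\<integral>x. (\<Sum>xs\<in>?C. indicator (B xs) x) \<partial>(\<Pi>\<^sub>M i\<in>{..<l}. ?N))"
    using intB B by (subst Bochner_Integration.integral_sum) auto
  also have "\<dots> \<le> (\<integral>x. ?f x \<partial>(\<Pi>\<^sub>M i\<in>{..<l}. ?N))"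
  proof (rule integral_mono[OF _ _ le])
    show "integrable (\<Pi>\<^sub>M i\<in>{..<l}. ?N) (\<lambda>x. \<Sum>xs\<in>?C. indicator (B xs) x :: real)"
      by (rule Bochner_Integration.integrable_sum) (rule intB)
    show "integrable (\<Pi>\<^sub>M i\<in>{..<l}. ?N) ?f"
      by (rule P.bdd_fun_integrable[OF prob_space.bdd_fun_closed_walk[OF measure_pmf.prob_space_axioms K.bdd_ww]]) auto
  qed
  also have "\<dots> = cycle_integral ?N K.ww l" by (simp add: cycle_integral_def)
  also have "\<dots> \<le> c"
  proof -
    have "K.ww = (\<lambda>x y. (1 + S x y) / 2)" by (simp add: K.ww_def fun_eq_iff)
    then show ?thesis using bound[OF K.bounded_skew_kernel_axioms] by simp
  qed
  finally have "real (card ?C) \<le> real n ^ l * c"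
    using n by (simp add: power_divide field_simps)
  moreover have "real l * real (num_cycles (labelled n E) l) = real (card ?C)"
    using num_cycles_labelled[OF E] l by (simp add: closed_walk_ind Int_def)
  ultimately show ?thesis by simp
qed

text \<open>An extremal S is almost surely a sign, so n random points already determine a tournament
  without further coins. Its mean number of cycles is at most the maximum.\<close>

lemma (in bounded_skew_kernel) cycle_count_lower:
  assumes ext: "extremal" and l: "2 \<le> l"
  shows "real (card (dlists l {..<n})) * cycle_integral M ww l \<le> real l * real (max_cycles n l)"
proof -
  interpret P: prob_space "\<Pi>\<^sub>M i\<in>{..<n}. M" by (rule prob_space_power)
  have S4: "cycle_integral M S 4 = 1 / 3" using ext by (simp add: extremal_def)
  let ?F = "\<lambda>x. \<Sum>xs\<in>dlists l {..<n}. closed_walk (\<lambda>i j. ww (x i) (x j)) xs"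
  have sub: "set xs \<subseteq> {..<n}" "distinct xs" "length xs = l" if "xs \<in> dlists l {..<n}" for xs
    using that by (auto simp: dlists_def)
  have intF: "integrable (\<Pi>\<^sub>M i\<in>{..<n}. M) ?F"
    by (intro P.bdd_fun_integrable bdd_fun_sum bdd_fun_closed_walk bdd_ww sub)
  have "real (card (dlists l {..<n})) * cycle_integral M ww l = (\<Sum>xs\<in>dlists l {..<n}. cycle_integral M ww l)"
    by simp
  also have "\<dots> = (\<Sum>xs\<in>dlists l {..<n}. (\<integral>x. closed_walk (\<lambda>i j. ww (x i) (x j)) xs \<partial>(\<Pi>\<^sub>M i\<in>{..<n}. M)))"
  proof (rule sum.cong[OF refl])
    fix xs assume "xs \<in> dlists l {..<n}"
    from integral_closed_walk[OF bdd_ww sub(2,1)[OF this]] sub(3)[OF this]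
    show "cycle_integral M ww l = (\<integral>x. closed_walk (\<lambda>i j. ww (x i) (x j)) xs \<partial>(\<Pi>\<^sub>M i\<in>{..<n}. M))" by simp
  qed
  also have "\<dots> = (\<integral>x. ?F x \<partial>(\<Pi>\<^sub>M i\<in>{..<n}. M))"
    by (intro Bochner_Integration.integral_sum[symmetric] P.bdd_fun_integrable bdd_fun_closed_walk bdd_ww sub)
  also have "\<dots> \<le> (\<integral>x. real l * real (max_cycles n l) \<partial>(\<Pi>\<^sub>M i\<in>{..<n}. M))"
  proof (rule integral_mono_AE[OF intF])
    have "AE x in (\<Pi>\<^sub>M i\<in>{..<n}. M). \<forall>p\<in>upairs n. \<bar>S (x (fst p)) (x (snd p))\<bar> = 1"
      by (rule AE_finite_allI[OF finite_upairs]) (auto intro!: AE_sign[OF S4] simp: upairs_def)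
    then show "AE x in (\<Pi>\<^sub>M i\<in>{..<n}. M). ?F x \<le> real l * real (max_cycles n l)"
    proof eventually_elim
      fix x assume sgn: "\<forall>p\<in>upairs n. \<bar>S (x (fst p)) (x (snd p))\<bar> = 1"
      \<comment> \<open>The tournament sampled at x; on distinct vertices \<open>ww\<close> is its
        indicator.\<close>
      define E where "E = {(i, j). i < n \<and> j < n \<and> i \<noteq> j \<and> S (x i) (x j) = 1}"
      have s: "S (x i) (x j) = 1 \<or> S (x i) (x j) = - 1" if "i < n" "j < n" "i \<noteq> j" for i j
      proof (cases "i < j")
        case True
        then have "(i, j) \<in> upairs n" using that by (simp add: upairs_def)
        then show ?thesis using sgn by force
      next
        case False
        then have "(j, i) \<in> upairs n" using that by (simp add: upairs_def)
        then have "\<bar>S (x j) (x i)\<bar> = 1" using sgn by force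
        then show ?thesis using S_skew[of "x i" "x j"] by auto
      qed
      have E: "E \<in> tours n"
      proof (rule toursI)
        show "((i, j) \<in> E) = ((j, i) \<notin> E)" if "i < n" "j < n" "i \<noteq> j" for i j
          using s[OF that] S_skew[of "x i" "x j"] that by (auto simp: E_def)
      qed (auto simp: E_def)
      have "?F x = (\<Sum>xs\<in>dlists l {..<n}. closed_walk (\<lambda>i j. of_bool ((i, j) \<in> E)) xs)"
      proof (rule sum.cong[OF refl], rule closed_walk_cong)
        fix xs i j assume xs: "xs \<in> dlists l {..<n}" and ij: "i \<in> set xs" "j \<in> set xs" "i \<noteq> j"
        then have "i < n" "j < n" using sub(1)[OF xs] by auto
        then show "ww (x i) (x j) = of_bool ((i, j) \<in> E)"
          using s[of i j] ij by (auto simp: ww_def E_def)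
      qed (use sub l in auto)
      also have "\<dots> = real l * real (num_cycles (labelled n E) l)"
        using num_cycles_labelled[OF E] l by simp
      also have "num_cycles (labelled n E) l \<le> max_cycles n l"
        unfolding max_cycles_eq using E by (intro Max_ge) auto
      finally show "?F x \<le> real l * real (max_cycles n l)" by (simp add: mult_left_mono)
    qed
  qed simp
  finally show ?thesis by (simp add: P.prob_space)
qed

lemma falling_power_ratio:
  "(\<lambda>n. real n ^ l / (fact l * real (n choose l))) \<longlonglongrightarrow> 1"
proof -
  have "(\<lambda>n. \<Prod>i<l. inverse (1 - real i / real n)) \<longlonglongrightarrow> (\<Prod>i<l. inverse (1 - 0))"
    by (intro tendsto_prod tendsto_inverse tendsto_diff tendsto_const lim_const_over_n) simp
  moreover have "\<forall>\<^sub>F n in sequentially. (\<Prod>i<l. inverse (1 - real i / real n)) = real n ^ l / (fact l * real (n choose l))"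
    using eventually_gt_at_top[of l]
  proof eventually_elim
    fix n assume n: "l < n"
    have "fact l * real (n choose l) = (\<Prod>i<l. real n - real i)"
      by (simp add: binomial_gbinomial gbinomial_prod_rev atLeast0LessThan)
    also have "\<dots> = (\<Prod>i<l. real n * (1 - real i / real n))"
      using n by (intro prod.cong) (auto simp: field_simps)
    also have "\<dots> = real n ^ l * (\<Prod>i<l. 1 - real i / real n)" by (simp add: prod.distrib)
    finally show "(\<Prod>i<l. inverse (1 - real i / real n)) = real n ^ l / (fact l * real (n choose l))"
      using n by (simp add: prod_inversef[symmetric] comp_def divide_inverse)
  qed
  ultimately show ?thesis by (simp add: tendsto_cong)
qed

text \<open>Sampling bounds the ratio below by c exactly, since both sides count lists of distinct
  vertices. The upper bound counts all n ^ l lists and loses a factor that tends to 1.\<close>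

lemma (in bounded_skew_kernel) cycle_limit_eq:
  assumes ext: "extremal" and l: "2 \<le> l" and c: "2 ^ l * cycle_integral M ww l = c"
    and bound: "\<And>n S. 0 < n \<Longrightarrow> bounded_skew_kernel (measure_pmf (pmf_of_set {..<n::nat})) S \<Longrightarrow>
      2 ^ l * cycle_integral (measure_pmf (pmf_of_set {..<n})) (\<lambda>x y. (1 + S x y) / 2) l \<le> c"
  shows "cycle_limit l = c"
proof -
  let ?r = "\<lambda>n. real (max_cycles n l) / random_cycles n l"
  have fact_l: "(fact l :: real) = real l * fact (l - 1)" using l by (simp add: fact_reduce)
  have lo: "c \<le> ?r n" and hi: "?r n \<le> c * (real n ^ l / (fact l * real (n choose l)))" if n: "l < n" for n
  proof -
    have pos: "0 < real (n choose l)" "0 < (fact (l - 1) :: real)" "0 < real l" using n l by simp_all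
    have R: "0 < random_cycles n l" using pos by (simp add: random_cycles_def)
    have card: "real (card (dlists l {..<n})) = fact l * real (n choose l)"
    proof -
      have "card (dlists l {..<n}) = \<Prod>{n - l + 1..n}" using card_dlists[of "{..<n}" l] n by simp
      also have "\<dots> = fact n div fact (n - l)" using fact_div_fact[of "n - l" n] by simp
      finally show ?thesis using n by (simp add: binomial_fact real_of_nat_div[OF fact_dvd] field_simps)
    qed
    have "fact l * real (n choose l) * (c / 2 ^ l) \<le> real l * real (max_cycles n l)"
      using cycle_count_lower[OF ext l, of n] unfolding card c[symmetric] by simp
    then have "c * random_cycles n l \<le> real (max_cycles n l)"
      using pos unfolding fact_l random_cycles_def by (simp add: field_simps)
    then show "c \<le> ?r n" using R by (simp add: pos_le_divide_eq)
    obtain E where E: "E \<in> tours n" "max_cycles n l = num_cycles (labelled n E) l"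
    proof -
      have "max_cycles n l \<in> (\<lambda>E. num_cycles (labelled n E) l) ` tours n"
        unfolding max_cycles_eq by (rule Max_in) (simp_all add: finite_tours tours_nonempty)
      then show ?thesis using that by blast
    qed
    have "real l * real (max_cycles n l) \<le> real n ^ l * (c / 2 ^ l)"
      unfolding E(2)
    proof (rule cycle_count_upper[OF E(1) _ l])
      show "0 < n" using n by simp
      fix S assume "bounded_skew_kernel (measure_pmf (pmf_of_set {..<n})) S"
      from bound[OF _ this] show "cycle_integral (measure_pmf (pmf_of_set {..<n})) (\<lambda>x y. (1 + S x y) / 2) l \<le> c / 2 ^ l"
        using n by (simp add: field_simps)
    qed
    then have "real (max_cycles n l) \<le> c * (real n ^ l / (fact l * real (n choose l))) * random_cycles n l"
      using pos unfolding fact_l random_cycles_def by (simp add: field_simps)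
    then show "?r n \<le> c * (real n ^ l / (fact l * real (n choose l)))" using R by (simp add: pos_divide_le_eq)
  qed
  have "?r \<longlonglongrightarrow> c"
  proof (rule tendsto_sandwich)
    show "\<forall>\<^sub>F n in sequentially. c \<le> ?r n"
      using eventually_gt_at_top[of l] by eventually_elim (rule lo)
    show "\<forall>\<^sub>F n in sequentially. ?r n \<le> c * (real n ^ l / (fact l * real (n choose l)))"
      using eventually_gt_at_top[of l] by eventually_elim (rule hi)
    show "(\<lambda>n. c * (real n ^ l / (fact l * real (n choose l)))) \<longlonglongrightarrow> c"
      using tendsto_mult[OF tendsto_const[of c] falling_power_ratio[of l]] by simp
  qed simp
  then show ?thesis unfolding cycle_limit_def by (rule limI)
qed

section \<open>Random tournaments\<close>

lemma space_unit_interval [simp]: "space unit_interval = {0..1}"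
  by (simp add: unit_interval_def space_restrict_space)

lemma pair_sigma_finite_unit_interval: "pair_sigma_finite unit_interval unit_interval"
proof -
  interpret U: prob_space unit_interval by (rule prob_space_unit_interval)
  show ?thesis ..
qed

lemma AE_unit_interval: "(AE x in lborel. P x) \<Longrightarrow> AE x in unit_interval. P x"
  unfolding unit_interval_def by (subst AE_restrict_space_iff) (auto elim: eventually_mono)

lemma measurable_unit_square_borel: "(\<lambda>p. p) \<in> (unit_interval \<Otimes>\<^sub>M unit_interval) \<rightarrow>\<^sub>M borel"
proof -
  have "(\<lambda>p. (fst p, snd p)) \<in> borel_measurable (unit_interval \<Otimes>\<^sub>M unit_interval)"
    by (intro borel_measurable_Pair measurable_compose[OF measurable_fst measurable_unit_interval_borel]
        measurable_compose[OF measurable_snd measurable_unit_interval_borel])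
  then show ?thesis by simp
qed

lemma measurable_unit_square_borel_swap: "(\<lambda>p. (snd p, fst p)) \<in> (unit_interval \<Otimes>\<^sub>M unit_interval) \<rightarrow>\<^sub>M borel"
  by (intro borel_measurable_Pair measurable_compose[OF measurable_fst measurable_unit_interval_borel]
      measurable_compose[OF measurable_snd measurable_unit_interval_borel])

text \<open>Planar Lebesgue measure is a product, so a null set has almost all sections null, first
  on the line and then in the interval. A measurable null cover N allows reassembling the
  sections.\<close>

lemma AE_unit_square:
  assumes "AE p in (lborel :: (real \<times> real) measure). P p"
  shows "AE p in (unit_interval \<Otimes>\<^sub>M unit_interval). P p"
proof -
  interpret U: pair_sigma_finite unit_interval unit_interval by (rule pair_sigma_finite_unit_interval)
  obtain N where N: "{p \<in> space lborel. \<not> P p} \<subseteq> N" "emeasure lborel N = 0" "N \<in> sets lborel"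
    using AE_E[OF assms] .
  have "AE p in lborel \<Otimes>\<^sub>M lborel. p \<notin> N"
    unfolding lborel_prod by (rule AE_not_in) (use N in auto)
  from lborel_pair.AE_pair[OF this] have "AE x in lborel. AE y in lborel. (x, y) \<notin> N" .
  then have "AE x in unit_interval. AE y in lborel. (x, y) \<notin> N" by (rule AE_unit_interval)
  then have ae: "AE x in unit_interval. AE y in unit_interval. (x, y) \<notin> N" by eventually_elim (rule AE_unit_interval)
  have "(\<lambda>p. p) -` (- N) \<inter> space (unit_interval \<Otimes>\<^sub>M unit_interval) \<in> sets (unit_interval \<Otimes>\<^sub>M unit_interval)"
    by (rule measurable_sets[OF measurable_unit_square_borel]) (use N(3) in simp)
  moreover have "(\<lambda>p. p) -` (- N) \<inter> space (unit_interval \<Otimes>\<^sub>M unit_interval) = {p \<in> space (unit_interval \<Otimes>\<^sub>M unit_interval). p \<notin> N}" by auto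
  ultimately have "AE p in (unit_interval \<Otimes>\<^sub>M unit_interval). p \<notin> N"
    using U.AE_pair_measure[where P = "\<lambda>p. p \<notin> N", OF _ ae] by simp
  then show ?thesis
  proof eventually_elim
    fix p assume "p \<notin> N"
    then show "P p" using N(1) by auto
  qed
qed

lemma AE_unit_square_swap:
  assumes "AE p in (unit_interval \<Otimes>\<^sub>M unit_interval). P p"
  shows "AE p in (unit_interval \<Otimes>\<^sub>M unit_interval). P (snd p, fst p)"
proof -
  interpret U: pair_sigma_finite unit_interval unit_interval by (rule pair_sigma_finite_unit_interval)
  have "AE p in distr (unit_interval \<Otimes>\<^sub>M unit_interval) (unit_interval \<Otimes>\<^sub>M unit_interval) (\<lambda>(x, y). (y, x)). P p"
    by (subst U.distr_pair_swap[symmetric]) (rule assms)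
  from AE_distrD[OF measurable_pair_swap' this] show ?thesis by (simp add: case_prod_beta)
qed

text \<open>Integrals of W live on the completed cube, whereas Fubini is applied to the plain
  product. A Borel version that agrees almost everywhere links the two.\<close>

lemma
  fixes f :: "'a \<Rightarrow> real"
  assumes g: "g \<in> borel_measurable M" and ae: "AE x in M. f x = g x"
  shows measurable_completion_AE: "f \<in> borel_measurable (completion M)"
    and integral_completion_AE: "integral\<^sup>L (completion M) f = integral\<^sup>L M g"
proof -
  show meas: "f \<in> borel_measurable (completion M)"
  proof (rule measurableI)
    fix A :: "real set" assume A: "A \<in> sets borel"
    show "f -` A \<inter> space (completion M) \<in> sets (completion M)"
    proof (rule completion.in_sets_AE)
      show "g -` A \<inter> space M \<in> sets (completion M)"
        using measurable_sets[OF g A] by (rule sets_completionI_sets)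
      show "AE x in completion M. x \<in> g -` A \<inter> space M \<longleftrightarrow> x \<in> f -` A \<inter> space (completion M)"
        using AE_completion[OF ae] by eventually_elim simp
    qed simp
  qed simp
  have "integral\<^sup>L (completion M) f = integral\<^sup>L (completion M) g"
    by (intro integral_cong_AE meas measurable_completion[OF g] AE_completion[OF ae])
  then show "integral\<^sup>L (completion M) f = integral\<^sup>L M g" using integral_completion[OF g] by simp
qed

text \<open>S is Borel, skew and bounded at every point, whereas W is tied to it only almost
  everywhere. The carousel fits this form despite its values at the corners.\<close>

locale tournamenton_kernel = bounded_skew_kernel unit_interval S for S :: "real \<Rightarrow> real \<Rightarrow> real" +
  fixes W :: "real \<Rightarrow> real \<Rightarrow> real"
  assumes W_range: "x \<in> {0..1} \<Longrightarrow> y \<in> {0..1} \<Longrightarrow> W x y \<in> {0..1}"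
    and W_AE: "AE p in (unit_interval \<Otimes>\<^sub>M unit_interval). W (fst p) (snd p) = ww (fst p) (snd p)"

lemma tournamenton_kernel_exists:
  assumes W: "tournamenton W"
  shows "\<exists>S. tournamenton_kernel S W"
proof -
  interpret U: prob_space unit_interval by (rule prob_space_unit_interval)
  let ?Q = "{0..1} \<times> {0..1} :: (real \<times> real) set"
  \<comment> \<open>W is assumed measurable on the square only; extending it by 0 gives a Lebesgue
    measurable function on the plane, which has a Borel version g.\<close>
  define f where "f p = (if p \<in> ?Q then (case p of (x, y) \<Rightarrow> W x y) else 0)" for p
  have "?Q \<in> sets borel" by (intro borel_closed closed_Times closed_atLeastAtMost)
  then have Q: "?Q \<in> sets lebesgue" by (intro sets_completionI_sets) simp
  have "f \<in> borel_measurable lebesgue"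
    unfolding f_def[abs_def] by (rule borel_measurable_if_I[OF _ Q]) (use W in \<open>simp add: tournamenton_def\<close>)
  then obtain g where g: "g \<in> borel_measurable lborel" "AE p in lborel. f p = g p"
    using completion_ex_borel_measurable_real by blast
  define cl where "cl t = max 0 (min 1 t)" for t :: real
  \<comment> \<open>Clamping and antisymmetrising repair g on its null set: S is skew and bounded by
    1 everywhere, and it equals W minus its transpose almost everywhere.\<close>
  define S where "S x y = cl (g (x, y)) - cl (g (y, x))" for x y
  have g': "g \<in> borel_measurable borel" using g(1) by simp
  have bound: "\<bar>S x y\<bar> \<le> 1" for x y by (auto simp: S_def cl_def)
  have "(\<lambda>(x, y). S x y) = (\<lambda>p. cl (g p) - cl (g (snd p, fst p)))"
    by (auto simp: S_def)
  moreover have "(\<lambda>p. cl (g p) - cl (g (snd p, fst p))) \<in> borel_measurable (unit_interval \<Otimes>\<^sub>M unit_interval)"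
    unfolding cl_def
    by (intro borel_measurable_diff borel_measurable_max borel_measurable_min borel_measurable_const
        measurable_compose[OF measurable_unit_square_borel g']
        measurable_compose[OF measurable_unit_square_borel_swap g'])
  ultimately have meas: "(\<lambda>(x, y). S x y) \<in> borel_measurable (unit_interval \<Otimes>\<^sub>M unit_interval)" by (simp only:)
  have ker: "bdd_kernel unit_interval S"
    unfolding bdd_kernel_def bdd_fun_def
  proof (intro conjI meas exI[of _ 1] allI)
    show "\<bar>case p of (x, y) \<Rightarrow> S x y\<bar> \<le> 1" for p using bound by (cases p) simp
  qed
  interpret K: bounded_skew_kernel unit_interval S
  proof unfold_locales
    show "skew S" by (simp add: skew_def S_def)
    show "bdd_kernel unit_interval S" by (rule ker)
    show "\<bar>S x y\<bar> \<le> 1" for x y by (rule bound)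
  qed
  have "AE p in (unit_interval \<Otimes>\<^sub>M unit_interval). W (fst p) (snd p) = K.ww (fst p) (snd p)"
    using AE_unit_square[OF g(2)] AE_unit_square_swap[OF AE_unit_square[OF g(2)]] AE_space[of "(unit_interval \<Otimes>\<^sub>M unit_interval)"]
  proof eventually_elim
    fix p assume e: "f p = g p" "f (snd p, fst p) = g (snd p, fst p)" and p: "p \<in> space (unit_interval \<Otimes>\<^sub>M unit_interval)"
    obtain x y where xy: "p = (x, y)" by (cases p)
    have in_Q: "x \<in> {0..1}" "y \<in> {0..1}" using p by (auto simp: xy space_pair_measure)
    have w: "W x y \<in> {0..1}" "W y x \<in> {0..1}" "W x y + W y x = 1"
      using W in_Q unfolding tournamenton_def by blast+
    have "g (x, y) = W x y" "g (y, x) = W y x" using e in_Q by (simp_all add: f_def xy)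
    then have "S x y = W x y - W y x" using w by (simp add: S_def cl_def)
    then show "W (fst p) (snd p) = K.ww (fst p) (snd p)" using w(3) by (simp add: xy K.ww_def)
  qed
  moreover have "W x y \<in> {0..1}" if "x \<in> {0..1}" "y \<in> {0..1}" for x y
    using W that unfolding tournamenton_def by blast
  ultimately have "tournamenton_kernel S W"
    by (intro tournamenton_kernel.intro tournamenton_kernel_axioms.intro K.bounded_skew_kernel_axioms)
  then show ?thesis by blast
qed

text \<open>Outside P all coins show the default False, so on the support a coin function is
  determined by the set of its True entries in P.\<close>

lemma measure_Pi_bernoulli:
  assumes fin: "finite P" and q: "\<And>e. e \<in> P \<Longrightarrow> q e \<in> {0..1}"
  shows "measure (measure_pmf (Pi_pmf P False (\<lambda>e. bernoulli_pmf (q e)))) {b. Q {e \<in> P. b e}}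
    = (\<Sum>X\<in>{X \<in> Pow P. Q X}. \<Prod>e\<in>P. if e \<in> X then q e else 1 - q e)"
proof -
  let ?p = "Pi_pmf P False (\<lambda>e. bernoulli_pmf (q e))"
  let ?I = "(\<lambda>X e. e \<in> X) ` {X \<in> Pow P. Q X}"
  have supp: "b e \<longrightarrow> e \<in> P" if "b \<in> set_pmf ?p" for b e
    using that set_Pi_pmf_subset[OF fin, of False "\<lambda>e. bernoulli_pmf (q e)"] by auto
  have "{b. Q {e \<in> P. b e}} \<inter> set_pmf ?p = ?I \<inter> set_pmf ?p"
  proof (intro set_eqI iffI)
    fix b assume b: "b \<in> {b. Q {e \<in> P. b e}} \<inter> set_pmf ?p"
    then have eq: "b = (\<lambda>e. e \<in> {e \<in> P. b e})" using supp[of b] by auto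
    have "{e \<in> P. b e} \<in> {X \<in> Pow P. Q X}" using b by auto
    then have "b \<in> ?I" by (rule image_eqI[where f = "\<lambda>X e. e \<in> X", OF eq])
    then show "b \<in> ?I \<inter> set_pmf ?p" using b by blast
  next
    fix b assume b: "b \<in> ?I \<inter> set_pmf ?p"
    then obtain X where X: "X \<subseteq> P" "Q X" "b = (\<lambda>e. e \<in> X)" by blast
    have "{e \<in> P. e \<in> X} = X" using X(1) by blast
    then show "b \<in> {b. Q {e \<in> P. b e}} \<inter> set_pmf ?p" using b X by simp
  qed
  then have "measure (measure_pmf ?p) {b. Q {e \<in> P. b e}} = measure (measure_pmf ?p) ?I"
    using measure_Int_set_pmf[of ?p "{b. Q {e \<in> P. b e}}"] measure_Int_set_pmf[of ?p ?I] by simp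
  also have "\<dots> = sum (pmf ?p) ?I"
    by (rule measure_measure_pmf_finite) (use fin in simp)
  also have "\<dots> = (\<Sum>X\<in>{X \<in> Pow P. Q X}. pmf ?p (\<lambda>e. e \<in> X))"
    by (subst sum.reindex) (auto simp: inj_on_def fun_eq_iff)
  also have "\<dots> = (\<Sum>X\<in>{X \<in> Pow P. Q X}. \<Prod>e\<in>P. if e \<in> X then q e else 1 - q e)"
  proof (rule sum.cong[OF refl])
    fix X assume "X \<in> {X \<in> Pow P. Q X}"
    then have "pmf ?p (\<lambda>e. e \<in> X) = (\<Prod>e\<in>P. pmf (bernoulli_pmf (q e)) (e \<in> X))"
      by (intro pmf_Pi'[OF fin]) auto
    also have "\<dots> = (\<Prod>e\<in>P. if e \<in> X then q e else 1 - q e)"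
      by (intro prod.cong refl) (use q in auto)
    finally show "pmf ?p (\<lambda>e. e \<in> X) = (\<Prod>e\<in>P. if e \<in> X then q e else 1 - q e)" .
  qed
  finally show ?thesis .
qed

lemma random_orientation_prob:
  assumes "\<And>i j. i < n \<Longrightarrow> j < n \<Longrightarrow> W (x i) (x j) \<in> {0..1}"
  shows "measure (measure_pmf (random_orientation W n x)) A
    = (\<Sum>X\<in>Pow (upairs n). of_bool (labelled n (orient n X) \<in> A) *
        (\<Prod>e\<in>upairs n. if e \<in> X then W (x (fst e)) (x (snd e)) else 1 - W (x (fst e)) (x (snd e))))"
proof -
  let ?q = "\<lambda>e. W (x (fst e)) (x (snd e))"
  have rec: "\<lparr>pverts = {..<n}, parcs = {(i, j) | i j. i < j \<and> j < n \<and> b (i, j)} \<union> {(j, i) | i j. i < j \<and> j < n \<and> \<not> b (i, j)}\<rparr>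
      = labelled n (orient n {e \<in> upairs n. b e})" for b
  proof -
    have sub: "{e \<in> upairs n. b e} \<subseteq> upairs n" by auto
    have "(i, j) \<in> {(i, j) | i j. i < j \<and> j < n \<and> b (i, j)} \<union> {(j, i) | i j. i < j \<and> j < n \<and> \<not> b (i, j)}
        \<longleftrightarrow> (i, j) \<in> orient n {e \<in> upairs n. b e}" for i j
      unfolding mem_orient[OF sub] by (auto simp: upairs_def)
    then show ?thesis unfolding labelled_def by (simp add: set_eq_iff)
  qed
  have "random_orientation W n x = map_pmf (\<lambda>b. labelled n (orient n {e \<in> upairs n. b e}))
      (Pi_pmf (upairs n) False (\<lambda>e. bernoulli_pmf (?q e)))"
    unfolding random_orientation_def rec upairs_def[symmetric] by (simp only: case_prod_unfold)
  then have "measure (measure_pmf (random_orientation W n x)) A =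
      measure (measure_pmf (Pi_pmf (upairs n) False (\<lambda>e. bernoulli_pmf (?q e))))
        {b. labelled n (orient n {e \<in> upairs n. b e}) \<in> A}"
    by (simp add: measure_map_pmf vimage_def)
  also have "\<dots> = (\<Sum>X\<in>{X \<in> Pow (upairs n). labelled n (orient n X) \<in> A}. \<Prod>e\<in>upairs n. if e \<in> X then ?q e else 1 - ?q e)"
    by (rule measure_Pi_bernoulli[OF finite_upairs]) (use assms in \<open>auto simp: upairs_def\<close>)
  also have "\<dots> = (\<Sum>X\<in>Pow (upairs n). if labelled n (orient n X) \<in> A then (\<Prod>e\<in>upairs n. if e \<in> X then ?q e else 1 - ?q e) else 0)"
    by (rule sum.inter_filter) simp
  also have "\<dots> = (\<Sum>X\<in>Pow (upairs n). of_bool (labelled n (orient n X) \<in> A) * (\<Prod>e\<in>upairs n. if e \<in> X then ?q e else 1 - ?q e))"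
    by (rule sum.cong[OF refl]) simp
  finally show ?thesis .
qed

text \<open>Two different coordinates have the product law of M with itself, so a null set of pairs
  pulls back to a null set. A repeated coordinate stays on the diagonal, which may itself be
  null.\<close>

lemma (in prob_space) AE_PiM_pairs:
  fixes n :: nat
  assumes "AE p in M \<Otimes>\<^sub>M M. Q p"
  shows "AE x in (\<Pi>\<^sub>M i\<in>{..<n}. M). \<forall>i<n. \<forall>j<n. i \<noteq> j \<longrightarrow> Q (x i, x j)"
proof -
  interpret P: prob_space "\<Pi>\<^sub>M i\<in>{..<n}. M" by (rule prob_space_power)
  interpret U: pair_prob_space M M by (rule pair_prob)
  obtain N where N: "{p \<in> space (M \<Otimes>\<^sub>M M). \<not> Q p} \<subseteq> N" "emeasure (M \<Otimes>\<^sub>M M) N = 0" "N \<in> sets (M \<Otimes>\<^sub>M M)"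
    using AE_E[OF assms] .
  define K where "K x y = (indicator N (x, y) :: real)" for x y
  have K_eq: "(\<lambda>(x, y). K x y) = indicator N" by (auto simp: K_def)
  have "(indicator N :: _ \<Rightarrow> real) \<in> borel_measurable (M \<Otimes>\<^sub>M M)" using N(3) by simp
  then have K: "bdd_kernel M K"
    unfolding bdd_kernel_def bdd_fun_def K_eq by (auto intro!: exI[of _ 1] simp: indicator_def)
  have intK: "integrable (M \<Otimes>\<^sub>M M) (indicator N :: _ \<Rightarrow> real)"
    using N(3) by (simp add: integrable_indicator_iff less_top[symmetric])
  have 0: "(\<integral>x. (\<integral>y. K x y \<partial>M) \<partial>M) = 0"
  proof -
    have "(\<integral>x. (\<integral>y. K x y \<partial>M) \<partial>M) = (\<integral>p. indicator N p \<partial>(M \<Otimes>\<^sub>M M))"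
      unfolding K_def by (rule U.integral_fst'[OF intK])
    also have "\<dots> = 0" using N by (simp add: measure_def)
    finally show ?thesis .
  qed
  have avoid: "AE x in (\<Pi>\<^sub>M i\<in>{..<n}. M). (x i, x j) \<notin> N" if ij: "i < n" "j < n" "i \<noteq> j" for i j
  proof -
    have b: "bdd_fun (\<Pi>\<^sub>M i\<in>{..<n}. M) (\<lambda>x. K (x i) (x j))"
      using ij by (intro bdd_kernel_comp[OF K] measurable_component_singleton) auto
    have "(\<integral>x. K (x i) (x j) \<partial>(\<Pi>\<^sub>M i\<in>{..<n}. M)) = 0"
      using pair_integral[OF K, of i "{..<n}" j] ij 0 by simp
    then have "AE x in (\<Pi>\<^sub>M i\<in>{..<n}. M). K (x i) (x j) = 0"
      using integral_nonneg_eq_0_iff_AE[OF P.bdd_fun_integrable[OF b]] by (simp add: K_def)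
    then show ?thesis by eventually_elim (simp add: K_def indicator_def split: if_splits)
  qed
  have "AE x in (\<Pi>\<^sub>M i\<in>{..<n}. M). \<forall>e\<in>{..<n} \<times> {..<n} - Id. (x (fst e), x (snd e)) \<notin> N"
    by (rule AE_finite_allI) (auto intro: avoid)
  then show ?thesis
    using AE_space[of "\<Pi>\<^sub>M i\<in>{..<n}. M"]
  proof eventually_elim
    fix x assume a: "\<forall>e\<in>{..<n} \<times> {..<n} - Id. (x (fst e), x (snd e)) \<notin> N" and x: "x \<in> space (\<Pi>\<^sub>M i\<in>{..<n}. M)"
    show "\<forall>i<n. \<forall>j<n. i \<noteq> j \<longrightarrow> Q (x i, x j)"
    proof (intro allI impI)
      fix i j assume ij: "i < n" "j < n" "i \<noteq> j"
      then have "(x i, x j) \<notin> N" using bspec[OF a, of "(i, j)"] by simp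
      moreover have "(x i, x j) \<in> space (M \<Otimes>\<^sub>M M)"
        using x ij by (auto simp: space_PiM space_pair_measure PiE_iff)
      ultimately show "Q (x i, x j)" using N(1) by auto
    qed
  qed
qed

context tournamenton_kernel begin

lemma AE_W:
  fixes n :: nat
  shows "AE x in (\<Pi>\<^sub>M i\<in>{..<n}. unit_interval). \<forall>i<n. \<forall>j<n. i \<noteq> j \<longrightarrow> W (x i) (x j) = ww (x i) (x j)"
  using AE_PiM_pairs[OF W_AE] by simp

text \<open>For l >= 2 consecutive vertices of the walk are different coordinates, so
  almost-everywhere equality of W and \<open>ww\<close> is enough.\<close>

lemma cycle_density_eq:
  assumes l: "2 \<le> l"
  shows "cycle_density W l = 2 ^ l * cycle_integral unit_interval ww l"
proof -
  interpret P: prob_space "(\<Pi>\<^sub>M i\<in>{..<l}. unit_interval)" by (rule prob_space_power)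
  let ?g = "\<lambda>x. closed_walk (\<lambda>i j. ww (x i) (x j)) [0..<l]"
  have g: "?g \<in> borel_measurable (\<Pi>\<^sub>M i\<in>{..<l}. unit_interval)"
    by (rule bdd_fun_measurable[OF bdd_fun_closed_walk[OF bdd_ww]]) auto
  have "AE x in (\<Pi>\<^sub>M i\<in>{..<l}. unit_interval). (\<Prod>i<l. W (x i) (x (Suc i mod l))) = ?g x"
    using AE_W[of l]
  proof eventually_elim
    fix x :: "nat \<Rightarrow> real" assume e: "\<forall>i<l. \<forall>j<l. i \<noteq> j \<longrightarrow> W (x i) (x j) = ww (x i) (x j)"
    have "(\<Prod>i<l. W (x i) (x (Suc i mod l))) = closed_walk (\<lambda>i j. W (x i) (x j)) [0..<l]"
      unfolding closed_walk_def using l by (intro prod.cong) auto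
    also have "\<dots> = ?g x"
      by (rule closed_walk_cong) (use e l in auto)
    finally show "(\<Prod>i<l. W (x i) (x (Suc i mod l))) = ?g x" .
  qed
  from integral_completion_AE[OF g this] show ?thesis
    unfolding cycle_density_def unit_cube_def unit_interval_def[symmetric] cycle_integral_def by simp
qed

lemma tournament_density_eq:
  assumes n: "n = card (pverts T)"
  shows "tournament_density T W = (\<Sum>E\<in>tours n.
    of_bool (digraph_iso (with_proj (labelled n E)) (with_proj T)) * labelled_density unit_interval ww n E)"
proof -
  interpret P: prob_space "(\<Pi>\<^sub>M i\<in>{..<n}. unit_interval)" by (rule prob_space_power)
  let ?D = "unit_cube n"
  have D: "?D = completion (\<Pi>\<^sub>M i\<in>{..<n}. unit_interval)" by (simp add: unit_cube_def unit_interval_def)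
  interpret D: prob_space ?D unfolding D by (rule P.prob_space_completion)
  let ?m = "\<lambda>A x. measure (measure_pmf (random_orientation W n x)) A"
  \<comment> \<open>A Borel version of the probability that the random orientation lies in
    A.\<close>
  define G where "G A x = (\<Sum>E\<in>tours n. of_bool (labelled n E \<in> A) * (\<Prod>(i, j)\<in>E. ww (x i) (x j)))" for A x
  have bG: "bdd_fun (\<Pi>\<^sub>M i\<in>{..<n}. unit_interval) (G A)" for A
    unfolding G_def[abs_def] by (intro bdd_fun_sum bdd_fun_mult bdd_fun_const bdd_arc_prod bdd_ww toursD(1))
  have AE_G: "AE x in (\<Pi>\<^sub>M i\<in>{..<n}. unit_interval). ?m A x = G A x" for A
    using AE_W[of n] AE_space[of "(\<Pi>\<^sub>M i\<in>{..<n}. unit_interval)"]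
  proof eventually_elim
    fix x assume e: "\<forall>i<n. \<forall>j<n. i \<noteq> j \<longrightarrow> W (x i) (x j) = ww (x i) (x j)" and x: "x \<in> space (\<Pi>\<^sub>M i\<in>{..<n}. unit_interval)"
    have r: "x i \<in> {0..1}" if "i < n" for i using x that by (auto simp: space_PiM PiE_iff)
    have "?m A x = (\<Sum>X\<in>Pow (upairs n). of_bool (labelled n (orient n X) \<in> A) *
        (\<Prod>e\<in>upairs n. if e \<in> X then W (x (fst e)) (x (snd e)) else 1 - W (x (fst e)) (x (snd e))))"
      by (rule random_orientation_prob) (rule W_range; rule r)
    also have "\<dots> = (\<Sum>X\<in>Pow (upairs n). of_bool (labelled n (orient n X) \<in> A) * (\<Prod>(i, j)\<in>orient n X. ww (x i) (x j)))"
    proof (rule sum.cong[OF refl])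
      fix X assume X: "X \<in> Pow (upairs n)"
      have "(\<Prod>e\<in>upairs n. if e \<in> X then W (x (fst e)) (x (snd e)) else 1 - W (x (fst e)) (x (snd e)))
        = (\<Prod>e\<in>upairs n. if e \<in> X then ww (x (fst e)) (x (snd e)) else ww (x (snd e)) (x (fst e)))"
      proof (rule prod.cong[OF refl])
        fix p assume p: "p \<in> upairs n"
        then have "W (x (fst p)) (x (snd p)) = ww (x (fst p)) (x (snd p))" using e by (auto simp: upairs_def)
        then show "(if p \<in> X then W (x (fst p)) (x (snd p)) else 1 - W (x (fst p)) (x (snd p)))
          = (if p \<in> X then ww (x (fst p)) (x (snd p)) else ww (x (snd p)) (x (fst p)))"
          using ww_sum[of "x (fst p)" "x (snd p)"] by simp
      qed
      also have "\<dots> = (\<Prod>e\<in>upairs n \<inter> {e. e \<in> X}. ww (x (fst e)) (x (snd e))) * (\<Prod>e\<in>upairs n \<inter> - {e. e \<in> X}. ww (x (snd e)) (x (fst e)))"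
        by (rule prod.If_cases) simp
      also have "upairs n \<inter> {e. e \<in> X} = X" using X by auto
      also have "upairs n \<inter> - {e. e \<in> X} = upairs n - X" by auto
      also have "(\<Prod>e\<in>X. ww (x (fst e)) (x (snd e))) * (\<Prod>e\<in>upairs n - X. ww (x (snd e)) (x (fst e)))
        = (\<Prod>(i, j)\<in>orient n X. ww (x i) (x j))"
        using prod_orient[of X n "\<lambda>i j. ww (x i) (x j)"] X by (simp add: case_prod_beta)
      finally show "of_bool (labelled n (orient n X) \<in> A) *
          (\<Prod>e\<in>upairs n. if e \<in> X then W (x (fst e)) (x (snd e)) else 1 - W (x (fst e)) (x (snd e)))
        = of_bool (labelled n (orient n X) \<in> A) * (\<Prod>(i, j)\<in>orient n X. ww (x i) (x j))" by (simp only:)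
    qed
    also have "\<dots> = G A x"
      unfolding G_def by (rule sum.reindex_bij_betw[OF orient_bij])
    finally show "?m A x = G A x" .
  qed
  \<comment> \<open>The exact probability is only almost everywhere equal to \<open>G A\<close>,
    which suffices on the completed cube. Measurability of the random orientation as a kernel,
    required for \<open>bind\<close>, rests on this.\<close>
  have mD: "?m A \<in> borel_measurable ?D" for A
    unfolding D by (rule measurable_completion_AE[OF bdd_fun_measurable[OF bG] AE_G])
  have K: "(\<lambda>x. measure_pmf (random_orientation W n x)) \<in> ?D \<rightarrow>\<^sub>M subprob_algebra (count_space UNIV)"
  proof (rule measurable_subprob_algebra)
    show "subprob_space (measure_pmf (random_orientation W n x))" for x
      by (rule prob_space_imp_subprob_space[OF measure_pmf.prob_space_axioms])
    show "(\<lambda>x. emeasure (measure_pmf (random_orientation W n x)) A) \<in> borel_measurable ?D" for A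
      unfolding measure_pmf.emeasure_eq_measure by (rule measurable_compose[OF mD measurable_ennreal])
  qed simp
  let ?A = "{S. digraph_iso (with_proj S) (with_proj T)}"
  have "tournament_density T W = measure (?D \<bind> (\<lambda>x. measure_pmf (random_orientation W n x))) ?A"
    by (simp add: tournament_density_def random_tournament_def n)
  also have "\<dots> = (\<integral>x. ?m ?A x \<partial>?D)"
    by (rule D.measure_bind[OF K]) simp
  also have "\<dots> = (\<integral>x. G ?A x \<partial>(\<Pi>\<^sub>M i\<in>{..<n}. unit_interval))"
    unfolding D by (rule integral_completion_AE[OF bdd_fun_measurable[OF bG] AE_G])
  also have "\<dots> = (\<Sum>E\<in>tours n. of_bool (labelled n E \<in> ?A) * labelled_density unit_interval ww n E)"
  proof -
    have "integrable (\<Pi>\<^sub>M i\<in>{..<n}. unit_interval) (\<lambda>x. \<Prod>(i, j)\<in>E. ww (x i) (x j))" if "E \<in> tours n" for E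
      by (rule P.bdd_fun_integrable[OF bdd_arc_prod[OF bdd_ww toursD(1)[OF that]]])
    then show ?thesis
      unfolding G_def labelled_density_def by (subst Bochner_Integration.integral_sum) simp_all
  qed
  finally show ?thesis by simp
qed

end

section \<open>Isomorphism classes and labelled tournaments\<close>

lemma digraph_iso_labelledD:
  assumes "digraph_iso (with_proj (labelled n F)) (with_proj (labelled n E))"
  shows "\<exists>\<sigma>. bij_betw \<sigma> {..<n} {..<n} \<and> E = map_prod \<sigma> \<sigma> ` F"
proof -
  obtain f where f: "pre_digraph.digraph_isomorphism (with_proj (labelled n F)) f"
      and eq: "with_proj (labelled n E) = app_iso f (with_proj (labelled n F))"
    using assms by (auto simp: digraph_iso_def)
  let ?\<sigma> = "iso_verts f"
  have v: "{..<n} = ?\<sigma> ` {..<n}" using arg_cong[OF eq, of verts] by (simp add: app_iso_def)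
  have a: "E = iso_arcs f ` F" using arg_cong[OF eq, of arcs] by (simp add: app_iso_def)
  \<comment> \<open>Both digraphs have the projections as tail and head maps, so an arc must go to
    the pair of the images of its ends.\<close>
  have t: "fst = iso_tail f" using arg_cong[OF eq, of tail] by (simp add: app_iso_def)
  have h: "snd = iso_head f" using arg_cong[OF eq, of head] by (simp add: app_iso_def)
  have inj: "inj_on ?\<sigma> {..<n}" and
      m: "\<forall>a\<in>F. ?\<sigma> (fst a) = iso_tail f (iso_arcs f a) \<and> ?\<sigma> (snd a) = iso_head f (iso_arcs f a)"
    using f by (simp_all add: pre_digraph.digraph_isomorphism_def)
  have "iso_arcs f e = map_prod ?\<sigma> ?\<sigma> e" if "e \<in> F" for e
    using bspec[OF m that] unfolding t[symmetric] h[symmetric] by (simp add: prod_eq_iff)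
  then have "E = map_prod ?\<sigma> ?\<sigma> ` F" unfolding a by (rule image_cong[OF refl])
  then show ?thesis using inj v by (auto simp: bij_betw_def)
qed

lemma digraph_iso_labelled_refl:
  assumes E: "E \<in> tours n"
  shows "digraph_iso (with_proj (labelled n E)) (with_proj (labelled n E))"
proof -
  have "wf_digraph (with_proj (labelled n E))"
    by unfold_locales (use toursD(1)[OF E] in auto)
  then show ?thesis
    unfolding digraph_iso_def pre_digraph.digraph_isomorphism_def
    by (intro exI[of _ "\<lparr>iso_verts = id, iso_arcs = id, iso_head = snd, iso_tail = fst\<rparr>"])
      (simp add: app_iso_def with_proj_def)
qed

text \<open>Isomorphic labelled tournaments differ by a permutation of the independent points, so
  all summands agree.\<close>

lemma (in tournamenton_kernel) tournament_density_labelled: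
  assumes E: "E \<in> tours n"
  shows "tournament_density (labelled n E) W
    = real (card {F \<in> tours n. digraph_iso (with_proj (labelled n F)) (with_proj (labelled n E))})
      * labelled_density unit_interval ww n E"
proof -
  have "tournament_density (labelled n E) W = (\<Sum>F\<in>tours n.
      of_bool (digraph_iso (with_proj (labelled n F)) (with_proj (labelled n E))) * labelled_density unit_interval ww n F)"
    by (rule tournament_density_eq) simp
  also have "\<dots> = (\<Sum>F\<in>tours n.
      of_bool (digraph_iso (with_proj (labelled n F)) (with_proj (labelled n E))) * labelled_density unit_interval ww n E)"
  proof (rule sum.cong[OF refl])
    fix F assume F: "F \<in> tours n"
    show "of_bool (digraph_iso (with_proj (labelled n F)) (with_proj (labelled n E))) * labelled_density unit_interval ww n F
      = of_bool (digraph_iso (with_proj (labelled n F)) (with_proj (labelled n E))) * labelled_density unit_interval ww n E"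
    proof (cases "digraph_iso (with_proj (labelled n F)) (with_proj (labelled n E))")
      case True
      then obtain \<sigma> where "bij_betw \<sigma> {..<n} {..<n}" "E = map_prod \<sigma> \<sigma> ` F"
        using digraph_iso_labelledD by blast
      then have "labelled_density unit_interval ww n E = labelled_density unit_interval ww n F"
        using labelled_density_relabel[OF bdd_ww F] by simp
      then show ?thesis by simp
    qed simp
  qed
  finally show ?thesis by (simp add: sum_distrib_right[symmetric] Int_def)
qed

text \<open>Labelled densities are constant on isomorphism classes, and each class contains at least
  the given tournament. Dividing by its size recovers them from the unlabelled densities.\<close>

lemma weakly_isomorphic_iff:
  assumes "tournamenton_kernel S W" "tournamenton_kernel S' W'"
  shows "weakly_isomorphic W W' \<longleftrightarrow> (\<forall>n. \<forall>E\<in>tours n.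
    labelled_density unit_interval (bounded_skew_kernel.ww S) n E = labelled_density unit_interval (bounded_skew_kernel.ww S') n E)"
proof -
  interpret A: tournamenton_kernel S W by (rule assms)
  interpret B: tournamenton_kernel S' W' by (rule assms)
  show ?thesis
  proof
    assume w: "weakly_isomorphic W W'"
    show "\<forall>n. \<forall>E\<in>tours n. labelled_density unit_interval A.ww n E = labelled_density unit_interval B.ww n E"
    proof (intro allI ballI)
      fix n E assume E: "E \<in> tours n"
      let ?F = "{F \<in> tours n. digraph_iso (with_proj (labelled n F)) (with_proj (labelled n E))}"
      have "E \<in> ?F" using E digraph_iso_labelled_refl[OF E] by blast
      then have "card ?F \<noteq> 0" by (subst card_0_eq) auto
      then have ne: "real (card ?F) \<noteq> 0" by (simp only: of_nat_eq_0_iff not_False_eq_True)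
      have "tournament_density (labelled n E) W = tournament_density (labelled n E) W'"
        using w tournament_labelled[OF E] unfolding weakly_isomorphic_def by blast
      then show "labelled_density unit_interval A.ww n E = labelled_density unit_interval B.ww n E"
        unfolding A.tournament_density_labelled[OF E] B.tournament_density_labelled[OF E]
        by (rule iffD1[OF mult_left_cancel[OF ne]])
    qed
  next
    assume "\<forall>n. \<forall>E\<in>tours n. labelled_density unit_interval A.ww n E = labelled_density unit_interval B.ww n E"
    then show "weakly_isomorphic W W'"
      unfolding weakly_isomorphic_def
      by (simp add: A.tournament_density_eq[OF refl] B.tournament_density_eq[OF refl])
  qed
qed

text \<open>For each pair not on the cycle the closed walk is multiplied by
  \<open>w i j + w j i = 1\<close>, and the product is expanded. The sum then runs over all
  tournaments that contain the cycle.\<close>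

lemma closed_walk_sum_tours:
  fixes w :: "nat \<Rightarrow> nat \<Rightarrow> real"
  assumes w: "\<And>i j. w i j + w j i = 1" and l: "3 \<le> l"
  shows "closed_walk w [0..<l] = (\<Sum>E\<in>{E \<in> tours l. arc_set [0..<l] \<subseteq> E}. \<Prod>(i, j)\<in>E. w i j)"
proof -
  define C where "C = arc_set [0..<l]"
  have C_eq: "C = (\<lambda>i. (i, Suc i mod l)) ` {..<l}"
    unfolding C_def arc_set_index using l by (intro image_cong) auto
  have C_mem: "(i, j) \<in> C \<longleftrightarrow> i < l \<and> j = (if Suc i = l then 0 else Suc i)" for i j
    unfolding C_eq by (auto simp: mod_Suc)
  have C_lt: "i < l" "j < l" "i \<noteq> j" "(j, i) \<notin> C" if "(i, j) \<in> C" for i j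
    using that l unfolding C_mem by (auto split: if_splits)
  have finC: "finite C" unfolding C_eq by simp
  \<comment> \<open>With the reversed cycle arcs set to 0, the sum over all tournaments keeps
    exactly those that contain C, and it still factorises over pairs.\<close>
  define v where "v i j = (if (j, i) \<in> C then 0 else w i j)" for i j
  have "(\<Sum>E\<in>tours l. \<Prod>(i, j)\<in>E. v i j) = (\<Sum>E\<in>tours l. if C \<subseteq> E then \<Prod>(i, j)\<in>E. w i j else 0)"
  proof (rule sum.cong[OF refl])
    fix E assume E: "E \<in> tours l"
    show "(\<Prod>(i, j)\<in>E. v i j) = (if C \<subseteq> E then \<Prod>(i, j)\<in>E. w i j else 0)"
    proof (cases "C \<subseteq> E")
      case True
      have "v i j = w i j" if ij: "(i, j) \<in> E" for i j
      proof -
        have "(j, i) \<notin> C"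
        proof
          assume c: "(j, i) \<in> C"
          then have "(j, i) \<in> E" using True by blast
          then show False using toursD(3)[OF E, of i j] C_lt[OF c] ij by simp
        qed
        then show ?thesis by (simp add: v_def)
      qed
      then have "(\<Prod>(i, j)\<in>E. v i j) = (\<Prod>(i, j)\<in>E. w i j)" by (intro prod.cong refl) auto
      then show ?thesis using True by simp
    next
      case False
      then obtain i j where ij: "(i, j) \<in> C" "(i, j) \<notin> E" by (auto simp: subset_iff)
      then have "(j, i) \<in> E" using toursD(3)[OF E, of i j] C_lt[OF ij(1)] by simp
      moreover have "v j i = 0" using ij by (simp add: v_def)
      ultimately have "(\<Prod>(i, j)\<in>E. v i j) = 0"
        by (intro prod_zero[OF finite_arcs[OF E]]) (auto intro!: bexI[of _ "(j, i)"])
      then show ?thesis using False by simp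
    qed
  qed
  also have "\<dots> = (\<Sum>E\<in>{E \<in> tours l. C \<subseteq> E}. \<Prod>(i, j)\<in>E. w i j)"
    by (rule sum.inter_filter[symmetric]) simp
  finally have sum: "(\<Sum>E\<in>{E \<in> tours l. C \<subseteq> E}. \<Prod>(i, j)\<in>E. w i j) = (\<Prod>(i, j)\<in>upairs l. v i j + v j i)"
    unfolding sum_tours_prod by simp
  \<comment> \<open>A pair on the cycle contributes the weight of its cycle arc, any other pair
    contributes 1. Since l >= 3, no pair carries two cycle arcs.\<close>
  have "v i j + v j i = (if (i, j) \<in> C then w i j else 1) * (if (j, i) \<in> C then w j i else 1)" for i j
    using C_lt(4)[of i j] w[of i j] by (auto simp: v_def)
  then have "(\<Prod>(i, j)\<in>upairs l. v i j + v j i)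
      = (\<Prod>e\<in>upairs l. if e \<in> C then w (fst e) (snd e) else 1)
        * (\<Prod>e\<in>upairs l. if e \<in> prod.swap ` C then w (snd e) (fst e) else 1)"
    unfolding prod.distrib[symmetric] by (intro prod.cong) (force simp: prod.swap_def)+
  also have "(\<Prod>e\<in>upairs l. if e \<in> C then w (fst e) (snd e) else 1) = (\<Prod>e\<in>upairs l \<inter> C. w (fst e) (snd e))"
    by (rule prod.inter_restrict[symmetric]) simp
  also have "(\<Prod>e\<in>upairs l. if e \<in> prod.swap ` C then w (snd e) (fst e) else 1) = (\<Prod>e\<in>upairs l \<inter> prod.swap ` C. w (snd e) (fst e))"
    by (rule prod.inter_restrict[symmetric]) simp
  also have "upairs l \<inter> prod.swap ` C = prod.swap ` (C - upairs l)"
  proof (intro set_eqI iffI)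
    fix e assume "e \<in> upairs l \<inter> prod.swap ` C"
    then show "e \<in> prod.swap ` (C - upairs l)" by (auto simp: upairs_def prod.swap_def)
  next
    fix e assume "e \<in> prod.swap ` (C - upairs l)"
    then obtain i j where ij: "(i, j) \<in> C" "(i, j) \<notin> upairs l" "e = (j, i)" by (auto simp: prod.swap_def)
    then have "(j, i) \<in> upairs l" using C_lt[OF ij(1)] by (auto simp: upairs_def)
    then show "e \<in> upairs l \<inter> prod.swap ` C" using ij by (force simp: prod.swap_def)
  qed
  also have "(\<Prod>e\<in>prod.swap ` (C - upairs l). w (snd e) (fst e)) = (\<Prod>e\<in>C - upairs l. w (fst e) (snd e))"
    by (subst prod.reindex) (auto simp: inj_on_def prod.swap_def)
  also have "upairs l \<inter> C = C \<inter> upairs l" by (rule Int_commute)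
  also have "(\<Prod>e\<in>C \<inter> upairs l. w (fst e) (snd e)) * (\<Prod>e\<in>C - upairs l. w (fst e) (snd e)) = (\<Prod>e\<in>C. w (fst e) (snd e))"
    by (rule prod.Int_Diff[OF finC, symmetric])
  also have "\<dots> = (\<Prod>i<l. w i (Suc i mod l))"
    unfolding C_eq by (subst prod.reindex) (auto simp: inj_on_def)
  also have "\<dots> = closed_walk w [0..<l]"
    unfolding closed_walk_def using l by (intro prod.cong) auto
  finally show ?thesis using sum by (simp add: C_def)
qed

lemma (in bounded_skew_kernel) cycle_integral_sum_tours:
  assumes l: "3 \<le> l"
  shows "cycle_integral M ww l = (\<Sum>E\<in>{E \<in> tours l. arc_set [0..<l] \<subseteq> E}. labelled_density M ww l E)"
proof -
  interpret P: prob_space "\<Pi>\<^sub>M i\<in>{..<l}. M" by (rule prob_space_power)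
  have "closed_walk (\<lambda>i j. ww (x i) (x j)) [0..<l]
      = (\<Sum>E\<in>{E \<in> tours l. arc_set [0..<l] \<subseteq> E}. \<Prod>(i, j)\<in>E. ww (x i) (x j))" for x
    by (rule closed_walk_sum_tours[OF _ l]) (rule ww_sum)
  moreover have "integrable (\<Pi>\<^sub>M i\<in>{..<l}. M) (\<lambda>x. \<Prod>(i, j)\<in>E. ww (x i) (x j))" if "E \<in> {E \<in> tours l. arc_set [0..<l] \<subseteq> E}" for E
    using that by (intro P.bdd_fun_integrable bdd_arc_prod bdd_ww) (auto dest: toursD(1))
  ultimately show ?thesis
    unfolding cycle_integral_def labelled_density_def by (simp only: Bochner_Integration.integral_sum)
qed

section \<open>The carousel\<close>

text \<open>A difference instead of \<open>2 * carousel x y - 1\<close>, so that skewness holds at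
  every point, including the corners (0, 1) and (1, 0).\<close>

definition carousel_skew :: "real \<Rightarrow> real \<Rightarrow> real" where
  "carousel_skew x y = carousel x y - carousel y x"

lemma carousel_range: "0 \<le> carousel x y" "carousel x y \<le> 1"
  by (simp_all add: carousel_def)

lemma bdd_kernel_carousel: "bdd_kernel unit_interval carousel"
proof -
  have [measurable]: "fst \<in> borel_measurable (unit_interval \<Otimes>\<^sub>M unit_interval)" "snd \<in> borel_measurable (unit_interval \<Otimes>\<^sub>M unit_interval)"
    using measurable_compose[OF measurable_fst measurable_unit_interval_borel]
      measurable_compose[OF measurable_snd measurable_unit_interval_borel] by simp_all
  have "(\<lambda>p. carousel (fst p) (snd p)) = (\<lambda>p. if fst p = snd p then 1 / 2
      else if fst p - 1 < snd p \<and> snd p < fst p - 1 / 2 \<or> fst p < snd p \<and> snd p \<le> fst p + 1 / 2 then 1 else 0)"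
    by (auto simp: carousel_def)
  moreover have "\<dots> \<in> borel_measurable (unit_interval \<Otimes>\<^sub>M unit_interval)" by measurable
  ultimately have "(\<lambda>p. carousel (fst p) (snd p)) \<in> borel_measurable (unit_interval \<Otimes>\<^sub>M unit_interval)" by simp
  then show ?thesis
    unfolding bdd_kernel_def bdd_fun_def case_prod_unfold
    using carousel_range by (auto intro!: exI[of _ 1] simp: abs_le_iff)
qed

lemma carousel_less:
  assumes "0 \<le> x" "x < y" "y < 1"
  shows "carousel x y = (if y \<le> x + 1 / 2 then 1 else 0)" "carousel y x = (if y \<le> x + 1 / 2 then 0 else 1)"
  using assms by (simp_all add: carousel_def)

lemma carousel_sum:
  assumes "x \<in> {0..<1}" "y \<in> {0..<1}"
  shows "carousel x y + carousel y x = 1"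
proof (cases x y rule: linorder_cases)
  case less
  then show ?thesis using carousel_less[of x y] assms by simp
next
  case equal
  then show ?thesis by (simp add: carousel_def)
next
  case greater
  then show ?thesis using carousel_less[of y x] assms by simp
qed

text \<open>The excluded null set contains the end point 1, the diagonal and the antipodal pairs,
  where the carousel is not locally constant or its two values do not sum to 1.\<close>

lemma AE_unit_square_generic:
  "AE p in (unit_interval \<Otimes>\<^sub>M unit_interval). fst p \<in> {0..<1} \<and> snd p \<in> {0..<1} \<and> fst p \<noteq> snd p \<and> \<bar>fst p - snd p\<bar> \<noteq> 1 / 2"
proof -
  interpret U: pair_sigma_finite unit_interval unit_interval by (rule pair_sigma_finite_unit_interval)
  let ?P = "\<lambda>p :: real \<times> real. fst p \<in> {0..<1} \<and> snd p \<in> {0..<1} \<and> fst p \<noteq> snd p \<and> \<bar>fst p - snd p\<bar> \<noteq> 1 / 2"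
  have [measurable]: "fst \<in> borel_measurable (unit_interval \<Otimes>\<^sub>M unit_interval)" "snd \<in> borel_measurable (unit_interval \<Otimes>\<^sub>M unit_interval)"
    using measurable_compose[OF measurable_fst measurable_unit_interval_borel]
      measurable_compose[OF measurable_snd measurable_unit_interval_borel] by simp_all
  have ne: "AE x in unit_interval. x \<noteq> c" for c by (rule AE_unit_interval[OF AE_lborel_singleton])
  have "AE x in unit_interval. AE y in unit_interval. ?P (x, y)"
    using ne[of 1] AE_space[of unit_interval]
  proof eventually_elim
    fix x :: real assume x: "x \<noteq> 1" "x \<in> space unit_interval"
    show "AE y in unit_interval. ?P (x, y)"
      using ne[of 1] ne[of x] ne[of "x + 1 / 2"] ne[of "x - 1 / 2"] AE_space[of unit_interval]
    proof eventually_elim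
      fix y :: real assume "y \<noteq> 1" "y \<noteq> x" "y \<noteq> x + 1 / 2" "y \<noteq> x - 1 / 2" "y \<in> space unit_interval"
      then show "?P (x, y)" using x by (auto simp: abs_if)
    qed
  qed
  moreover have "{p \<in> space (unit_interval \<Otimes>\<^sub>M unit_interval). ?P p} \<in> sets (unit_interval \<Otimes>\<^sub>M unit_interval)"
    unfolding atLeastLessThan_iff by measurable
  ultimately show ?thesis using U.AE_pair_measure[where P = ?P] by blast
qed

lemma tournamenton_kernel_carousel: "tournamenton_kernel carousel_skew carousel"
proof -
  interpret U: prob_space unit_interval by (rule prob_space_unit_interval)
  have "bdd_kernel unit_interval (\<lambda>x y. carousel x y + (- 1) * carousel y x)"
    by (intro bdd_kernel_add bdd_kernel_mult bdd_kernel_const bdd_kernel_carousel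
        bdd_kernel_swap[OF bdd_kernel_carousel])
  then have ker: "bdd_kernel unit_interval carousel_skew" by (simp add: carousel_skew_def[abs_def])
  interpret K: bounded_skew_kernel unit_interval carousel_skew
  proof unfold_locales
    show "skew carousel_skew" by (simp add: skew_def carousel_skew_def)
    show "bdd_kernel unit_interval carousel_skew" by (rule ker)
    show "\<bar>carousel_skew x y\<bar> \<le> 1" for x y
      using carousel_range[of x y] carousel_range[of y x] by (simp add: carousel_skew_def abs_le_iff)
  qed
  have "AE p in (unit_interval \<Otimes>\<^sub>M unit_interval). carousel (fst p) (snd p) = K.ww (fst p) (snd p)"
    using AE_unit_square_generic
  proof eventually_elim
    fix p :: "real \<times> real"
    assume "fst p \<in> {0..<1} \<and> snd p \<in> {0..<1} \<and> fst p \<noteq> snd p \<and> \<bar>fst p - snd p\<bar> \<noteq> 1 / 2"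
    then have "carousel (fst p) (snd p) + carousel (snd p) (fst p) = 1" by (intro carousel_sum) auto
    then show "carousel (fst p) (snd p) = K.ww (fst p) (snd p)" by (simp add: K.ww_def carousel_skew_def)
  qed
  then show ?thesis
    using carousel_range
    by (intro tournamenton_kernel.intro tournamenton_kernel_axioms.intro K.bounded_skew_kernel_axioms) auto
qed

lemma integral_carousel:
  assumes x: "0 < x" "x < 1" "x \<noteq> 1 / 2"
  shows "(\<integral>y. carousel x y \<partial>unit_interval) = 1 / 2"
proof -
  let ?A = "{x - 1<..<x - 1 / 2} \<union> {x<..x + 1 / 2}"
  have m: "(\<lambda>y. carousel x y) \<in> borel_measurable unit_interval"
    using bdd_fun_measurable[OF bdd_kernel_section[OF bdd_kernel_carousel]] x by simp
  have A: "?A \<in> sets borel" by simp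
  have "AE y in unit_interval. carousel x y = indicator ?A y"
    using AE_unit_interval[OF AE_lborel_singleton[of x]]
    by eventually_elim (auto simp: carousel_def indicator_def)
  then have "(\<integral>y. carousel x y \<partial>unit_interval) = (\<integral>y. indicator ?A y \<partial>unit_interval)"
    by (intro integral_cong_AE m measurable_compose[OF measurable_unit_interval_borel]
        borel_measurable_indicator A)
  also have "\<dots> = measure lborel (?A \<inter> {0..1})"
    using measure_unit_interval[OF A] by simp
  also have "\<dots> = 1 / 2"
  proof (cases "x < 1 / 2")
    case True
    then have "?A \<inter> {0..1} = {x<..x + 1 / 2}" using x by auto
    then show ?thesis by simp
  next
    case False
    then have "?A \<inter> {0..1} = {0..<x - 1 / 2} \<union> {x<..1}" using x by auto
    also have "measure lborel \<dots> = measure lborel {0..<x - 1 / 2} + measure lborel {x<..1}"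
      using x False by (intro measure_Union) auto
    finally show ?thesis using x False by simp
  qed
  finally show ?thesis .
qed

text \<open>Identifying antipodal points turns the carousel into a switching of the linear order.\<close>

lemma carousel_switch:
  fixes s t :: real
  defines "e \<equiv> \<lambda>u :: real. if u < 1 / 2 then 1 else - 1 :: real"
    and "f \<equiv> \<lambda>u :: real. if u < 1 / 2 then u else u - 1 / 2"
  assumes st: "s \<in> {0..<1}" "t \<in> {0..<1}" "s \<noteq> t" "\<bar>s - t\<bar> \<noteq> 1 / 2"
  shows "carousel_skew s t = e s * e t * sgn (f t - f s)"
proof -
  have lt: "carousel_skew s t = e s * e t * sgn (f t - f s)"
    if l: "0 \<le> s" "s < t" "t < 1" "t \<noteq> s + 1 / 2" for s t :: real
  proof -
    have S: "carousel_skew s t = (if t \<le> s + 1 / 2 then 1 else - 1)"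
      using carousel_less[OF l(1-3)] by (simp add: carousel_skew_def)
    \<comment> \<open>Within one half the two signs agree and the order is kept. Across the halves s
      beats t iff t - 1/2 precedes s, so both the order and the sign are reversed.\<close>
    consider "t < 1 / 2" | "s < 1 / 2" "1 / 2 \<le> t" | "1 / 2 \<le> s" by linarith
    then show ?thesis
      unfolding S using l by cases (auto simp: e_def f_def sgn_if)
  qed
  show ?thesis
  proof (cases s t rule: linorder_cases)
    case less
    then show ?thesis using st by (intro lt) (auto simp: abs_if)
  next
    case greater
    have "carousel_skew s t = - carousel_skew t s" by (simp add: carousel_skew_def)
    also have "carousel_skew t s = e t * e s * sgn (f s - f t)"
      using st greater by (intro lt) (auto simp: abs_if)
    also have "sgn (f s - f t) = - sgn (f t - f s)" by (simp add: sgn_minus[symmetric])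
    finally show ?thesis by simp
  qed (use st in simp)
qed

text \<open>A linear order has no cyclic triangles at all.\<close>

lemma c4_sgn:
  assumes "distinct [f a, f b, f c, f d]"
  shows "c4 (\<lambda>i j. sgn (f j - f i :: real)) a b c d = 1"
proof -
  have "f a < f b \<or> f b < f a" "f a < f c \<or> f c < f a" "f a < f d \<or> f d < f a"
    "f b < f c \<or> f c < f b" "f b < f d \<or> f d < f b" "f c < f d \<or> f d < f c"
    using assms by auto
  then show ?thesis
    unfolding c4_eq by (elim disjE; (linarith | simp add: sgn_if))
qed

lemma extremal_carousel: "bounded_skew_kernel.extremal unit_interval carousel_skew"
proof -
  interpret C: tournamenton_kernel carousel_skew carousel by (rule tournamenton_kernel_carousel)
  interpret P: prob_space "(\<Pi>\<^sub>M i\<in>{..<4::nat}. unit_interval)" by (rule C.prob_space_power)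
  have ne: "AE x in unit_interval. x \<noteq> c" for c by (rule AE_unit_interval[OF AE_lborel_singleton])
  \<comment> \<open>Regularity: the out-neighbours of a generic point fill half of the
    circle.\<close>
  have "AE x in unit_interval. (C.vec 1 x)\<^sup>2 = 0"
    using ne[of 0] ne[of 1] ne[of "1 / 2"] AE_space[of unit_interval]
  proof eventually_elim
    fix x :: real assume x': "x \<noteq> 0" "x \<noteq> 1" "x \<noteq> 1 / 2" "x \<in> space unit_interval"
    then have x: "0 < x" "x < 1" by auto
    have b: "bdd_fun unit_interval (carousel x)" by (rule bdd_kernel_section[OF bdd_kernel_carousel x'(4)])
    have "AE y in unit_interval. carousel_skew x y = 2 * carousel x y - 1"
      using ne[of 1] AE_space[of unit_interval]
    proof eventually_elim
      fix y :: real assume "y \<noteq> 1" "y \<in> space unit_interval"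
      then have "carousel x y + carousel y x = 1" using x by (intro carousel_sum) auto
      then show "carousel_skew x y = 2 * carousel x y - 1" by (simp add: carousel_skew_def)
    qed
    then have "(\<integral>y. carousel_skew x y \<partial>unit_interval) = (\<integral>y. 2 * carousel x y - 1 \<partial>unit_interval)"
      by (intro integral_cong_AE bdd_fun_measurable bdd_fun_diff bdd_fun_mult bdd_fun_const b
          bdd_kernel_section[OF C.bdd x'(4)])
    also have "\<dots> = 0"
      using C.bdd_fun_integrable[OF b] integral_carousel[OF x x'(3)] C.prob_space by simp
    finally show "(C.vec 1 x)\<^sup>2 = 0" by (simp add: C.vec_Suc[of 0, simplified] kernel_op_def)
  qed
  then have tt: "C.tt = 0" unfolding C.tt_def by (rule integral_eq_zero_AE)
  \<comment> \<open>Folding antipodal points together switches the sampled carousel into a linear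
    order, and switching leaves \<open>c4\<close> unchanged.\<close>
  have "AE x in (\<Pi>\<^sub>M i\<in>{..<4::nat}. unit_interval). c4 (\<lambda>i j. carousel_skew (x i) (x j)) 0 1 2 3 = 1"
    using C.AE_PiM_pairs[OF AE_unit_square_generic, of 4]
  proof eventually_elim
    fix x :: "nat \<Rightarrow> real"
    assume g: "\<forall>i<4. \<forall>j<4. i \<noteq> j \<longrightarrow> fst (x i, x j) \<in> {0..<1} \<and> snd (x i, x j) \<in> {0..<1} \<and>
        fst (x i, x j) \<noteq> snd (x i, x j) \<and> \<bar>fst (x i, x j) - snd (x i, x j)\<bar> \<noteq> 1 / 2"
    define e where "e i = (if x i < 1 / 2 then 1 else - 1 :: real)" for i
    define f where "f i = (if x i < 1 / 2 then x i else x i - 1 / 2)" for i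
    have gij: "x i \<in> {0..<1}" "x j \<in> {0..<1}" "x i \<noteq> x j" "\<bar>x i - x j\<bar> \<noteq> 1 / 2"
      if "i < 4" "j < 4" "i \<noteq> j" for i j
      using g[rule_format, OF that] by simp_all
    have "c4 (\<lambda>i j. carousel_skew (x i) (x j)) 0 1 2 3 = c4 (\<lambda>i j. sgn (f j - f i)) 0 1 2 (3 :: nat)"
    proof (rule c4_switch[where e = e])
      fix i j :: nat assume "i \<in> {0, 1, 2, 3}" "j \<in> {0, 1, 2, 3}" and "i \<noteq> j"
      then have "i < 4" "j < 4" by auto
      from carousel_switch[OF gij[OF this \<open>i \<noteq> j\<close>]]
      show "carousel_skew (x i) (x j) = e i * e j * sgn (f j - f i)" by (simp only: e_def f_def)
    qed (auto simp: e_def)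
    also have "\<dots> = 1"
    proof (rule c4_sgn)
      have "f i \<noteq> f j" if "i < 4" "j < 4" "i \<noteq> j" for i j
        using gij[OF that] by (auto simp: f_def abs_if split: if_splits)
      then show "distinct [f 0, f 1, f 2, f 3]" by simp
    qed
    finally show "c4 (\<lambda>i j. carousel_skew (x i) (x j)) 0 1 2 3 = 1" .
  qed
  then have "(\<integral>x. c4 (\<lambda>i j. carousel_skew (x i) (x j)) 0 1 2 3 \<partial>(\<Pi>\<^sub>M i\<in>{..<4::nat}. unit_interval)) = (\<integral>x. 1 \<partial>(\<Pi>\<^sub>M i\<in>{..<4::nat}. unit_interval))"
    by (intro integral_cong_AE bdd_fun_measurable[OF C.bdd_c4] borel_measurable_const) auto
  also have "\<dots> = 1" using P.prob_space by simp
  finally have "cycle_integral unit_interval carousel_skew 4 = 1 / 3"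
    using C.integral_c4[of "0::nat" 1 2 3 "{..<4}"] by simp
  then show ?thesis using tt by (simp add: C.extremal_def)
qed

theorem theorem21:
  fixes W :: "real \<Rightarrow> real \<Rightarrow> real"
  assumes "tournamenton W"
  shows "cycle_limit 4 = 4 / 3 \<and> (cycle_density W 4 = cycle_limit 4 \<longleftrightarrow> weakly_isomorphic W carousel)
       \<and> cycle_limit 8 = 332 / 315 \<and> (cycle_density W 8 = cycle_limit 8 \<longleftrightarrow> weakly_isomorphic W carousel)"
proof -
  obtain S where S: "tournamenton_kernel S W" using tournamenton_kernel_exists[OF assms] by blast
  interpret K: tournamenton_kernel S W by (rule S)
  interpret C: tournamenton_kernel carousel_skew carousel by (rule tournamenton_kernel_carousel)
  have C_ext: "C.extremal" by (rule extremal_carousel)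
  have c: "2 ^ 4 * cycle_integral unit_interval C.ww 4 = 4 / 3" "2 ^ 8 * cycle_integral unit_interval C.ww 8 = 332 / 315"
    using C.cycle_density_bounds(2,4) C_ext by blast+
  have bound: "2 ^ 4 * cycle_integral (measure_pmf (pmf_of_set {..<n})) (\<lambda>x y. (1 + S' x y) / 2) 4 \<le> 4 / 3"
      "2 ^ 8 * cycle_integral (measure_pmf (pmf_of_set {..<n})) (\<lambda>x y. (1 + S' x y) / 2) 8 \<le> 332 / 315"
    if "bounded_skew_kernel (measure_pmf (pmf_of_set {..<n::nat})) S'" for n S'
  proof -
    have "bounded_skew_kernel.ww S' = (\<lambda>x y. (1 + S' x y) / 2)"
      by (intro ext) (rule bounded_skew_kernel.ww_def[OF that])
    with bounded_skew_kernel.cycle_density_bounds(1,3)[OF that]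
    show "2 ^ 4 * cycle_integral (measure_pmf (pmf_of_set {..<n})) (\<lambda>x y. (1 + S' x y) / 2) 4 \<le> 4 / 3"
      "2 ^ 8 * cycle_integral (measure_pmf (pmf_of_set {..<n})) (\<lambda>x y. (1 + S' x y) / 2) 8 \<le> 332 / 315"
      by simp_all
  qed
  have lim: "cycle_limit 4 = 4 / 3" "cycle_limit 8 = 332 / 315"
    using C.cycle_limit_eq[OF C_ext _ c(1) bound(1)] C.cycle_limit_eq[OF C_ext _ c(2) bound(2)] by simp_all
  \<comment> \<open>The 4-cycles suffice here for both lengths: the four-vertex densities give W the
    cycle density of the carousel, and equality for length 4 already characterises
    \<open>extremal\<close>.\<close>
  have "K.extremal" if w: "weakly_isomorphic W carousel"
  proof -
    have "\<forall>E\<in>tours 4. labelled_density unit_interval K.ww 4 E = labelled_density unit_interval C.ww 4 E"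
      using w unfolding weakly_isomorphic_iff[OF S tournamenton_kernel_carousel] by blast
    then have "cycle_integral unit_interval K.ww 4 = cycle_integral unit_interval C.ww 4"
      unfolding K.cycle_integral_sum_tours[of 4, simplified] C.cycle_integral_sum_tours[of 4, simplified]
      by (intro sum.cong) auto
    then show ?thesis using c(1) K.cycle_density_bounds(2) by simp
  qed
  moreover have "weakly_isomorphic W carousel" if "K.extremal"
    unfolding weakly_isomorphic_iff[OF S tournamenton_kernel_carousel]
    using K.labelled_density_extremal[OF that] C.labelled_density_extremal[OF C_ext] by simp
  ultimately have weak: "weakly_isomorphic W carousel \<longleftrightarrow> K.extremal" by blast
  have "cycle_density W 4 = 4 / 3 \<longleftrightarrow> K.extremal" "cycle_density W 8 = 332 / 315 \<longleftrightarrow> K.extremal"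
    using K.cycle_density_bounds(2,4) K.cycle_density_eq[of 4] K.cycle_density_eq[of 8] by simp_all
  then show ?thesis unfolding lim weak by blast
qed

end
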